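(* Let $d\geqslant 2$ be an integer. For every real $\alpha\in(1/2,1)$, $$\dim\mathscr{F}_{d,\alpha}\leqslant\frac{(1+s_0)(1-\alpha)}{d+1-\alpha},\qquad\text{where } s_0=d(d-1)+\min_{r=1,\ldots,d}\frac{2d+(r-1)(r-2)}{r},$$ and $\dim$ denotes Hausdorff dimension.
   Context: Write $\mathbf{e}(z)=\exp(2\pi i z)$ and $\mathsf{T}=[0,1]$. For $\alpha\in(1/2,1)$ let $\mathscr{F}_{d,\alpha}=\{x\in\mathsf{T}:\ |\sum_{n=1}^N\mathbf{e}(xn^d)|\geqslant N^\alpha\text{ for infinitely many }N\in\mathbb{N}\}$. *)

theory Defs
  imports "HOL-Analysis.Analysis"
begin

section \<open>Hausdorff measure and Hausdorff dimension\<close>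

text \<open>
  The quantity $(\mathrm{diam}\, U)^s$ with the conventions of geometric measure theory:
  it is $0$ for the empty set, and for $s = 0$ it is $1$ for every nonempty set, singletons
  included.  The case distinction on \<open>s\<close> is needed since \<^term>\<open>0 powr 0 = (0::real)\<close>.
\<close>

definition diam_pow :: "real \<Rightarrow> 'a::metric_space set \<Rightarrow> ennreal" where
  "diam_pow s U =
     (if U = {} then 0 else if s = 0 then 1 else ennreal (diameter U powr s))"

text \<open>
  Boundedness of the covering sets is required explicitly, because \<^const>\<open>diameter\<close> takes
  an unspecified real value on unbounded sets.  Finite covers are included, as the \<open>U i\<close> may
  be empty.
\<close>

definition delta_covers :: "real \<Rightarrow> 'a::metric_space set \<Rightarrow> (nat \<Rightarrow> 'a set) set" where
  "delta_covers \<delta> A =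
     {U. A \<subseteq> (\<Union>i. U i) \<and> (\<forall>i. bounded (U i) \<and> diameter (U i) \<le> \<delta>)}"

definition hausdorff_premeasure :: "real \<Rightarrow> real \<Rightarrow> 'a::metric_space set \<Rightarrow> ennreal" where
  "hausdorff_premeasure s \<delta> A = (INF U\<in>delta_covers \<delta> A. \<Sum>i. diam_pow s (U i))"

text \<open>
  The premeasure increases as \<open>\<delta>\<close> decreases, so the limit as \<open>\<delta>\<close> tends to \<open>0\<close> is a supremum.
\<close>

definition hausdorff_measure :: "real \<Rightarrow> 'a::metric_space set \<Rightarrow> ennreal" where
  "hausdorff_measure s A = (SUP \<delta>\<in>{0<..}. hausdorff_premeasure s \<delta> A)"

text \<open>
  The value is an extended real, so that it is \<open>\<infinity>\<close> if no Hausdorff measure of \<open>A\<close> vanishes.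
\<close>

definition hausdorff_dim :: "'a::metric_space set \<Rightarrow> ereal" where
  "hausdorff_dim A = Inf {ereal s | s. 0 \<le> s \<and> hausdorff_measure s A = 0}"


section \<open>Large values of Weyl sums\<close>

definition e :: "real \<Rightarrow> complex" where
  "e z = exp (2 * of_real pi * \<i> * of_real z)"

definition large_weyl_set :: "nat \<Rightarrow> real \<Rightarrow> real set" where
  "large_weyl_set d \<alpha> =
     {x \<in> {0..1}. \<exists>\<^sub>\<infinity>N::nat. norm (\<Sum>n=1..N. e (x * real n ^ d)) \<ge> real N powr \<alpha>}"

definition s0 :: "nat \<Rightarrow> real" where
  "s0 d = real d * (real d - 1) +
     Min ((\<lambda>r::nat. (2 * real d + (real r - 1) * (real r - 2)) / real r) ` {1..d})"

end

theory Submission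
  imports Defs
begin

text \<open>
  The sum over \<open>n \<le> N\<close> of \<open>e(x n\<^sup>d)\<close> and all its partial sums vary little when \<open>x\<close> moves by \<open>N\<^bsup>-d\<^esup>\<close>,
  so it suffices to count the cells of this length that contain a point where some partial sum
  exceeds \<open>N\<^bsup>1-u\<^esup>\<close>, \<open>u = 1 - \<alpha>\<close>, and \<open>N\<^bsup>s0 u + \<epsilon>\<^esup>\<close> such cells are permitted.  Two counts are combined.

  First, the system \<open>\<Sum> x\<^sub>i\<^sup>j = \<Sum> y\<^sub>i\<^sup>j\<close> with \<open>j \<in> {1, \<dots>, r-1, d}\<close> in \<open>2 s = r (r + 1)\<close> variables has only
  \<open>N\<^bsup>s+\<epsilon>\<^esup>\<close> solutions up to \<open>N\<close>; restricting the mean value to the last coordinate gives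
  \<open>N\<^bsup>d - r + r (r + 1) u + \<epsilon>\<^esup>\<close> cells.  Second, for \<open>r = d\<close> each \<open>x\<close> yields the points
  \<open>(x \<cdot> (d choose j) c\<^bsup>d-j\<^esup>)\<^sub>j\<close> for the shifts \<open>n \<mapsto> n + c\<close>, \<open>c \<le> N\<close>, all of which are large values.  They lie in
  many different cells unless \<open>d x\<close> is close to a rational with denominator at most \<open>T\<close>, and there are
  only \<open>O(T\<^sup>2)\<close> exceptional cells.  With \<open>E = d (d + 1) u\<close> this gives \<open>T\<^sup>2 + N\<^bsup>E+\<epsilon>\<^esup> / T\<close> cells, that is
  \<open>N\<^bsup>max (E - 1) (2 E / 3) + \<epsilon>\<^esup>\<close> for the best \<open>T\<close>, and \<open>2 d (d + 1) / 3 \<le> s0\<close>.  The line through the exponents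
  \<open>(r (r + 1), r)\<close> and \<open>(d (d + 1), d + 1)\<close> meets the height \<open>d\<close> at the \<open>r\<close>-th term in the definition of
  \<open>s0\<close> (with \<open>d + 1 - r\<close> in place of \<open>r\<close>), so one of the two counts always suffices.

  The mean value estimate follows from a decoupling inequality over the \<open>p\<close>-adic numbers,
  proved as in the short proof of \<open>\<ell>\<^sup>2\<close> decoupling for the moment curve by Guo, Li, Yung and
  Zorin-Kranich.  Over the \<open>p\<close>-adics the uncertainty principle is an exact statement about characters
  modulo powers of \<open>p\<close>.
\<close>

section \<open>Averages and elementary inequalities\<close>

text \<open>One prime p > d serves for all N: the range of summation is only enclosed in an interval
  of length a power of p, and all constants may depend on p. The condition p > d makes the
  factorials and binomial coefficients met in interpolation units modulo p, so jets at two points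
  incongruent modulo p can be prescribed independently. This p-adic transversality takes the place
  of separated intervals on the line. The decoupling exponent is not computed directly: every
  admissible exponent \<eta> \<ge> \<eta>0 can be lowered by an amount that depends on \<eta>0 but
  not on \<eta>. The improvement comes from products of two residue classes at different levels,
  where the exponent of one factor is critical for a smaller dimension in which decoupling is
  already known. The transfer back to the integers is a comparison of solution counts, so only sums
  with coefficients 1 are transferred. The length of a large partial sum depends on x, an obstacle
  to a direct use of moments; partial summation and dyadic blocks remove it at the cost of powers of
  log N.\<close>

definition mean :: "'a set \<Rightarrow> ('a \<Rightarrow> real) \<Rightarrow> real" where
  "mean A f = (\<Sum>x\<in>A. f x) / real (card A)"

lemma mean_mono: "(\<And>x. x \<in> A \<Longrightarrow> f x \<le> g x) \<Longrightarrow> mean A f \<le> mean A g"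
  unfolding mean_def by (intro divide_right_mono sum_mono) auto

lemma mean_cong: "(\<And>x. x \<in> A \<Longrightarrow> f x = g x) \<Longrightarrow> mean A f = mean A g"
  unfolding mean_def by simp

lemma mean_nonneg: "(\<And>x. x \<in> A \<Longrightarrow> 0 \<le> f x) \<Longrightarrow> 0 \<le> mean A f"
  unfolding mean_def by (intro divide_nonneg_nonneg sum_nonneg) auto

lemma mean_const: "finite A \<Longrightarrow> A \<noteq> {} \<Longrightarrow> mean A (\<lambda>_. c) = c"
  unfolding mean_def by auto

lemma mean_add: "mean A (\<lambda>x. f x + g x) = mean A f + mean A g"
  unfolding mean_def by (simp add: sum.distrib add_divide_distrib)

lemma mean_sum: "mean A (\<lambda>x. \<Sum>i\<in>I. f i x) = (\<Sum>i\<in>I. mean A (f i))"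
  unfolding mean_def by (subst sum.swap) (simp add: sum_divide_distrib)

lemma mean_cmult: "mean A (\<lambda>x. c * f x) = c * mean A f"
  unfolding mean_def by (simp flip: sum_distrib_left)

lemma mean_swap: "mean A (\<lambda>x. mean B (\<lambda>y. f x y)) = mean B (\<lambda>y. mean A (\<lambda>x. f x y))"
  unfolding mean_def sum_divide_distrib by (subst sum.swap) (simp add: mult.commute)

lemma mean_eq_0:
  assumes "finite A" "\<And>x. x \<in> A \<Longrightarrow> 0 \<le> f x" "mean A f \<le> 0" "x \<in> A"
  shows "f x = 0"
proof -
  have "card A > 0" using assms by (auto simp: card_gt_0_iff)
  then have "(\<Sum>x\<in>A. f x) \<le> 0"
    using assms(3) by (auto simp: mean_def divide_le_0_iff)
  then have "(\<Sum>x\<in>A. f x) = 0"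
    using assms(2) by (intro antisym sum_nonneg) auto
  then show ?thesis using assms by (subst (asm) sum_nonneg_eq_0_iff) auto
qed

lemma convex_on_power: "convex_on {0::real..} (\<lambda>x. x ^ n)"
  using convex_power_even[of n] convex_power_odd[of n] convex_on_subset by blast

text \<open>Convexity of \<open>x ^ n\<close> with weights proportional to \<open>K j\<close>. If
  \<open>K j\<close> bounds the norm of the j-th summand, these are the weights that reproduce
  Minkowski's inequality.\<close>

lemma sum_power_le_weighted:
  fixes x K :: "'a \<Rightarrow> real"
  assumes "finite J" "\<And>j. j \<in> J \<Longrightarrow> 0 \<le> x j" "\<And>j. j \<in> J \<Longrightarrow> 0 < K j" "J \<noteq> {}"
  shows "(\<Sum>j\<in>J. x j) ^ n \<le> (\<Sum>j\<in>J. (K j / sum K J) * (x j * (sum K J / K j)) ^ n)"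
proof -
  have pos: "sum K J > 0" using assms by (intro sum_pos) auto
  have "(\<Sum>j\<in>J. (K j / sum K J) *\<^sub>R (x j * (sum K J / K j))) ^ n
      \<le> (\<Sum>j\<in>J. (K j / sum K J) * (x j * (sum K J / K j)) ^ n)"
    by (intro convex_on_sum[where f = "\<lambda>x. x ^ n", OF assms(1,4) convex_on_power])
       (use assms pos in \<open>auto intro!: mult_nonneg_nonneg divide_nonneg_pos simp: less_imp_le simp flip: sum_divide_distrib\<close>)
  also have "(\<Sum>j\<in>J. (K j / sum K J) *\<^sub>R (x j * (sum K J / K j))) = (\<Sum>j\<in>J. x j)"
    by (intro sum.cong) (use assms(3) pos in \<open>auto simp: field_simps dest!: assms(3)\<close>)
  finally show ?thesis .
qed

text \<open>The triangle inequality for the norm of order \<open>n\<close>, with bounds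
  \<open>K j\<close> in place of roots: after weighted convexity the j-th term contributes at most
  \<open>K j / S * S ^ n\<close>, and these add up to \<open>S ^ n\<close>.\<close>

lemma mean_minkowski:
  assumes A: "finite A" and J: "finite J" and n: "n \<ge> 1"
    and F: "\<And>j x. j \<in> J \<Longrightarrow> x \<in> A \<Longrightarrow> 0 \<le> F j x"
    and K: "\<And>j. j \<in> J \<Longrightarrow> 0 \<le> K j"
    and le: "\<And>j. j \<in> J \<Longrightarrow> mean A (\<lambda>x. F j x ^ n) \<le> K j ^ n"
  shows "mean A (\<lambda>x. (\<Sum>j\<in>J. F j x) ^ n) \<le> (\<Sum>j\<in>J. K j) ^ n"
proof -
  \<comment> \<open>A summand with \<open>K j = 0\<close> vanishes on all of \<open>A\<close>; it is
    removed before dividing by \<open>K j\<close>.\<close>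
  define J' where "J' = {j\<in>J. K j > 0}"
  have J': "finite J'" "J' \<subseteq> J" using J by (auto simp: J'_def)
  have F0: "F j x = 0" if "j \<in> J - J'" "x \<in> A" for j x
  proof -
    have "K j = 0" using that K by (force simp: J'_def)
    then have "mean A (\<lambda>x. F j x ^ n) \<le> 0" using le[of j] that n by (auto simp: power_0_left)
    then have "F j x ^ n = 0" using that F by (intro mean_eq_0[OF A _ _ that(2)]) auto
    then show ?thesis by simp
  qed
  have sF: "(\<Sum>j\<in>J. F j x) = (\<Sum>j\<in>J'. F j x)" if "x \<in> A" for x
    by (intro sum.mono_neutral_right) (use J J' F0 that in auto)
  have sK: "(\<Sum>j\<in>J. K j) = (\<Sum>j\<in>J'. K j)"
    by (intro sum.mono_neutral_right) (use J J' K in \<open>auto simp: J'_def intro: antisym\<close>)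
  show ?thesis
  proof (cases "J' = {}")
    case True
    then show ?thesis using sF sK n by (simp add: power_0_left mean_def)
  next
    case False
    define S where "S = (\<Sum>j\<in>J'. K j)"
    have Spos: "S > 0" unfolding S_def using J' False by (intro sum_pos) (auto simp: J'_def)
    have "mean A (\<lambda>x. (\<Sum>j\<in>J. F j x) ^ n) = mean A (\<lambda>x. (\<Sum>j\<in>J'. F j x) ^ n)"
      by (intro mean_cong) (simp add: sF)
    also have "\<dots> \<le> mean A (\<lambda>x. \<Sum>j\<in>J'. (K j / S) * (F j x * (S / K j)) ^ n)"
      unfolding S_def by (intro mean_mono sum_power_le_weighted) (use J' F False in \<open>auto simp: J'_def\<close>)
    also have "\<dots> = (\<Sum>j\<in>J'. (K j / S) * (S / K j) ^ n * mean A (\<lambda>x. F j x ^ n))"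
      unfolding mean_sum mean_cmult[symmetric]
      by (intro sum.cong refl mean_cong) (simp add: power_mult_distrib power_divide)
    also have "\<dots> \<le> (\<Sum>j\<in>J'. (K j / S) * (S / K j) ^ n * K j ^ n)"
      using J' le Spos by (intro sum_mono mult_left_mono) (auto simp: J'_def)
    also have "\<dots> = (\<Sum>j\<in>J'. K j) / S * S ^ n"
      unfolding sum_divide_distrib sum_distrib_right
      by (intro sum.cong refl) (auto simp: J'_def power_divide)
    also have "\<dots> = S ^ n" using Spos by (simp add: S_def)
    finally show ?thesis by (simp add: sK S_def)
  qed
qed

text \<open>Young's inequality applied pointwise to \<open>X x / a\<close> and
  \<open>Y x / b\<close>. If \<open>a\<close> or \<open>b\<close> is 0, then \<open>X\<close> or
  \<open>Y\<close> vanishes on \<open>A\<close> and the normalisation is replaced by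
  \<open>Z x \<le> 0\<close>.\<close>

lemma mean_hoelder:
  assumes A: "finite A" and th: "0 < \<theta>" "\<theta> < 1"
    and XY: "\<And>x. x \<in> A \<Longrightarrow> 0 \<le> X x" "\<And>x. x \<in> A \<Longrightarrow> 0 \<le> Y x"
    and Z: "\<And>x. x \<in> A \<Longrightarrow> Z x \<le> X x powr \<theta> * Y x powr (1 - \<theta>)"
    and X: "mean A X \<le> a" and Y: "mean A Y \<le> b"
  shows "mean A Z \<le> a powr \<theta> * b powr (1 - \<theta>)"
proof (cases "A = {}")
  case True
  then show ?thesis by (simp add: mean_def)
next
  case False
  have a0: "0 \<le> a" "0 \<le> b" using mean_nonneg[of A X] mean_nonneg[of A Y] XY X Y by fastforce+
  show ?thesis
  proof (cases "a = 0 \<or> b = 0")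
    case True
    have "Z x \<le> 0" if "x \<in> A" for x
    proof -
      have "X x = 0 \<or> Y x = 0"
        using True mean_eq_0[OF A, of X x] mean_eq_0[OF A, of Y x] XY X Y that by auto
      then show ?thesis using Z[OF that] by auto
    qed
    then have "mean A Z \<le> mean A (\<lambda>_. 0)" by (intro mean_mono)
    then show ?thesis using a0 by (simp add: mean_def) (smt (verit) mult_nonneg_nonneg powr_ge_zero)
  next
    case False
    then have ab: "a > 0" "b > 0" using a0 by auto
    define c where "c = a powr \<theta> * b powr (1 - \<theta>)"
    have c: "c > 0" using ab by (simp add: c_def)
    have pt: "Z x \<le> c * (\<theta> * (X x / a) + (1 - \<theta>) * (Y x / b))" if x: "x \<in> A" for x
    proof (cases "X x = 0 \<or> Y x = 0")
      case True
      then have "Z x \<le> 0" using Z[OF x] by auto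
      also have "0 \<le> c * (\<theta> * (X x / a) + (1 - \<theta>) * (Y x / b))"
        using c ab th XY x by auto
      finally show ?thesis .
    next
      case False
      then have p: "X x > 0" "Y x > 0" using XY x by (auto simp: less_le)
      have "Z x \<le> c * ((X x / a) powr \<theta> * (Y x / b) powr (1 - \<theta>))"
        using Z[OF x] ab p by (simp add: c_def powr_divide)
      also have "\<dots> \<le> c * (\<theta> * (X x / a) + (1 - \<theta>) * (Y x / b))"
        using c p ab th by (intro mult_left_mono Youngs_inequality_0) auto
      finally show ?thesis .
    qed
    have "mean A Z \<le> mean A (\<lambda>x. c * (\<theta> * (X x / a) + (1 - \<theta>) * (Y x / b)))"
      by (intro mean_mono pt)
    also have "\<dots> = c * (\<theta> / a * mean A X + (1 - \<theta>) / b * mean A Y)"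
      using mean_cmult[of A "\<theta> / a" X] mean_cmult[of A "(1 - \<theta>) / b" Y] by (simp add: mean_cmult mean_add)
    also have "\<dots> \<le> c * (\<theta> / a * a + (1 - \<theta>) / b * b)"
      using c ab th X Y by (intro mult_left_mono add_mono) auto
    also have "\<dots> = c" using ab by simp
    finally show ?thesis by (simp add: c_def)
  qed
qed

text \<open>The case \<open>x = 0\<close> is separate because \<open>0 ^ 0 = 1\<close> whereas
  \<open>0 powr \<theta> = 0\<close>: there both sides are 1 or 0 according to whether the exponents
  vanish.\<close>

lemma power_powr_combine:
  fixes x :: real
  assumes "0 \<le> x" "0 < \<theta>" "\<theta> < 1" "real c = \<theta> * real a + (1 - \<theta>) * real b"
  shows "(x ^ a) powr \<theta> * (x ^ b) powr (1 - \<theta>) = x ^ c"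
proof (cases "x = 0")
  case True
  have "c = 0 \<longleftrightarrow> a = 0 \<and> b = 0"
  proof
    assume "c = 0"
    then have "\<theta> * real a + (1 - \<theta>) * real b = 0" using assms by simp
    moreover have "0 \<le> \<theta> * real a" "0 \<le> (1 - \<theta>) * real b" using assms by auto
    ultimately have "\<theta> * real a = 0" "(1 - \<theta>) * real b = 0" by linarith+
    then show "a = 0 \<and> b = 0" using assms by simp
  qed (use assms in auto)
  then show ?thesis using True by (auto simp: power_0_left)
next
  case False
  then have "x > 0" using assms by simp
  then show ?thesis
    by (simp add: powr_powr assms(4) mult_ac flip: powr_realpow powr_add)
qed

lemma norm_sum_power_le:
  fixes z :: "'a \<Rightarrow> 'b::real_normed_vector"
  assumes "finite J"
  shows "norm (\<Sum>j\<in>J. z j) ^ Suc n \<le> real (card J) ^ n * (\<Sum>j\<in>J. norm (z j) ^ Suc n)"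
proof (cases "J = {}")
  case False
  then have c: "real (card J) > 0" using assms by (simp add: card_gt_0_iff)
  have "norm (\<Sum>j\<in>J. z j) ^ Suc n \<le> (\<Sum>j\<in>J. norm (z j)) ^ Suc n"
    by (intro power_mono norm_sum) auto
  also have "\<dots> \<le> (\<Sum>j\<in>J. (1 / (\<Sum>j\<in>J. 1)) * (norm (z j) * ((\<Sum>j\<in>J. 1) / 1)) ^ Suc n)"
    by (intro sum_power_le_weighted) (use assms False in auto)
  also have "\<dots> = real (card J) ^ n * (\<Sum>j\<in>J. norm (z j) ^ Suc n)"
    unfolding sum_distrib_left using c by (intro sum.cong refl) (simp add: power_mult_distrib)
  finally show ?thesis .
qed auto

lemma power_add_le_add_power:
  fixes x y :: real
  assumes "0 \<le> x" "0 \<le> y" "n \<ge> 1"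
  shows "x ^ n + y ^ n \<le> (x + y) ^ n"
proof -
  obtain m where n: "n = Suc m" using assms by (cases n) auto
  have "x ^ n + y ^ n \<le> x * (x + y) ^ m + y * (x + y) ^ m"
    unfolding n power_Suc using assms by (intro add_mono mult_left_mono power_mono) auto
  then show ?thesis by (simp add: n distrib_right)
qed

lemma sum_power_le_power_sum:
  fixes x :: "'a \<Rightarrow> real"
  assumes "finite J" "\<And>j. j \<in> J \<Longrightarrow> 0 \<le> x j" "n \<ge> 1"
  shows "(\<Sum>j\<in>J. x j ^ n) \<le> (\<Sum>j\<in>J. x j) ^ n"
  using assms(1,2)
proof (induction J rule: finite_induct)
  case (insert a J)
  have "x a ^ n + (\<Sum>j\<in>J. x j) ^ n \<le> (x a + (\<Sum>j\<in>J. x j)) ^ n"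
    using insert assms by (intro power_add_le_add_power) (auto intro: sum_nonneg)
  then show ?case using insert by auto
qed (use assms in auto)

section \<open>The additive character of the real line\<close>

lemma e_add: "e (x + y) = e x * e y"
  by (simp add: e_def distrib_left exp_add)

lemma norm_e [simp]: "norm (e x) = 1"
proof -
  have "e x = cis (2 * pi * x)" by (simp add: e_def cis_conv_exp mult_ac)
  then show ?thesis by simp
qed

lemma e_cis: "e x = cis (2 * pi * x)"
  by (simp add: e_def cis_conv_exp mult_ac)

lemma e_0 [simp]: "e 0 = 1" by (simp add: e_def)

lemma e_of_int [simp]: "e (of_int n) = 1"
  by (simp add: e_cis cis_multiple_2pi)

lemma e_minus: "e (- x) = cnj (e x)"
  by (simp add: e_cis cis_cnj)

lemma e_eq_1_iff: "e x = 1 \<longleftrightarrow> x \<in> \<int>"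
proof
  assume "e x = 1"
  then have "cos (2 * pi * x) = 1" by (simp add: e_cis complex_eq_iff)
  then obtain n :: int where "2 * pi * x = of_int n * 2 * pi"
    unfolding cos_one_2pi_int by blast
  then have "x = of_int n" by simp
  then show "x \<in> \<int>" by simp
qed (auto elim!: Ints_cases)

lemma e_add_int: "x - y \<in> \<int> \<Longrightarrow> e x = e y"
  using e_add[of "x - y" y] e_eq_1_iff[of "x - y"] by simp

section \<open>Exponential sums over finite groups of characters\<close>

text \<open>Closure is under pointwise products; a member is in general not additive in
  \<open>n\<close>, but stands for a frequency, with \<open>u n\<close> its phase at the n-th point
  of a curve. Translation by a member is injective, so a finite set closed under products is a
  group. Averages over it play the role of integrals over a torus.\<close>

definition char_group :: "(int \<Rightarrow> complex) set \<Rightarrow> bool" where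
  "char_group U \<longleftrightarrow> finite U \<and> U \<noteq> {} \<and> (\<forall>u\<in>U. \<forall>n. norm (u n) = 1) \<and>
     (\<forall>u\<in>U. \<forall>v\<in>U. (\<lambda>n. u n * v n) \<in> U)"

lemma char_groupD:
  assumes "char_group U"
  shows "finite U" "U \<noteq> {}" "u \<in> U \<Longrightarrow> norm (u n) = 1"
    "u \<in> U \<Longrightarrow> v \<in> U \<Longrightarrow> (\<lambda>n. u n * v n) \<in> U"
  using assms by (auto simp: char_group_def)

lemma char_group_shift_bij:
  assumes U: "char_group U" and v: "v \<in> U"
  shows "bij_betw (\<lambda>u n. u n * v n) U U"
proof -
  have nz: "v n \<noteq> 0" for n using char_groupD(3)[OF U v, of n] by auto
  have inj: "inj_on (\<lambda>u n. u n * v n) U"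
  proof (rule inj_onI)
    fix u w assume "(\<lambda>n. u n * v n) = (\<lambda>n. w n * v n)"
    then have "u n * v n = w n * v n" for n by meson
    then show "u = w" using nz by auto
  qed
  have "(\<lambda>u n. u n * v n) ` U \<subseteq> U" using char_groupD(4)[OF U _ v] by auto
  then have "(\<lambda>u n. u n * v n) ` U = U"
    using inj char_groupD(1)[OF U] by (simp add: endo_inj_surj)
  then show ?thesis using inj by (simp add: bij_betw_def)
qed

lemma sum_shift:
  assumes "char_group U" "v \<in> U"
  shows "(\<Sum>u\<in>U. G (\<lambda>n. u n * v n)) = (\<Sum>u\<in>U. G u)"
  using sum.reindex_bij_betw[OF char_group_shift_bij[OF assms], of G] by simp

lemma mean_shift:
  assumes "char_group U" "v \<in> U"
  shows "mean U (\<lambda>u. G (\<lambda>n. u n * v n)) = mean U G"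
  unfolding mean_def using sum_shift[OF assms, of G] by simp

text \<open>Translation by \<open>v\<close> multiplies the sum by \<open>v n * cnj (v n')\<close>,
  which is different from 1.\<close>

lemma sum_char_eq_0:
  assumes U: "char_group U" and v: "v \<in> U" "v n \<noteq> v n'"
  shows "(\<Sum>u\<in>U. u n * cnj (u n')) = 0"
proof -
  have "(\<Sum>u\<in>U. u n * cnj (u n')) = (\<Sum>u\<in>U. (u n * v n) * cnj (u n' * v n'))"
    using sum_shift[OF U v(1), of "\<lambda>u. u n * cnj (u n')"] by simp
  also have "\<dots> = (v n * cnj (v n')) * (\<Sum>u\<in>U. u n * cnj (u n'))"
    by (simp add: sum_distrib_left mult_ac)
  finally have "(1 - v n * cnj (v n')) * (\<Sum>u\<in>U. u n * cnj (u n')) = 0"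
    by (simp add: algebra_simps)
  moreover have "v n * cnj (v n') \<noteq> 1"
  proof
    assume "v n * cnj (v n') = 1"
    then have "v n * (cnj (v n') * v n') = v n'" by (simp add: mult.assoc[symmetric])
    moreover have "cnj (v n') * v n' = 1"
      using char_groupD(3)[OF U v(1), of n'] complex_norm_square[of "v n'"] by (simp add: mult.commute)
    ultimately show False using v(2) by simp
  qed
  ultimately show ?thesis by simp
qed

text \<open>Functions are collected, not frequency vectors \<open>x\<close>. Vectors that induce the
  same function are identified, and since all fibres have the same size modulo \<open>q\<close>, the
  mean over this set is the mean over all \<open>x\<close> modulo \<open>q\<close>.\<close>

definition phases :: "nat \<Rightarrow> (nat \<Rightarrow> int poly) \<Rightarrow> nat \<Rightarrow> (int \<Rightarrow> complex) set" where
  "phases k \<gamma> q =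
     {u. \<exists>x::nat \<Rightarrow> int. u = (\<lambda>n. e (real_of_int (\<Sum>j=1..k. x j * poly (\<gamma> j) n) / real q))}"

lemma phasesI: "(\<lambda>n. e (real_of_int (\<Sum>j=1..k. x j * poly (\<gamma> j) n) / real q)) \<in> phases k \<gamma> q"
  unfolding phases_def by blast

lemma e_div_cong:
  assumes "int q dvd a - b" "q > 0"
  shows "e (real_of_int a / real q) = e (real_of_int b / real q)"
proof (rule e_add_int)
  obtain c where "a - b = int q * c" using assms by blast
  then have "real_of_int a - real_of_int b = real q * real_of_int c"
    by (metis of_int_diff of_int_mult of_int_of_nat_eq)
  then have "real_of_int a / real q - real_of_int b / real q = of_int c"
    using assms(2) by (simp add: field_simps)
  then show "real_of_int a / real q - real_of_int b / real q \<in> \<int>" by simp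
qed

lemma char_group_phases:
  assumes q: "q > 0"
  shows "char_group (phases k \<gamma> q)"
proof -
  have "phases k \<gamma> q \<subseteq> (\<lambda>x n. e (real_of_int (\<Sum>j=1..k. x j * poly (\<gamma> j) n) / real q)) ` 
      (PiE {1..k} (\<lambda>_. {0..<int q}))"
  proof
    fix u assume "u \<in> phases k \<gamma> q"
    then obtain x :: "nat \<Rightarrow> int" where u: "u = (\<lambda>n. e (real_of_int (\<Sum>j=1..k. x j * poly (\<gamma> j) n) / real q))"
      by (auto simp: phases_def)
    have "u = (\<lambda>n. e (real_of_int (\<Sum>j=1..k. restrict (\<lambda>j. x j mod int q) {1..k} j * poly (\<gamma> j) n) / real q))"
      unfolding u
    proof (intro ext e_div_cong)
      fix n
      have "int q dvd (\<Sum>j=1..k. (x j - x j mod int q) * poly (\<gamma> j) n)"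
        by (intro dvd_sum dvd_mult2) (simp add: mod_eq_dvd_iff[symmetric])
      also have "(\<Sum>j=1..k. (x j - x j mod int q) * poly (\<gamma> j) n) = (\<Sum>j=1..k. x j * poly (\<gamma> j) n)
           - (\<Sum>j=1..k. restrict (\<lambda>j. x j mod int q) {1..k} j * poly (\<gamma> j) n)"
        by (simp add: sum_subtractf algebra_simps)
      finally show "int q dvd \<dots>" .
    qed (use q in auto)
    moreover have "restrict (\<lambda>j. x j mod int q) {1..k} \<in> PiE {1..k} (\<lambda>_. {0..<int q})"
      using q by auto
    ultimately show "u \<in> (\<lambda>x n. e (real_of_int (\<Sum>j=1..k. x j * poly (\<gamma> j) n) / real q)) ` 
      (PiE {1..k} (\<lambda>_. {0..<int q}))" by blast
  qed
  then have fin: "finite (phases k \<gamma> q)"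
    by (rule finite_subset) (intro finite_imageI finite_PiE; simp)
  have mult: "(\<lambda>n. u n * v n) \<in> phases k \<gamma> q" if "u \<in> phases k \<gamma> q" "v \<in> phases k \<gamma> q" for u v
  proof -
    from that obtain x y :: "nat \<Rightarrow> int" where
      "u = (\<lambda>n. e (real_of_int (\<Sum>j=1..k. x j * poly (\<gamma> j) n) / real q))"
      "v = (\<lambda>n. e (real_of_int (\<Sum>j=1..k. y j * poly (\<gamma> j) n) / real q))"
      by (auto simp: phases_def)
    then have "(\<lambda>n. u n * v n) = (\<lambda>n. e (real_of_int (\<Sum>j=1..k. (x j + y j) * poly (\<gamma> j) n) / real q))"
      by (auto simp: fun_eq_iff add_divide_distrib sum.distrib distrib_right simp flip: e_add)
    then show ?thesis using phasesI by metis
  qed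
  show ?thesis unfolding char_group_def
    using fin mult phasesI[of _ \<gamma> k q] by (auto simp: phases_def)
qed

definition es :: "(int \<Rightarrow> complex) \<Rightarrow> int set \<Rightarrow> (int \<Rightarrow> complex) \<Rightarrow> complex" where
  "es A S u = (\<Sum>n\<in>S. A n * u n)"

definition cls :: "int \<Rightarrow> int \<Rightarrow> int set" where
  "cls m i = {n. m dvd n - i}"

definition res :: "int \<Rightarrow> int \<Rightarrow> int \<Rightarrow> int set" where
  "res M m i = {j\<in>{0..<M}. m dvd j - i}"

lemma finite_res [simp]: "finite (res M m i)"
  unfolding res_def by (rule finite_subset[of _ "{0..<M}"]) auto

lemma res_1: "res M 1 i = {0..<M}"
  by (auto simp: res_def)

lemma cls_1: "cls 1 i = UNIV"
  by (auto simp: cls_def)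

lemma sum_cls_refine:
  fixes g :: "int \<Rightarrow> 'a::comm_monoid_add"
  assumes S: "finite S" and M: "M > 0" "m dvd M"
  shows "(\<Sum>n\<in>S \<inter> cls m i. g n) = (\<Sum>j\<in>res M m i. \<Sum>n\<in>S \<inter> cls M j. g n)"
proof -
  have "(\<Sum>n\<in>S \<inter> cls m i. g n) = (\<Sum>j\<in>res M m i. \<Sum>n\<in>{n\<in>S \<inter> cls m i. n mod M = j}. g n)"
  proof (rule sum.group[symmetric])
    show "(\<lambda>n. n mod M) ` (S \<inter> cls m i) \<subseteq> res M m i"
    proof safe
      fix n assume n: "n \<in> cls m i"
      have "m dvd (n - i) - M * (n div M)"
        by (rule dvd_diff[OF _ dvd_mult2]) (use n M(2) in \<open>simp_all add: cls_def\<close>)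
      also have "(n - i) - M * (n div M) = n mod M - i" by (simp add: minus_mult_div_eq_mod algebra_simps)
      finally show "n mod M \<in> res M m i" using M by (simp add: res_def)
    qed
  qed (use S in auto)
  also have "\<dots> = (\<Sum>j\<in>res M m i. \<Sum>n\<in>S \<inter> cls M j. g n)"
  proof (intro sum.cong refl)
    fix j assume j: "j \<in> res M m i"
    have "n mod M = j \<longleftrightarrow> M dvd n - j" for n
      using j M by (auto simp: res_def mod_eq_dvd_iff[symmetric])
    moreover have "m dvd n - i" if "M dvd n - j" for n
      using dvd_add[of m "n - j" "j - i"] that j M dvd_trans by (auto simp: res_def)
    ultimately show "{n \<in> S \<inter> cls m i. n mod M = j} = S \<inter> cls M j"
      by (auto simp: cls_def)
  qed
  finally show ?thesis .
qed

lemma es_refine: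
  assumes "finite S" "M > 0" "m dvd M"
  shows "es A (S \<inter> cls m i) u = (\<Sum>j\<in>res M m i. es A (S \<inter> cls M j) u)"
  unfolding es_def using assms by (rule sum_cls_refine)

lemma es_split:
  assumes "finite S" "M > 0"
  shows "es A S u = (\<Sum>j\<in>{0..<M}. es A (S \<inter> cls M j) u)"
  using es_refine[OF assms, of 1 A 0 u] by (simp add: res_1 cls_1)

text \<open>\<open>2 * tri k = k * (k + 1)\<close> is the critical exponent for the moment curve of
  degree \<open>k\<close>.\<close>

definition tri :: "nat \<Rightarrow> nat" where "tri k = k * (k + 1) div 2"

lemma tri_0 [simp]: "tri 0 = 0" and tri_1 [simp]: "tri (Suc 0) = 1"
  by (simp_all add: tri_def)

lemma real_tri: "real (tri k) = real k * (real k + 1) / 2"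
proof -
  have "2 * tri k = k * (k + 1)" by (simp add: tri_def)
  then have "real (2 * tri k) = real (k * (k + 1))" by simp
  then show ?thesis by (simp add: algebra_simps)
qed

lemma tri_pos: "k \<ge> 1 \<Longrightarrow> tri k \<ge> 1"
  by (cases k) (auto simp: tri_def)

lemma tri_mono: "l \<le> k \<Longrightarrow> tri l \<le> tri k"
  unfolding tri_def by (intro div_le_mono mult_mono) auto

text \<open>Normal form of a nondegenerate curve; zooming into a residue class modulo a power of \<open>p\<close>
  leads back to this form.\<close>

definition good :: "nat \<Rightarrow> nat \<Rightarrow> (nat \<Rightarrow> int poly) \<Rightarrow> bool" where
  "good p k \<gamma> \<longleftrightarrow> (\<forall>j\<in>{1..k}. \<exists>\<delta>. \<gamma> j = monom 1 j + smult (int p) \<delta>)"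

text \<open>The \<open>N j\<close> are upper bounds for the squared norms of the pieces; quantifying over bounds avoids
  taking roots.\<close>

definition decoup :: "nat \<Rightarrow> nat \<Rightarrow> nat \<Rightarrow> real \<Rightarrow> bool" where
  "decoup p k b D \<longleftrightarrow> (\<forall>\<gamma> A S N. good p k \<gamma> \<longrightarrow> finite S \<longrightarrow> (\<forall>j. 0 \<le> N j) \<longrightarrow>
     (\<forall>j\<in>{0..<int p ^ b}. mean (phases k \<gamma> (p ^ (k * b))) (\<lambda>u. norm (es A (S \<inter> cls (int p ^ b) j) u) ^ (2 * tri k))
         \<le> N j ^ tri k) \<longrightarrow>
     mean (phases k \<gamma> (p ^ (k * b))) (\<lambda>u. norm (es A S u) ^ (2 * tri k))
         \<le> D * (\<Sum>j\<in>{0..<int p ^ b}. N j) ^ tri k)"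

lemma decoupD:
  assumes "decoup p k b D" "good p k \<gamma>" "finite S" "\<And>j. 0 \<le> N j"
    "\<And>j. j \<in> {0..<int p ^ b} \<Longrightarrow> mean (phases k \<gamma> (p ^ (k * b)))
         (\<lambda>u. norm (es A (S \<inter> cls (int p ^ b) j) u) ^ (2 * tri k)) \<le> N j ^ tri k"
  shows "mean (phases k \<gamma> (p ^ (k * b))) (\<lambda>u. norm (es A S u) ^ (2 * tri k))
         \<le> D * (\<Sum>j\<in>{0..<int p ^ b}. N j) ^ tri k"
  using assms unfolding decoup_def by blast

text \<open>The triangle inequality followed by Cauchy-Schwarz over the \<open>p ^ b\<close>
  classes. This supplies the exponent from which the improvement starts.\<close>

lemma decoup_trivial:
  assumes p: "p > 0" and k: "k \<ge> 1"
  shows "decoup p k b (real p ^ (b * tri k))"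
  unfolding decoup_def
proof (intro allI impI)
  fix \<gamma> A and S :: "int set" and N :: "int \<Rightarrow> real"
  assume S: "finite S" and N: "\<forall>j. 0 \<le> N j" and le: "\<forall>j\<in>{0..<int p ^ b}. mean (phases k \<gamma> (p ^ (k * b)))
         (\<lambda>u. norm (es A (S \<inter> cls (int p ^ b) j) u) ^ (2 * tri k)) \<le> N j ^ tri k"
  define U where "U = phases k \<gamma> (p ^ (k * b))"
  have U: "char_group U" unfolding U_def using p by (intro char_group_phases) auto
  have P: "int p ^ b > 0" using p by simp
  have "mean U (\<lambda>u. norm (es A S u) ^ (2 * tri k)) \<le>
      mean U (\<lambda>u. (\<Sum>j\<in>{0..<int p ^ b}. norm (es A (S \<inter> cls (int p ^ b) j) u)) ^ (2 * tri k))"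
    by (intro mean_mono power_mono) (auto simp: es_split[OF S P] intro: norm_sum)
  also have "\<dots> \<le> (\<Sum>j\<in>{0..<int p ^ b}. sqrt (N j)) ^ (2 * tri k)"
  proof (intro mean_minkowski)
    show "2 * tri k \<ge> 1" using tri_pos[OF k] by simp
    show "mean U (\<lambda>u. norm (es A (S \<inter> cls (int p ^ b) j) u) ^ (2 * tri k)) \<le> sqrt (N j) ^ (2 * tri k)"
      if "j \<in> {0..<int p ^ b}" for j
      using le that N by (auto simp: U_def power_mult)
  qed (use U N in \<open>auto simp: char_groupD\<close>)
  also have "\<dots> = ((\<Sum>j\<in>{0..<int p ^ b}. 1 * sqrt (N j))\<^sup>2) ^ tri k" by (simp add: power_mult)
  also have "\<dots> \<le> ((\<Sum>j\<in>{0..<int p ^ b}. 1\<^sup>2) * (\<Sum>j\<in>{0..<int p ^ b}. (sqrt (N j))\<^sup>2)) ^ tri k"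
    by (intro power_mono Cauchy_Schwarz_ineq_sum) auto
  also have "\<dots> = real p ^ (b * tri k) * (\<Sum>j\<in>{0..<int p ^ b}. N j) ^ tri k"
    using N by (simp add: power_mult_distrib power_mult)
  finally show "mean (phases k \<gamma> (p ^ (k * b))) (\<lambda>u. norm (es A S u) ^ (2 * tri k))
         \<le> real p ^ (b * tri k) * (\<Sum>j\<in>{0..<int p ^ b}. N j) ^ tri k" by (simp add: U_def)
qed

lemma sum_norm_es_square:
  assumes S: "finite S"
  shows "(\<Sum>u\<in>U. of_real ((norm (es A S u))\<^sup>2)) =
     (\<Sum>n\<in>S. \<Sum>n'\<in>S. A n * cnj (A n') * (\<Sum>u\<in>U. u n * cnj (u n')))"
proof -
  have "of_real ((norm (es A S u))\<^sup>2) = (\<Sum>n\<in>S. \<Sum>n'\<in>S. A n * cnj (A n') * (u n * cnj (u n')))" for u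
    unfolding complex_norm_square es_def cnj_sum sum_product by (intro sum.cong refl) simp
  then have "(\<Sum>u\<in>U. of_real ((norm (es A S u))\<^sup>2)) = 
    (\<Sum>u\<in>U. \<Sum>n\<in>S. \<Sum>n'\<in>S. A n * cnj (A n') * (u n * cnj (u n')))" by simp
  also have "\<dots> = (\<Sum>n\<in>S. \<Sum>u\<in>U. \<Sum>n'\<in>S. A n * cnj (A n') * (u n * cnj (u n')))"
    by (rule sum.swap)
  also have "\<dots> = (\<Sum>n\<in>S. \<Sum>n'\<in>S. \<Sum>u\<in>U. A n * cnj (A n') * (u n * cnj (u n')))"
    by (intro sum.cong refl sum.swap)
  finally show ?thesis by (simp add: sum_distrib_left)
qed

lemma dvd_poly_diff: "(a::int) - b dvd poly P a - poly P b"
proof (induction P)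
  case (pCons c P)
  have "poly (pCons c P) a - poly (pCons c P) b = (a - b) * poly P a + b * (poly P a - poly P b)"
    by (simp add: algebra_simps)
  then show ?case using pCons by (simp add: dvd_add)
qed auto

text \<open>For \<open>k = 1\<close> the moment is the second one, and different classes modulo
  \<open>p ^ b\<close> are orthogonal, so nothing is lost.\<close>

lemma decoup_1:
  assumes p: "prime p"
  shows "decoup p 1 b 1"
  unfolding decoup_def
proof (intro allI impI)
  fix \<gamma> A and S :: "int set" and N :: "int \<Rightarrow> real"
  assume g: "good p 1 \<gamma>" and S: "finite S" and N: "\<forall>j. 0 \<le> N j"
    and le: "\<forall>j\<in>{0..<int p ^ b}. mean (phases 1 \<gamma> (p ^ (1 * b)))
         (\<lambda>u. norm (es A (S \<inter> cls (int p ^ b) j) u) ^ (2 * tri 1)) \<le> N j ^ tri 1"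
  define U where "U = phases 1 \<gamma> (p ^ (1 * b))"
  have p0: "p > 0" using p by (simp add: prime_gt_0_nat)
  have U: "char_group U" unfolding U_def using p0 by (intro char_group_phases) auto
  have P: "int p ^ b > 0" using p0 by simp
  obtain \<delta> where \<delta>: "\<gamma> 1 = monom 1 1 + smult (int p) \<delta>" using g by (auto simp: good_def)
  \<comment> \<open>The character of frequency 1 already separates points incongruent modulo
    \<open>p ^ b\<close>: differences of values of \<open>\<gamma> 1\<close> are
    \<open>n - n'\<close> times \<open>1 + p h\<close>, a unit modulo \<open>p\<close>.\<close>
  define v where "v = (\<lambda>n. e (real_of_int (\<Sum>j=1..1. (\<lambda>_. 1) j * poly (\<gamma> j) n) / real (p ^ (1 * b))))"
  have vU: "v \<in> U" unfolding v_def U_def by (rule phasesI)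
  have zero: "(\<Sum>u\<in>U. u n * cnj (u n')) = 0" if nd: "\<not> int p ^ b dvd n - n'" for n n'
  proof (rule sum_char_eq_0[OF U vU], rule ccontr)
    assume "\<not> v n \<noteq> v n'"
    then have "e (real_of_int (poly (\<gamma> 1) n) / real (p ^ b)) = e (real_of_int (poly (\<gamma> 1) n') / real (p ^ b))"
      by (simp add: v_def)
    then have "e (real_of_int (poly (\<gamma> 1) n - poly (\<gamma> 1) n') / real (p ^ b)) = 1"
      using e_add[of "real_of_int (poly (\<gamma> 1) n - poly (\<gamma> 1) n') / real (p ^ b)" "real_of_int (poly (\<gamma> 1) n') / real (p ^ b)"]
      by (simp add: diff_divide_distrib) (metis norm_e norm_zero zero_neq_one mult_cancel_right1)
    then have "real_of_int (poly (\<gamma> 1) n - poly (\<gamma> 1) n') / real (p ^ b) \<in> \<int>"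
      by (simp add: e_eq_1_iff)
    then obtain c where "real_of_int (poly (\<gamma> 1) n - poly (\<gamma> 1) n') = real_of_int c * real (p ^ b)"
      using p0 by (auto elim!: Ints_cases simp: field_simps)
    then have "real_of_int (poly (\<gamma> 1) n - poly (\<gamma> 1) n') = real_of_int (c * int (p ^ b))" by simp
    then have dv: "int p ^ b dvd poly (\<gamma> 1) n - poly (\<gamma> 1) n'" by (simp only: of_int_eq_iff) simp
    obtain h where h: "poly \<delta> n - poly \<delta> n' = (n - n') * h" using dvd_poly_diff by blast
    have "poly (\<gamma> 1) n - poly (\<gamma> 1) n' = (n - n') + int p * (poly \<delta> n - poly \<delta> n')"
      unfolding \<delta> by (simp add: poly_monom algebra_simps)
    also have "\<dots> = (n - n') * (1 + int p * h)" by (simp add: h algebra_simps)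
    finally have "int p ^ b dvd (n - n') * (1 + int p * h)" using dv by simp
    moreover have "coprime (int p ^ b) (1 + int p * h)"
    proof -
      have "coprime (int p) (1 + int p * h)"
        by (metis add.commute coprime_1_right coprime_iff_gcd_eq_1 gcd_add_mult mult.commute)
      then show ?thesis by simp
    qed
    ultimately show False using nd coprime_dvd_mult_left_iff by blast
  qed
  have eq: "(\<Sum>u\<in>U. (norm (es A S u))\<^sup>2) = (\<Sum>j\<in>{0..<int p ^ b}. \<Sum>u\<in>U. (norm (es A (S \<inter> cls (int p ^ b) j) u))\<^sup>2)"
  proof -
    define c where "c n n' = A n * cnj (A n') * (\<Sum>u\<in>U. u n * cnj (u n'))" for n n'
    have "(of_real (\<Sum>u\<in>U. (norm (es A S u))\<^sup>2) :: complex) = (\<Sum>n\<in>S. \<Sum>n'\<in>S. c n n')"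
      using sum_norm_es_square[OF S, of A U] by (simp add: c_def)
    also have "\<dots> = (\<Sum>j\<in>{0..<int p ^ b}. \<Sum>n\<in>S \<inter> cls (int p ^ b) j. \<Sum>n'\<in>S. c n n')"
      using sum_cls_refine[OF S P, of 1 "\<lambda>n. \<Sum>n'\<in>S. c n n'" 0] by (simp add: res_1 cls_1)
    also have "\<dots> = (\<Sum>j\<in>{0..<int p ^ b}. \<Sum>n\<in>S \<inter> cls (int p ^ b) j. \<Sum>n'\<in>S \<inter> cls (int p ^ b) j. c n n')"
    proof (rule sum.cong[OF refl], rule sum.cong[OF refl], rule sum.mono_neutral_right[OF S], blast, rule ballI)
      fix j n n' assume "n \<in> S \<inter> cls (int p ^ b) j" "n' \<in> S - S \<inter> cls (int p ^ b) j"
      then have "int p ^ b dvd n - j" "\<not> int p ^ b dvd n' - j" by (auto simp: cls_def)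
      then have "\<not> int p ^ b dvd n - n'"
        using dvd_diff[of "int p ^ b" "n - j" "n - n'"] by auto
      then show "c n n' = 0" using zero by (simp add: c_def)
    qed
    also have "\<dots> = (\<Sum>j\<in>{0..<int p ^ b}. of_real (\<Sum>u\<in>U. (norm (es A (S \<inter> cls (int p ^ b) j) u))\<^sup>2))"
      unfolding of_real_sum using sum_norm_es_square[of "S \<inter> cls (int p ^ b) _" A U] S by (intro sum.cong) (auto simp: c_def)
    also have "\<dots> = of_real (\<Sum>j\<in>{0..<int p ^ b}. \<Sum>u\<in>U. (norm (es A (S \<inter> cls (int p ^ b) j) u))\<^sup>2)" by simp
    finally show ?thesis by (simp only: of_real_eq_iff)
  qed
  have "mean U (\<lambda>u. (norm (es A S u))\<^sup>2) = (\<Sum>j\<in>{0..<int p ^ b}. mean U (\<lambda>u. (norm (es A (S \<inter> cls (int p ^ b) j) u))\<^sup>2))"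
    unfolding mean_def eq by (simp add: sum_divide_distrib)
  also have "\<dots> \<le> (\<Sum>j\<in>{0..<int p ^ b}. N j)"
    using le by (intro sum_mono) (auto simp: U_def)
  finally show "mean (phases 1 \<gamma> (p ^ (1 * b))) (\<lambda>u. norm (es A S u) ^ (2 * tri 1))
         \<le> 1 * (\<Sum>j\<in>{0..<int p ^ b}. N j) ^ tri 1" by (simp add: U_def)
qed

text \<open>All terms are compared with the largest one, \<open>M\<close>. If every other term is at
  most \<open>\<delta> / P * M\<close>, the sum is at most \<open>(1 + \<delta>) * M\<close>.
  Otherwise a second term is comparable to \<open>M\<close>, and \<open>M ^ (2 * T)\<close> is
  bounded by a product of powers of two different terms. The split of the exponent into 2 and
  \<open>2 * (T - 1)\<close> is the one of the bilinear expression with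
  \<open>l = 1\<close>.\<close>

lemma broad_narrow:
  fixes z :: "'a \<Rightarrow> complex"
  assumes J: "finite J" and \<delta>: "\<delta> > 0" and T: "T \<ge> 1"
  defines "P \<equiv> real (card J)"
  shows "norm (\<Sum>j\<in>J. z j) ^ (2 * T) \<le> (1 + \<delta>) ^ (2 * T) * (\<Sum>j\<in>J. norm (z j) ^ (2 * T)) +
     P ^ (2 * T) * (P / \<delta>) ^ (2 * (T - 1)) * (\<Sum>i\<in>J. \<Sum>j\<in>J - {i}. norm (z i) ^ 2 * norm (z j) ^ (2 * (T - 1)))"
proof (cases "J = {}")
  case True
  then show ?thesis using T by (simp add: power_0_left P_def)
next
  case False
  have P: "P \<ge> 1" using J False by (simp add: P_def Suc_leI card_gt_0_iff)
  define M where "M = Max ((\<lambda>j. norm (z j)) ` J)"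
  have "M \<in> (\<lambda>j. norm (z j)) ` J" unfolding M_def using J False by (intro Max_in) auto
  then obtain i where i: "i \<in> J" "norm (z i) = M" by auto
  have le: "norm (z j) \<le> M" if "j \<in> J" for j unfolding M_def using J that by (intro Max_ge) auto
  have M0: "M \<ge> 0" using i by (metis norm_ge_zero)
  let ?X = "\<Sum>i\<in>J. \<Sum>j\<in>J - {i}. norm (z i) ^ 2 * norm (z j) ^ (2 * (T - 1))"
  have X0: "?X \<ge> 0" by (intro sum_nonneg mult_nonneg_nonneg) auto
  have C0: "P ^ (2 * T) * (P / \<delta>) ^ (2 * (T - 1)) \<ge> 0" using P \<delta> by simp
  show ?thesis
  proof (cases "\<forall>j\<in>J - {i}. norm (z j) \<le> \<delta> / P * M")
    case True
    have "norm (\<Sum>j\<in>J. z j) = norm (z i + (\<Sum>j\<in>J - {i}. z j))" using i J by (simp add: sum.remove)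
    also have "\<dots> \<le> M + (\<Sum>j\<in>J - {i}. norm (z j))"
      using i norm_sum[of z "J - {i}"] by (intro order.trans[OF norm_triangle_ineq] add_mono) auto
    also have "\<dots> \<le> M + (\<Sum>j\<in>J - {i}. \<delta> / P * M)" using True by (intro add_mono sum_mono) auto
    also have "\<dots> = M + real (card (J - {i})) * (\<delta> / P * M)" by simp
    also have "\<dots> \<le> M + P * (\<delta> / P * M)"
      using J \<delta> P M0 i by (intro add_mono mult_right_mono) (auto simp: P_def)
    also have "\<dots> = (1 + \<delta>) * M" using P by (simp add: algebra_simps)
    finally have "norm (\<Sum>j\<in>J. z j) ^ (2 * T) \<le> ((1 + \<delta>) * M) ^ (2 * T)" by (intro power_mono) auto
    also have "\<dots> = (1 + \<delta>) ^ (2 * T) * norm (z i) ^ (2 * T)" by (simp add: power_mult_distrib i)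
    also have "\<dots> \<le> (1 + \<delta>) ^ (2 * T) * (\<Sum>j\<in>J. norm (z j) ^ (2 * T))"
      using J i \<delta> by (intro mult_left_mono member_le_sum) auto
    also have "\<dots> \<le> \<dots> + P ^ (2 * T) * (P / \<delta>) ^ (2 * (T - 1)) * ?X"
      using mult_nonneg_nonneg[OF C0 X0] by simp
    finally show ?thesis .
  next
    case False
    then obtain j where "j \<in> J - {i}" "\<not> norm (z j) \<le> \<delta> / P * M" by blast
    then have j: "j \<in> J" "j \<noteq> i" "\<delta> / P * M < norm (z j)" by (simp_all only: not_le Diff_iff) auto
    then have Mj: "M \<le> P / \<delta> * norm (z j)" using P \<delta> by (simp add: field_simps)
    have "norm (\<Sum>j\<in>J. z j) \<le> (\<Sum>j\<in>J. norm (z j))" by (rule norm_sum)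
    also have "\<dots> \<le> (\<Sum>j\<in>J. M)" by (intro sum_mono le)
    also have "\<dots> = P * M" by (simp add: P_def)
    finally have "norm (\<Sum>j\<in>J. z j) ^ (2 * T) \<le> (P * M) ^ (2 * T)" by (intro power_mono) auto
    also have "\<dots> = P ^ (2 * T) * (M ^ 2 * M ^ (2 * (T - 1)))"
      using T by (cases T) (simp_all add: power_mult_distrib power2_eq_square)
    also have "\<dots> \<le> P ^ (2 * T) * (norm (z i) ^ 2 * (P / \<delta> * norm (z j)) ^ (2 * (T - 1)))"
      using P Mj M0 i by (intro mult_left_mono mult_mono power_mono) auto
    also have "\<dots> = P ^ (2 * T) * (P / \<delta>) ^ (2 * (T - 1)) * (norm (z i) ^ 2 * norm (z j) ^ (2 * (T - 1)))"
      by (simp add: power_mult_distrib power_divide)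
    also have "\<dots> \<le> P ^ (2 * T) * (P / \<delta>) ^ (2 * (T - 1)) * ?X"
    proof (intro mult_left_mono C0)
      have "norm (z i) ^ 2 * norm (z j) ^ (2 * (T - 1)) \<le> (\<Sum>j\<in>J - {i}. norm (z i) ^ 2 * norm (z j) ^ (2 * (T - 1)))"
        using J j by (intro member_le_sum) auto
      also have "\<dots> \<le> ?X"
        using J i by (intro member_le_sum[of i J "\<lambda>i. \<Sum>j\<in>J - {i}. norm (z i) ^ 2 * norm (z j) ^ (2 * (T - 1))"] sum_nonneg) auto
      finally show "norm (z i) ^ 2 * norm (z j) ^ (2 * (T - 1)) \<le> ?X" .
    qed
    also have "\<dots> \<le> (1 + \<delta>) ^ (2 * T) * (\<Sum>j\<in>J. norm (z j) ^ (2 * T)) + \<dots>"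
      using \<delta> by (auto intro!: mult_nonneg_nonneg sum_nonneg)
    finally show ?thesis .
  qed
qed

section \<open>Hermite interpolation modulo prime powers\<close>

text \<open>The Taylor coefficient of order \<open>s\<close> at \<open>i\<close>, that is the s-th
  derivative divided by s!. Read off as a coefficient of a shifted polynomial it is an
  integer.\<close>

definition jet :: "int \<Rightarrow> nat \<Rightarrow> int poly \<Rightarrow> int" where
  "jet i s P = coeff (pcompose P [:i, 1:]) s"

lemma jet_add: "jet i s (P + Q) = jet i s P + jet i s Q"
  by (simp add: jet_def pcompose_add)

lemma jet_smult: "jet i s (smult c P) = c * jet i s P"
  by (simp add: jet_def pcompose_smult)

lemma jet_0 [simp]: "jet i s 0 = 0"
  by (simp add: jet_def)

lemma jet_sum: "jet i s (\<Sum>j\<in>J. f j) = (\<Sum>j\<in>J. jet i s (f j))"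
  by (induction J rule: infinite_finite_induct) (auto simp: jet_add)

lemma jet_const: "s \<ge> 1 \<Longrightarrow> jet i s [:c:] = 0"
  by (cases s) (auto simp: jet_def)

lemma poly_taylor:
  fixes P :: "int poly"
  assumes "degree P \<le> D"
  shows "poly P (i + x) = (\<Sum>s\<le>D. jet i s P * x ^ s)"
proof -
  have "poly P (i + x) = poly (pcompose P [:i, 1:]) x" by (simp add: poly_pcompose add.commute)
  also have "\<dots> = (\<Sum>s\<le>degree (pcompose P [:i, 1:]). jet i s P * x ^ s)"
    by (simp add: poly_altdef jet_def)
  also have "\<dots> = (\<Sum>s\<le>D. jet i s P * x ^ s)"
    using assms by (intro sum.mono_neutral_left) (auto simp: jet_def degree_pcompose intro: coeff_eq_0)
  finally show ?thesis .
qed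

lemma pcompose_power: "pcompose (P ^ n) Q = pcompose P Q ^ n" for P :: "int poly"
  by (induction n) (simp_all add: pcompose_mult one_pCons pcompose_pCons)

lemma smult_sum_right: "smult c (\<Sum>j\<in>J. f j) = (\<Sum>j\<in>J. smult c (f j))" for c :: int
  by (induction J rule: infinite_finite_induct) (auto simp: smult_add_right)

lemma prime_inverse_mod:
  assumes "prime (p::int)" "\<not> p dvd a"
  shows "\<exists>b. p dvd a * b - 1"
proof -
  have "coprime p a" using assms by (simp add: prime_imp_coprime)
  then obtain x y where "x * p + y * a = 1"
    using bezout_int[of p a] by (auto simp: coprime_iff_gcd_eq_1)
  then have "a * y - 1 = p * (- x)" by (simp add: algebra_simps)
  then show ?thesis by (metis dvd_triv_left)
qed

lemma prime_solve_mod: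
  assumes "prime (p::int)" "\<not> p dvd a"
  shows "\<exists>b. p dvd a * b - c"
proof -
  obtain b where "p dvd a * b - 1" using prime_inverse_mod[OF assms] by blast
  then have "p dvd (a * b - 1) * c" by simp
  also have "(a * b - 1) * c = a * (b * c) - c" by (simp add: algebra_simps)
  finally show ?thesis by blast
qed

text \<open>The factor t + \<delta> is a unit among power series modulo \<open>p\<close>, so
  multiplication by its m-th power is invertible modulo t^l. The system is triangular: the new
  coefficient at t^l enters with the unit \<open>\<delta> ^ m\<close>.\<close>

lemma unit_shift_solve:
  fixes p \<delta> :: int
  assumes p: "prime p" "\<not> p dvd \<delta>"
  shows "\<exists>R. (\<forall>s\<ge>l. coeff R s = 0) \<and> (\<forall>s<l. p dvd coeff ([:\<delta>, 1:] ^ m * R) s - r s)"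
proof (induction l)
  case 0
  show ?case by (intro exI[of _ 0]) auto
next
  case (Suc l)
  then obtain R where R: "\<And>s. s \<ge> l \<Longrightarrow> coeff R s = 0"
    "\<And>s. s < l \<Longrightarrow> p dvd coeff ([:\<delta>, 1:] ^ m * R) s - r s" by blast
  have "\<not> p dvd \<delta> ^ m" using p prime_dvd_power by blast
  then obtain c where c: "p dvd \<delta> ^ m * c - (r l - coeff ([:\<delta>, 1:] ^ m * R) l)"
    using prime_solve_mod[OF p(1)] by blast
  have "coeff ([:\<delta>, 1:] ^ m) 0 = \<delta> ^ m" by (simp add: coeff_0_power)
  then have cf: "coeff ([:\<delta>, 1:] ^ m * monom c l) s = (if s < l then 0 else if s = l then \<delta> ^ m * c
     else coeff ([:\<delta>, 1:] ^ m * monom c l) s)" for s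
    by (auto simp: mult.commute[of _ "monom c l"] coeff_monom_mult)
  show ?case
  proof (intro exI[of _ "R + monom c l"] conjI allI impI)
    fix s assume "s \<ge> Suc l" then show "coeff (R + monom c l) s = 0" using R by simp
  next
    fix s assume s: "s < Suc l"
    then consider "s < l" | "s = l" by linarith
    then show "p dvd coeff ([:\<delta>, 1:] ^ m * (R + monom c l)) s - r s"
    proof cases
      case 1 then show ?thesis using R(2)[of s] cf[of s] by (simp add: distrib_left)
    next
      case 2 then show ?thesis using c cf[of s] by (simp add: distrib_left algebra_simps)
    qed
  qed
qed

lemma prime_not_dvd_small:
  assumes "prime p" "1 \<le> s" "s < (p::nat)"
  shows "\<not> int p dvd int s"
  using assms by (metis int_dvd_int_iff dvd_imp_le not_less not_one_le_zero neq0_conv)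

lemma prime_not_dvd_fact:
  assumes "prime p" "k < (p::nat)"
  shows "\<not> int p dvd int (fact k)"
  using assms by (metis int_dvd_int_iff prime_dvd_fact_iff not_less)

text \<open>The derivative is sought in the form k! (t - i')^(k-l) times a polynomial of degree less
  than \<open>l\<close>. The power of t - i' makes the jets at \<open>i'\<close> vanish exactly, and
  the \<open>l\<close> free coefficients produce the jets at \<open>i\<close>. The factor k! keeps
  the antiderivative integral and is a unit modulo \<open>p\<close> because
  \<open>k < p\<close>.\<close>

lemma hermite_one_sided:
  assumes p: "prime p" "k < p" and l: "l \<le> k" and ii: "\<not> int p dvd i - i'"
  shows "\<exists>Q. (\<forall>s>k. coeff Q s = 0) \<and> (\<forall>s\<in>{1..k-l}. jet i' s Q = 0) \<and>
     (\<forall>s\<in>{1..l}. int p dvd jet i s Q - v s)"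
proof (cases "l = 0")
  case True
  then show ?thesis by (intro exI[of _ 0]) auto
next
  case False
  have pp: "prime (int p)" using p by simp
  obtain w where w: "int p dvd int (fact k) * w - 1"
    using prime_inverse_mod[OF pp prime_not_dvd_fact[OF p]] by blast
  obtain R2 where R2: "\<And>s. s \<ge> l \<Longrightarrow> coeff R2 s = 0"
    "\<And>s. s < l \<Longrightarrow> int p dvd coeff ([:i - i', 1:] ^ (k - l) * R2) s - w * int (Suc s) * v (Suc s)"
    using unit_shift_solve[OF pp ii, of l "k - l" "\<lambda>s. w * int (Suc s) * v (Suc s)"] by blast
  define R where "R = [:i - i', 1:] ^ (k - l) * R2"
  define Q where "Q = (\<Sum>s<k. monom (int (fact k div Suc s) * coeff R s) (Suc s))"
  have degR: "coeff R s = 0" if "s \<ge> k" for s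
  proof (cases "R2 = 0")
    case False
    have "degree R2 < l" using R2(1) False leading_coeff_neq_0 by (metis not_le)
    moreover have "degree R \<le> degree ([:i - i', 1:] ^ (k - l)) + degree R2"
      unfolding R_def by (rule degree_mult_le)
    moreover have "degree ([:i - i', 1:] ^ (k - l)) \<le> k - l"
      using degree_power_le[of "[:i - i', 1:]" "k - l"] by simp
    ultimately have "degree R < k" using l by linarith
    then show ?thesis using that by (intro coeff_eq_0) simp
  qed (simp add: R_def)
  have cQ: "coeff Q (Suc s) = (if s < k then int (fact k div Suc s) * coeff R s else 0)" for s
    unfolding Q_def coeff_sum by (simp add: coeff_monom if_distrib cong: if_cong)
  have cQ': "int (Suc s) * coeff Q (Suc s) = int (fact k) * coeff R s" for s
  proof (cases "s < k")
    case True
    then have "Suc s dvd (fact k :: nat)" by (intro dvd_fact) auto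
    then have "int (Suc s) * int (fact k div Suc s) = int (fact k)"
      by (metis dvd_mult_div_cancel of_nat_mult)
    then show ?thesis using True by (simp add: cQ mult.assoc[symmetric] del: of_nat_Suc)
  next
    case False
    then show ?thesis by (simp add: cQ degR)
  qed
  have dQ: "pderiv Q = smult (int (fact k)) R"
    by (intro poly_eqI) (use cQ' in \<open>simp add: coeff_pderiv\<close>)
  \<comment> \<open>\<open>Q\<close> is written in the variable centred at \<open>i\<close>;
    \<open>Q'\<close> is its translate to the original variable, not its derivative.\<close>
  define Q' where "Q' = pcompose Q [:- i, 1:]"
  have jet_i: "jet i s Q' = coeff Q s" for s
    by (simp add: jet_def Q'_def pcompose_assoc[symmetric] pcompose_pCons)
  have jet_i': "jet i' s Q' = coeff (pcompose Q [:i' - i, 1:]) s" for s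
    by (simp add: jet_def Q'_def pcompose_assoc[symmetric] pcompose_pCons)
  have degQ: "degree Q \<le> k"
    unfolding Q_def by (intro degree_sum_le) (auto intro: order.trans[OF degree_monom_le])
  have "\<forall>s>k. coeff Q' s = 0"
    using degQ by (auto simp: Q'_def degree_pcompose intro!: coeff_eq_0)
  moreover have "jet i' s Q' = 0" if s: "s \<in> {1..k-l}" for s
  proof -
    obtain t where t: "s = Suc t" "t < k - l" using s by (cases s) auto
    have "int (Suc t) * jet i' s Q' = coeff (pderiv (pcompose Q [:i' - i, 1:])) t"
      unfolding jet_i' t coeff_pderiv by simp
    also have "pderiv (pcompose Q [:i' - i, 1:]) = pcompose (pderiv Q) [:i' - i, 1:]"
      by (simp add: pderiv_pcompose pderiv_pCons)
    also have "\<dots> = smult (int (fact k)) (pcompose ([:i - i', 1:] ^ (k - l)) [:i' - i, 1:] * pcompose R2 [:i' - i, 1:])"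
      by (simp add: dQ pcompose_smult R_def pcompose_mult)
    also have "pcompose ([:i - i', 1:] ^ (k - l)) [:i' - i, 1:] = monom 1 (k - l)"
      by (simp add: pcompose_power pcompose_pCons monom_altdef)
    also have "coeff (smult (int (fact k)) (monom 1 (k - l) * pcompose R2 [:i' - i, 1:])) t = 0"
      using t by (simp add: coeff_monom_mult)
    finally show ?thesis by simp
  qed
  moreover have "int p dvd jet i s Q' - v s" if s: "s \<in> {1..l}" for s
  proof -
    obtain t where t: "s = Suc t" "t < l" using s by (cases s) auto
    have "int p dvd int (fact k) * (coeff R t - w * int (Suc t) * v (Suc t)) + (int (fact k) * w - 1) * (int (Suc t) * v (Suc t))"
      using R2(2)[OF t(2)] w by (intro dvd_add dvd_mult dvd_mult2) (auto simp: R_def)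
    also have "\<dots> = int (Suc t) * (coeff Q (Suc t) - v (Suc t))"
      unfolding right_diff_distrib cQ' by (simp add: algebra_simps)
    finally have "int p dvd int (Suc t) * (coeff Q (Suc t) - v (Suc t))" .
    moreover have "\<not> int p dvd int (Suc t)" using t l p by (intro prime_not_dvd_small) auto
    ultimately show ?thesis using pp t by (simp add: prime_dvd_mult_iff jet_i)
  qed
  ultimately show ?thesis by blast
qed

definition lin :: "nat \<Rightarrow> (nat \<Rightarrow> int poly) \<Rightarrow> (nat \<Rightarrow> int) \<Rightarrow> int poly" where
  "lin k \<gamma> w = (\<Sum>j=1..k. smult (w j) (\<gamma> j))"

lemma jet_lin: "jet i s (lin k \<gamma> w) = (\<Sum>j=1..k. w j * jet i s (\<gamma> j))"
  by (simp add: lin_def jet_sum jet_smult)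

lemma poly_lin: "poly (lin k \<gamma> w) x = (\<Sum>j=1..k. w j * poly (\<gamma> j) x)"
  by (simp add: lin_def poly_sum)

text \<open>Successive approximation as in Hensel's lemma: the error of a solution modulo
  \<open>p ^ K\<close>, divided by \<open>p ^ K\<close>, is removed by solving once more modulo
  \<open>p\<close>. Linearity of \<open>L s\<close> means that no terms of higher order
  arise.\<close>

lemma lift_surj_mod:
  fixes L :: "'a \<Rightarrow> (nat \<Rightarrow> int) \<Rightarrow> int"
  assumes lin: "\<And>s w w' c. L s (\<lambda>j. w j + c * w' j) = L s w + c * L s w'"
    and surj: "\<And>v. \<exists>w. \<forall>s\<in>I. p dvd L s w - v s"
  shows "\<exists>w. \<forall>s\<in>I. p ^ K dvd L s w - v s"
proof (induction K)
  case (Suc K)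
  then obtain w where w: "\<forall>s\<in>I. p ^ K dvd L s w - v s" by blast
  define r where "r s = (L s w - v s) div p ^ K" for s
  have r: "L s w - v s = p ^ K * r s" if "s \<in> I" for s using w that by (simp add: r_def)
  obtain w' where w': "\<forall>s\<in>I. p dvd L s w' - (- r s)" using surj[of "\<lambda>s. - r s"] by blast
  show ?case
  proof (intro exI[of _ "\<lambda>j. w j + p ^ K * w' j"] ballI)
    fix s assume s: "s \<in> I"
    have "L s (\<lambda>j. w j + p ^ K * w' j) - v s = p ^ K * (L s w' - (- r s))"
      using r[OF s] lin[of s w "p ^ K" w'] by (simp add: algebra_simps)
    moreover have "p ^ Suc K dvd p ^ K * (L s w' - (- r s))"
      using w' s by (simp add: mult.commute)
    ultimately show "p ^ Suc K dvd L s (\<lambda>j. w j + p ^ K * w' j) - v s" by simp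
  qed
qed auto

text \<open>Modulo \<open>p\<close> the curve consists of the monomials, so
  \<open>lin k \<gamma> w\<close> realises every polynomial of degree at most \<open>k\<close> up to
  its constant term, which jets of positive order do not see. The interpolants for the two points
  are added.\<close>

lemma hermite_good_mod_p:
  assumes p: "prime p" "k < p" and l: "l \<le> k" and g: "good p k \<gamma>" and ii: "\<not> int p dvd i - i'"
  shows "\<exists>w. (\<forall>s\<in>{1..l}. int p dvd jet i s (lin k \<gamma> w) - v s) \<and>
             (\<forall>s\<in>{1..k-l}. int p dvd jet i' s (lin k \<gamma> w) - v' s)"
proof -
  obtain Q1 where Q1: "\<forall>s>k. coeff Q1 s = 0" "\<forall>s\<in>{1..k-l}. jet i' s Q1 = 0"
     "\<forall>s\<in>{1..l}. int p dvd jet i s Q1 - v s"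
    using hermite_one_sided[OF p l ii] by blast
  have ii': "\<not> int p dvd i' - i" using ii by (simp add: dvd_diff_commute)
  obtain Q2 where Q2: "\<forall>s>k. coeff Q2 s = 0" "\<forall>s\<in>{1..l}. jet i s Q2 = 0"
     "\<forall>s\<in>{1..k-l}. int p dvd jet i' s Q2 - v' s"
    using hermite_one_sided[OF p _ ii', of "k - l" v'] l by auto
  define Q where "Q = Q1 + Q2"
  have Q: "\<And>s. s > k \<Longrightarrow> coeff Q s = 0" using Q1 Q2 by (simp add: Q_def)
  define w where "w j = coeff Q j" for j
  have "\<forall>j\<in>{1..k}. \<exists>\<delta>. \<gamma> j = monom 1 j + smult (int p) \<delta>" using g by (simp add: good_def)
  then obtain \<delta> where \<delta>: "\<And>j. j \<in> {1..k} \<Longrightarrow> \<gamma> j = monom 1 j + smult (int p) (\<delta> j)" by metis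
  have degQ: "degree Q \<le> k" using Q by (intro degree_le) auto
  have Qs: "Q = [:coeff Q 0:] + (\<Sum>j=1..k. smult (w j) (monom 1 j))"
  proof (rule poly_eqI)
    fix s
    have "coeff (\<Sum>j=1..k. smult (w j) (monom 1 j)) s = (if s \<in> {1..k} then w s else 0)"
      by (simp add: coeff_sum if_distrib[of "\<lambda>x. _ * x"] cong: if_cong)
    then show "coeff Q s = coeff ([:coeff Q 0:] + (\<Sum>j=1..k. smult (w j) (monom 1 j))) s"
      using Q[of s] by (cases s) (auto simp: w_def)
  qed
  have "lin k \<gamma> w = (\<Sum>j=1..k. smult (w j) (monom 1 j)) + smult (int p) (\<Sum>j=1..k. smult (w j) (\<delta> j))"
    unfolding lin_def smult_sum_right sum.distrib[symmetric]
    by (intro sum.cong refl) (simp add: \<delta> smult_add_right mult.commute)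
  then have "lin k \<gamma> w + [:coeff Q 0:] = Q + smult (int p) (\<Sum>j=1..k. smult (w j) (\<delta> j))"
    using Qs by (simp add: algebra_simps)
  then have "jet x s (lin k \<gamma> w) = jet x s Q + int p * jet x s (\<Sum>j=1..k. smult (w j) (\<delta> j))" if "s \<ge> 1" for x s
    using that by (metis jet_add jet_smult jet_const add.right_neutral)
  then have jets: "int p dvd jet x s (lin k \<gamma> w) - jet x s Q" if "s \<ge> 1" for x s
    using that by simp
  show ?thesis
  proof (intro exI[of _ w] conjI ballI)
    fix s assume s: "s \<in> {1..l}"
    have "int p dvd (jet i s (lin k \<gamma> w) - jet i s Q) + (jet i s Q1 - v s)"
      using jets Q1 s by (intro dvd_add) auto
    then show "int p dvd jet i s (lin k \<gamma> w) - v s" using Q2 s by (simp add: Q_def jet_add)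
  next
    fix s assume s: "s \<in> {1..k-l}"
    have "int p dvd (jet i' s (lin k \<gamma> w) - jet i' s Q) + (jet i' s Q2 - v' s)"
      using jets Q2 s by (intro dvd_add) auto
    then show "int p dvd jet i' s (lin k \<gamma> w) - v' s" using Q1 s by (simp add: Q_def jet_add)
  qed
qed

text \<open>The \<open>k\<close> coefficients of a linear combination meet \<open>l\<close>
  conditions at \<open>i\<close> and \<open>k - l\<close> at \<open>i'\<close>. That these are
  independent is the transversality of the curve at points incongruent modulo
  \<open>p\<close>.\<close>

lemma hermite_good:
  assumes p: "prime p" "k < p" and l: "l \<le> k" and g: "good p k \<gamma>" and ii: "\<not> int p dvd i - i'"
  shows "\<exists>w. (\<forall>s\<in>{1..l}. int p ^ K dvd jet i s (lin k \<gamma> w) - v s) \<and>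
             (\<forall>s\<in>{1..k-l}. int p ^ K dvd jet i' s (lin k \<gamma> w))"
proof -
  define L where "L = (\<lambda>(x, s) w. jet x s (lin k \<gamma> w))"
  define I where "I = Pair i ` {1..l} \<union> Pair i' ` {1..k-l}"
  have ne: "i \<noteq> i'" using ii by auto
  have "\<exists>w. \<forall>s\<in>I. int p ^ K dvd L s w - (\<lambda>(x, s). if x = i then v s else 0) s"
  proof (rule lift_surj_mod)
    fix s w w' c
    show "L s (\<lambda>j. w j + c * w' j) = L s w + c * L s w'"
      by (cases s) (simp add: L_def jet_lin distrib_right sum.distrib sum_distrib_left mult.assoc)
  next
    fix v2 :: "int \<times> nat \<Rightarrow> int"
    obtain w where "(\<forall>s\<in>{1..l}. int p dvd jet i s (lin k \<gamma> w) - v2 (i, s)) \<and>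
             (\<forall>s\<in>{1..k-l}. int p dvd jet i' s (lin k \<gamma> w) - v2 (i', s))"
      using hermite_good_mod_p[OF p l g ii, of "\<lambda>s. v2 (i, s)" "\<lambda>s. v2 (i', s)"] by blast
    then show "\<exists>w. \<forall>s\<in>I. int p dvd L s w - v2 s" by (intro exI[of _ w]) (auto simp: I_def L_def)
  qed
  then obtain w where w: "\<forall>s\<in>I. int p ^ K dvd L s w - (\<lambda>(x, s). if x = i then v s else 0) s" by blast
  show ?thesis
  proof (intro exI[of _ w] conjI ballI)
    fix s assume "s \<in> {1..l}"
    then have "(i, s) \<in> I" by (auto simp: I_def)
    then show "int p ^ K dvd jet i s (lin k \<gamma> w) - v s" using w by (fastforce simp: L_def)
  next
    fix s assume "s \<in> {1..k-l}"
    then have "(i', s) \<in> I" by (auto simp: I_def)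
    then show "int p ^ K dvd jet i' s (lin k \<gamma> w)" using w ne by (fastforce simp: L_def)
  qed
qed

text \<open>A polynomial whose jet of order \<open>l\<close> at \<open>i\<close> is \<open>(t - i)\<^sup>h\<close> becomes, after zooming into
  \<open>i + p\<^sup>a \<int>\<close> and dividing by \<open>p\<^sup>a\<^sup>h\<close>, congruent to \<open>t\<^sup>h\<close> modulo \<open>p\<close>.\<close>

lemma zoom_poly:
  fixes P :: "int poly"
  assumes p: "p > 0" and a: "a \<ge> 1" and h: "1 \<le> h" "h \<le> l"
    and jets: "\<And>s. s \<in> {1..l} \<Longrightarrow> int p ^ K dvd jet i s P - (if s = h then 1 else 0)"
  shows "\<exists>\<delta>. \<forall>m. int p ^ K dvd poly P (i + int p ^ a * m)
      - (poly P i + int p ^ (a * h) * poly (monom 1 h + smult (int p) \<delta>) m)"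
proof -
  define D where "D = max (degree P) l"
  \<comment> \<open>The Taylor terms of order above \<open>l\<close>. Since \<open>s > h\<close> and
    \<open>a \<ge> 1\<close>, the power p^(a s) is divisible by p^(a h + 1); the extra
    \<open>p\<close> is the one in front of \<open>\<delta>\<close> in the normal form.\<close>
  define \<delta> where "\<delta> = (\<Sum>s=Suc l..D. monom (int p ^ (a * (s - h) - 1) * jet i s P) s)"
  have lD: "l \<le> D" by (simp add: D_def)
  have "int p ^ K dvd poly P (i + int p ^ a * m)
      - (poly P i + int p ^ (a * h) * poly (monom 1 h + smult (int p) \<delta>) m)" for m
  proof -
    define y where "y = int p ^ a * m"
    have P0: "jet i 0 P = poly P i"
      by (simp add: jet_def coeff_pcompose_0)
    have "poly P (i + y) = (\<Sum>s\<le>D. jet i s P * y ^ s)" by (intro poly_taylor) (simp add: D_def)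
    also have "{..D} = {0} \<union> {1..l} \<union> {Suc l..D}" using lD by auto
    also have "(\<Sum>s\<in>\<dots>. jet i s P * y ^ s) = poly P i + (\<Sum>s=1..l. jet i s P * y ^ s) + (\<Sum>s=Suc l..D. jet i s P * y ^ s)"
      by (subst sum.union_disjoint; (subst sum.union_disjoint)?) (auto simp: P0)
    finally have 1: "poly P (i + y) = poly P i + (\<Sum>s=1..l. jet i s P * y ^ s) + (\<Sum>s=Suc l..D. jet i s P * y ^ s)" .
    have 2: "int p ^ (a * h) * (int p * poly \<delta> m) = (\<Sum>s=Suc l..D. jet i s P * y ^ s)"
      unfolding \<delta>_def poly_sum sum_distrib_left
    proof (intro sum.cong refl)
      fix s assume s: "s \<in> {Suc l..D}"
      then have "s - h \<ge> 1" using h by auto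
      then have "a * (s - h) \<ge> 1" using a by (metis One_nat_def Suc_leI mult_pos_pos not_le not_less_eq_eq zero_less_Suc order_less_le_trans)
      then have "a * h + (1 + (a * (s - h) - 1)) = a * h + a * (s - h)" by linarith
      also have "\<dots> = a * (h + (s - h))" by (simp add: distrib_left)
      also have "\<dots> = a * s" using s h by simp
      finally have "int p ^ (a * h) * (int p * int p ^ (a * (s - h) - 1)) = int p ^ (a * s)"
        by (metis power_add power_one_right)
      then show "int p ^ (a * h) * (int p * poly (monom (int p ^ (a * (s - h) - 1) * jet i s P) s) m) = jet i s P * y ^ s"
        by (simp add: poly_monom y_def power_mult_distrib power_mult)
    qed
    have 3: "int p ^ (a * h) * m ^ h = (\<Sum>s=1..l. (if s = h then 1 else 0) * y ^ s)"
    proof -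
      have "(\<Sum>s=1..l. (if s = h then 1 else 0) * y ^ s) = (\<Sum>s=1..l. (if s = h then y ^ s else 0))"
        by (intro sum.cong) auto
      also have "\<dots> = y ^ h" using h by simp
      finally show ?thesis by (simp add: y_def power_mult_distrib power_mult)
    qed
    have "poly P (i + y) - (poly P i + int p ^ (a * h) * poly (monom 1 h + smult (int p) \<delta>) m)
       = (\<Sum>s=1..l. jet i s P * y ^ s) - (\<Sum>s=1..l. (if s = h then 1 else 0) * y ^ s)"
      unfolding 1 2[symmetric] 3[symmetric] by (simp add: poly_monom algebra_simps)
    also have "\<dots> = (\<Sum>s=1..l. (jet i s P - (if s = h then 1 else 0)) * y ^ s)"
      by (simp add: sum_subtractf left_diff_distrib)
    also have "int p ^ K dvd \<dots>" using jets by (intro dvd_sum dvd_mult2) auto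
    finally show ?thesis by (simp add: y_def)
  qed
  then show ?thesis by blast
qed

text \<open>The terms of order 1 to \<open>r\<close> vanish modulo \<open>p ^ K\<close> by
  hypothesis, and a term of order \<open>s > r\<close> carries the power \<open>p ^ (c * s)\<close>
  with \<open>c * s \<ge> Suc r * c\<close>.\<close>

lemma flat_poly:
  fixes P :: "int poly"
  assumes jets: "\<And>s. s \<in> {1..r} \<Longrightarrow> int p ^ K dvd jet i s P" and K: "K \<le> Suc r * c"
  shows "int p ^ K dvd poly P (i + int p ^ c * m) - poly P i"
proof -
  define y where "y = int p ^ c * m"
  have P0: "jet i 0 P = poly P i"
      by (simp add: jet_def coeff_pcompose_0)
  have "poly P (i + y) = (\<Sum>s\<le>degree P. jet i s P * y ^ s)" by (intro poly_taylor) simp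
  also have "\<dots> = poly P i + (\<Sum>s\<in>{..degree P} - {0}. jet i s P * y ^ s)"
    by (subst sum.remove[of _ 0]) (auto simp: P0)
  finally have "poly P (i + y) - poly P i = (\<Sum>s\<in>{..degree P} - {0}. jet i s P * y ^ s)" by simp
  also have "int p ^ K dvd \<dots>"
  proof (intro dvd_sum)
    fix s assume s: "s \<in> {..degree P} - {0}"
    show "int p ^ K dvd jet i s P * y ^ s"
    proof (cases "s \<le> r")
      case True then show ?thesis using jets[of s] s by (intro dvd_mult2) auto
    next
      case False
      then have "Suc r * c \<le> s * c" by (intro mult_right_mono) auto
      then have "K \<le> c * s" using K by (simp add: mult.commute)
      then have "int p ^ K dvd int p ^ (c * s)" by (rule le_imp_power_dvd)
      then show ?thesis by (simp add: y_def power_mult_distrib power_mult)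
    qed
  qed
  finally show ?thesis by (simp add: y_def)
qed

text \<open>The uncertainty principle in exact form. Interpolation gives \<open>l\<close>
  combinations of the coordinates that look like t, ..., t^l at \<open>i\<close> and are flat to
  order \<open>k - l\<close> at \<open>i'\<close>. Hence a character \<open>u\<close> of the zoomed
  curve at level \<open>B\<close> is, up to a constant, the restriction of a character
  \<open>v\<close> of the original curve, and flatness makes \<open>v\<close> constant on the class
  of \<open>i'\<close> modulo \<open>p ^ c\<close> once \<open>c\<close> is large enough.\<close>

lemma rescale:
  assumes g: "good p k \<gamma>" and p: "prime p" "k < p" and l: "1 \<le> l" "l \<le> k" and a: "1 \<le> a"
    and ii: "\<not> int p dvd i - i'" and b: "l * (a + B) \<le> k * b"
  shows "\<exists>\<gamma>'. good p l \<gamma>' \<and> (\<forall>u\<in>phases l \<gamma>' (p ^ (l * B)). \<exists>v\<in>phases k \<gamma> (p ^ (k * b)).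
     (\<exists>\<omega>. norm \<omega> = 1 \<and> (\<forall>m. v (i + int p ^ a * m) = \<omega> * u m)) \<and>
     (\<forall>c. l * (a + B) \<le> (k - l + 1) * c \<longrightarrow> (\<exists>\<omega>. norm \<omega> = 1 \<and> (\<forall>m. v (i' + int p ^ c * m) = \<omega>))))"
proof -
  \<comment> \<open>The p-adic precision required: zooming divides the coordinate \<open>h\<close>
    by p^(a h), after which level \<open>B\<close> asks for l B further digits, and \<open>h\<close>
    is at most \<open>l\<close>.\<close>
  define K where "K = l * (a + B)"
  have p0: "p > 0" using p by (simp add: prime_gt_0_nat)
  have "\<forall>h\<in>{1..l}. \<exists>w. (\<forall>s\<in>{1..l}. int p ^ K dvd jet i s (lin k \<gamma> w) - (if s = h then 1 else 0)) \<and>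
             (\<forall>s\<in>{1..k-l}. int p ^ K dvd jet i' s (lin k \<gamma> w))"
    by (intro ballI hermite_good[OF p l(2) g ii])
  then obtain w where w: "\<And>h s. h \<in> {1..l} \<Longrightarrow> s \<in> {1..l} \<Longrightarrow> int p ^ K dvd jet i s (lin k \<gamma> (w h)) - (if s = h then 1 else 0)"
    "\<And>h s. h \<in> {1..l} \<Longrightarrow> s \<in> {1..k-l} \<Longrightarrow> int p ^ K dvd jet i' s (lin k \<gamma> (w h))"
    by (metis (no_types, lifting))
  define P where "P h = lin k \<gamma> (w h)" for h
  have "\<forall>h\<in>{1..l}. \<exists>\<delta>. \<forall>m. int p ^ K dvd poly (P h) (i + int p ^ a * m)
      - (poly (P h) i + int p ^ (a * h) * poly (monom 1 h + smult (int p) \<delta>) m)"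
    unfolding P_def by (intro ballI zoom_poly[OF p0 a] w(1)) auto
  then obtain \<delta> where \<delta>: "\<And>h m. h \<in> {1..l} \<Longrightarrow> int p ^ K dvd poly (P h) (i + int p ^ a * m)
      - (poly (P h) i + int p ^ (a * h) * poly (monom 1 h + smult (int p) (\<delta> h)) m)"
    by metis
  define \<gamma>' where "\<gamma>' h = monom 1 h + smult (int p) (\<delta> h)" for h
  have g': "good p l \<gamma>'" by (auto simp: good_def \<gamma>'_def)
  have "\<exists>v\<in>phases k \<gamma> (p ^ (k * b)).
     (\<exists>\<omega>. norm \<omega> = 1 \<and> (\<forall>m. v (i + int p ^ a * m) = \<omega> * u m)) \<and>
     (\<forall>c. K \<le> (k - l + 1) * c \<longrightarrow> (\<exists>\<omega>. norm \<omega> = 1 \<and> (\<forall>m. v (i' + int p ^ c * m) = \<omega>)))"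
    if u: "u \<in> phases l \<gamma>' (p ^ (l * B))" for u
  proof -
    obtain y :: "nat \<Rightarrow> int" where y: "u = (\<lambda>m. e (real_of_int (\<Sum>h=1..l. y h * poly (\<gamma>' h) m) / real (p ^ (l * B))))"
      using u by (auto simp: phases_def)
    \<comment> \<open>\<open>f h\<close> lowers the denominator \<open>p ^ (k * b)\<close> to p^(l B
      + a h); the zoom into the class of \<open>i\<close> then absorbs p^(a h) and leaves the
      denominator of \<open>u\<close>.\<close>
    define f where "f h = int p ^ (k * b - l * B - a * h)" for h
    have le: "a * h + l * B \<le> k * b" if "h \<in> {1..l}" for h
    proof -
      have "a * h \<le> a * l" using that by simp
      then have "a * h + l * B \<le> l * (a + B)" by (simp add: algebra_simps)
      then show ?thesis using b by linarith
    qed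
    have fK: "int p ^ (k * b) dvd f h * int p ^ K" if "h \<in> {1..l}" for h
    proof -
      have "k * b \<le> (k * b - l * B - a * h) + K"
      proof -
        have "a * h \<le> a * l" using that by simp
        then have 1: "a * h + l * B \<le> K" by (simp add: K_def algebra_simps)
        have "k * b = (k * b - l * B - a * h) + (a * h + l * B)" using le[OF that] by simp
        also have "\<dots> \<le> (k * b - l * B - a * h) + K" using 1 by (rule add_left_mono)
        finally show ?thesis .
      qed
      then have "int p ^ (k * b) dvd int p ^ ((k * b - l * B - a * h) + K)" by (rule le_imp_power_dvd)
      then show ?thesis by (simp add: f_def power_add)
    qed
    have fa: "f h * int p ^ (a * h) = int p ^ (k * b - l * B)" if "h \<in> {1..l}" for h
      using le[OF that] by (simp add: f_def flip: power_add)
    define x where "x j = (\<Sum>h=1..l. f h * y h * w h j)" for j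
    define X where "X n = (\<Sum>j=1..k. x j * poly (\<gamma> j) n)" for n
    have X: "X n = (\<Sum>h=1..l. f h * y h * poly (P h) n)" for n
      unfolding X_def x_def P_def poly_lin sum_distrib_left sum_distrib_right
      by (subst sum.swap) (simp add: mult.assoc)
    define v where "v = (\<lambda>n. e (real_of_int (X n) / real (p ^ (k * b))))"
    have v: "v \<in> phases k \<gamma> (p ^ (k * b))" unfolding v_def X_def by (rule phasesI)
    have q: "p ^ (k * b) > 0" using p0 by simp
    have A: "v (i + int p ^ a * m) = v i * u m" for m
    proof -
      have "int (p ^ (k * b)) dvd (\<Sum>h=1..l. y h * (f h * (poly (P h) (i + int p ^ a * m)
            - (poly (P h) i + int p ^ (a * h) * poly (\<gamma>' h) m))))"
      proof (rule dvd_sum, rule dvd_mult)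
        fix h assume h: "h \<in> {1..l}"
        show "int (p ^ (k * b)) dvd f h * (poly (P h) (i + int p ^ a * m)
            - (poly (P h) i + int p ^ (a * h) * poly (\<gamma>' h) m))"
          using dvd_trans[OF fK[OF h] mult_dvd_mono[OF dvd_refl \<delta>[OF h, of m], of "f h"]] by (simp add: \<gamma>'_def)
      qed
      also have "\<dots> = X (i + int p ^ a * m) - (X i + int p ^ (k * b - l * B) * (\<Sum>h=1..l. y h * poly (\<gamma>' h) m))"
      proof -
        have "(\<Sum>h=1..l. y h * (f h * (poly (P h) (i + int p ^ a * m)
            - (poly (P h) i + int p ^ (a * h) * poly (\<gamma>' h) m))))
          = (\<Sum>h=1..l. f h * y h * poly (P h) (i + int p ^ a * m) - (f h * y h * poly (P h) i
             + int p ^ (k * b - l * B) * (y h * poly (\<gamma>' h) m)))"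
          by (intro sum.cong refl, subst fa[symmetric], assumption) (simp add: algebra_simps)
        then show ?thesis by (simp add: X sum_subtractf sum.distrib sum_distrib_left)
      qed
      finally have "v (i + int p ^ a * m) = e (real_of_int (X i + int p ^ (k * b - l * B) * (\<Sum>h=1..l. y h * poly (\<gamma>' h) m)) / real (p ^ (k * b)))"
        unfolding v_def by (intro e_div_cong q)
      also have "real_of_int (X i + int p ^ (k * b - l * B) * (\<Sum>h=1..l. y h * poly (\<gamma>' h) m)) / real (p ^ (k * b))
        = real_of_int (X i) / real (p ^ (k * b)) + real_of_int (\<Sum>h=1..l. y h * poly (\<gamma>' h) m) / real (p ^ (l * B))"
      proof -
        have "l * B \<le> k * b" using le[of 1] l by auto
        then have "real (p ^ (k * b)) = real (p ^ (k * b - l * B)) * real (p ^ (l * B))"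
          by (metis le_add_diff_inverse2 of_nat_mult power_add)
        then show ?thesis using p0 by (simp add: add_divide_distrib)
      qed
      finally show ?thesis by (simp add: e_add v_def y)
    qed
    have Bc: "v (i' + int p ^ c * m) = v i'" if c: "K \<le> (k - l + 1) * c" for c m
      unfolding v_def
    proof (intro e_div_cong q)
      have "int (p ^ (k * b)) dvd (\<Sum>h=1..l. y h * (f h * (poly (P h) (i' + int p ^ c * m) - poly (P h) i')))"
      proof (rule dvd_sum, rule dvd_mult)
        fix h assume h: "h \<in> {1..l}"
        have "int p ^ K dvd poly (P h) (i' + int p ^ c * m) - poly (P h) i'"
          using w(2)[OF h] c by (intro flat_poly[where r = "k - l"]) (auto simp: P_def)
        then show "int (p ^ (k * b)) dvd f h * (poly (P h) (i' + int p ^ c * m) - poly (P h) i')"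
          using fK[OF h] by (metis dvd_trans dvd_refl mult_dvd_mono of_nat_power)
      qed
      also have "\<dots> = X (i' + int p ^ c * m) - X i'"
        unfolding X sum_subtractf[symmetric] by (intro sum.cong refl) (simp add: algebra_simps)
      finally show "int (p ^ (k * b)) dvd \<dots>" .
    qed
    have nv: "norm (v n) = 1" for n by (simp add: v_def)
    show ?thesis
      by (intro bexI[OF _ v] conjI exI[of _ "v i"] nv allI A impI exI[of _ "v i'"] Bc)
  qed
  then show ?thesis using g' unfolding K_def by blast
qed

section \<open>Bilinear estimates\<close>

lemma es_zoom:
  assumes p: "p > 0" and T: "T \<subseteq> cls (int p ^ a) i" and v: "\<And>m. v (i + int p ^ a * m) = \<omega> * u' m"
  shows "es A T (\<lambda>n. u n * v n) =
    \<omega> * es (\<lambda>m. A (i + int p ^ a * m) * u (i + int p ^ a * m)) {m. i + int p ^ a * m \<in> T} u'"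
proof -
  let ?h = "\<lambda>m. i + int p ^ a * m"
  have bij: "bij_betw ?h {m. ?h m \<in> T} T"
  proof (rule bij_betwI')
    fix y assume y: "y \<in> T"
    then obtain m where "y - i = int p ^ a * m" using T by (auto simp: cls_def)
    then have "y = ?h m" by simp
    then show "\<exists>m\<in>{m. ?h m \<in> T}. y = ?h m" using y by blast
  qed (use p in auto)
  have "es A T (\<lambda>n. u n * v n) = (\<Sum>m\<in>{m. ?h m \<in> T}. A (?h m) * (u (?h m) * v (?h m)))"
    unfolding es_def by (rule sum.reindex_bij_betw[OF bij, symmetric])
  also have "\<dots> = \<omega> * es (\<lambda>m. A (?h m) * u (?h m)) {m. ?h m \<in> T} u'"
    unfolding es_def sum_distrib_left v by (intro sum.cong refl) (simp only: mult_ac)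
  finally show ?thesis .
qed

lemma es_const_phase:
  assumes "\<And>n. n \<in> T \<Longrightarrow> v n = \<omega>"
  shows "es A T (\<lambda>n. u n * v n) = \<omega> * es A T u"
  using assms by (simp add: es_def sum_distrib_left mult_ac)

lemma bij_betw_res:
  assumes p: "p > 0"
  shows "bij_betw (\<lambda>m. (i + int p ^ a * m) mod int p ^ (a + B)) {0..<int p ^ B} (res (int p ^ (a + B)) (int p ^ a) i)"
proof (rule bij_betwI')
  fix x y assume xy: "x \<in> {0..<int p ^ B}" "y \<in> {0..<int p ^ B}"
  have "(i + int p ^ a * x) mod int p ^ (a + B) = (i + int p ^ a * y) mod int p ^ (a + B)
    \<longleftrightarrow> int p ^ a * int p ^ B dvd int p ^ a * (x - y)"
    by (simp add: mod_eq_dvd_iff algebra_simps power_add)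
  also have "\<dots> \<longleftrightarrow> int p ^ B dvd x - y" using p by simp
  also have "\<dots> \<longleftrightarrow> x = y" using xy by (auto simp: mod_eq_dvd_iff[symmetric])
  finally show "(i + int p ^ a * x) mod int p ^ (a + B) = (i + int p ^ a * y) mod int p ^ (a + B) \<longleftrightarrow> x = y" .
next
  fix x assume "x \<in> {0..<int p ^ B}"
  have "int p ^ a dvd int p ^ a * x - int p ^ (a + B) * ((i + int p ^ a * x) div int p ^ (a + B))"
    by (simp add: power_add)
  also have "\<dots> = (i + int p ^ a * x) mod int p ^ (a + B) - i"
    by (simp add: minus_mult_div_eq_mod[symmetric])
  finally show "(i + int p ^ a * x) mod int p ^ (a + B) \<in> res (int p ^ (a + B)) (int p ^ a) i"
    using p by (simp add: res_def)
next
  fix y assume y: "y \<in> res (int p ^ (a + B)) (int p ^ a) i"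
  then obtain m where m: "y = i + int p ^ a * m" by (auto simp: res_def dvd_def algebra_simps)
  have "(i + int p ^ a * (m mod int p ^ B)) mod int p ^ (a + B) = y mod int p ^ (a + B)"
    unfolding m mod_eq_dvd_iff
    by (simp add: power_add mod_eq_dvd_iff[symmetric] flip: right_diff_distrib)
  also have "\<dots> = y" using y by (simp add: res_def)
  finally show "\<exists>x\<in>{0..<int p ^ B}. y = (i + int p ^ a * x) mod int p ^ (a + B)"
    using p by (intro bexI[of _ "m mod int p ^ B"]) auto
qed

text \<open>The mean over \<open>U\<close> does not change if one averages in addition over
  translations by the characters obtained from \<open>rescale\<close>. For fixed \<open>u\<close>
  these translations turn the class of \<open>i\<close> into a sum along a good curve in dimension
  \<open>l\<close>, to which \<open>dec\<close> applies, while the weight \<open>w\<close> is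
  invariant under them. Minkowski's inequality then exchanges the outer mean with the sum over
  subclasses.\<close>

lemma local_decoup:
  assumes dec: "decoup p l B D" and D: "D \<ge> 0"
    and g: "good p k \<gamma>" and p: "prime p" "k < p" and l: "1 \<le> l" "l \<le> k" and a: "1 \<le> a"
    and ii: "\<not> int p dvd i - i'" and b: "l * (a + B) \<le> k * b" and S: "finite S"
  defines "U \<equiv> phases k \<gamma> (p ^ (k * b))"
  assumes w0: "\<And>u. 0 \<le> w u"
    and w: "\<And>u v. v \<in> U \<Longrightarrow> (\<And>c. l * (a + B) \<le> (k - l + 1) * c \<Longrightarrow>
        \<exists>\<omega>. norm \<omega> = 1 \<and> (\<forall>m. v (i' + int p ^ c * m) = \<omega>)) \<Longrightarrow> w (\<lambda>n. u n * v n) = w u"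
    and K0: "\<And>j. 0 \<le> K j"
    and K: "\<And>j. j \<in> res (int p ^ (a + B)) (int p ^ a) i \<Longrightarrow>
      mean U (\<lambda>u. w u * norm (es A (S \<inter> cls (int p ^ (a + B)) j) u) ^ (2 * tri l)) \<le> K j ^ tri l"
  shows "mean U (\<lambda>u. w u * norm (es A (S \<inter> cls (int p ^ a) i) u) ^ (2 * tri l))
    \<le> D * (\<Sum>j\<in>res (int p ^ (a + B)) (int p ^ a) i. K j) ^ tri l"
proof -
  have p0: "p > 0" using p by (simp add: prime_gt_0_nat)
  have U: "char_group U" unfolding U_def using p0 by (intro char_group_phases) auto
  obtain \<gamma>' where g': "good p l \<gamma>'" and ex: "\<forall>u\<in>phases l \<gamma>' (p ^ (l * B)). \<exists>v\<in>U.
     (\<exists>\<omega>. norm \<omega> = 1 \<and> (\<forall>m. v (i + int p ^ a * m) = \<omega> * u m)) \<and>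
     (\<forall>c. l * (a + B) \<le> (k - l + 1) * c \<longrightarrow> (\<exists>\<omega>. norm \<omega> = 1 \<and> (\<forall>m. v (i' + int p ^ c * m) = \<omega>)))"
    using rescale[OF g p l a ii b] unfolding U_def by blast
  define U' where "U' = phases l \<gamma>' (p ^ (l * B))"
  have U': "char_group U'" unfolding U'_def using p0 by (intro char_group_phases) auto
  obtain V where V: "\<And>u. u \<in> U' \<Longrightarrow> V u \<in> U"
     "\<And>u. u \<in> U' \<Longrightarrow> \<exists>\<omega>. norm \<omega> = 1 \<and> (\<forall>m. V u (i + int p ^ a * m) = \<omega> * u m)"
     "\<And>u c. u \<in> U' \<Longrightarrow> l * (a + B) \<le> (k - l + 1) * c \<Longrightarrow> \<exists>\<omega>. norm \<omega> = 1 \<and> (\<forall>m. V u (i' + int p ^ c * m) = \<omega>)"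
    using ex unfolding U'_def[symmetric] by metis
  define h where "h m = i + int p ^ a * m" for m
  define A' where "A' u = (\<lambda>m. A (h m) * u (h m))" for u
  define S' where "S' = {m. h m \<in> S}"
  define T where "T = tri l"
  have T: "T \<ge> 1" using tri_pos[OF l(1)] by (simp add: T_def)
  have S': "finite S'" unfolding S'_def
    using finite_vimageI[OF S, of h] p0 by (auto simp: h_def vimage_def inj_on_def)
  have norm_zoom: "norm (es A R (\<lambda>n. u n * V u' n)) = norm (es (A' u) {m. h m \<in> R} u')"
    if u': "u' \<in> U'" and R: "R \<subseteq> cls (int p ^ a) i" for u u' R
  proof -
    obtain \<omega> where "norm \<omega> = 1" "\<forall>m. V u' (i + int p ^ a * m) = \<omega> * u' m" using V(2)[OF u'] by blast
    then show ?thesis using es_zoom[OF p0 R, of "V u'" \<omega> u' A u] by (simp add: h_def A'_def norm_mult)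
  qed
  define \<sigma> where "\<sigma> m = (i + int p ^ a * m) mod int p ^ (a + B)" for m
  have bij: "bij_betw \<sigma> {0..<int p ^ B} (res (int p ^ (a + B)) (int p ^ a) i)"
    unfolding \<sigma>_def by (rule bij_betw_res[OF p0])
  have sub: "cls (int p ^ (a + B)) (\<sigma> m) \<subseteq> cls (int p ^ a) i" if "m \<in> {0..<int p ^ B}" for m
  proof
    fix n assume n: "n \<in> cls (int p ^ (a + B)) (\<sigma> m)"
    have "\<sigma> m \<in> res (int p ^ (a + B)) (int p ^ a) i" using bij that by (auto simp: bij_betw_def)
    then have "int p ^ a dvd (n - \<sigma> m) + (\<sigma> m - i)"
      using n by (intro dvd_add) (auto simp: cls_def res_def power_add dest: dvd_mult_left)
    then show "n \<in> cls (int p ^ a) i" by (simp add: cls_def)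
  qed
  have set1: "{m. h m \<in> S \<inter> cls (int p ^ a) i} = S'" by (auto simp: S'_def h_def cls_def)
  have set2: "{m. h m \<in> S \<inter> cls (int p ^ (a + B)) (\<sigma> m0)} = S' \<inter> cls (int p ^ B) m0" for m0
  proof -
    have "int p ^ (a + B) dvd h m - \<sigma> m0 \<longleftrightarrow> int p ^ B dvd m - m0" for m
    proof -
      have "int p ^ (a + B) dvd h m - \<sigma> m0 \<longleftrightarrow> h m mod int p ^ (a + B) = h m0 mod int p ^ (a + B)"
        unfolding \<sigma>_def h_def[symmetric] by (simp add: mod_eq_dvd_iff[symmetric])
      also have "\<dots> \<longleftrightarrow> int p ^ a * int p ^ B dvd int p ^ a * (m - m0)"
        by (simp add: mod_eq_dvd_iff h_def power_add algebra_simps)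
      finally show ?thesis using p0 by simp
    qed
    then show ?thesis by (auto simp: S'_def cls_def)
  qed
  \<comment> \<open>The exact norms of the pieces for fixed \<open>u\<close>: decoupling is applied
    for each \<open>u\<close> separately, before the mean over \<open>u\<close> is taken.\<close>
  define N where "N u m = root T (mean U' (\<lambda>u'. norm (es (A' u) (S' \<inter> cls (int p ^ B) m) u') ^ (2 * T)))" for u m
  have N0: "0 \<le> N u m" for u m unfolding N_def by (intro real_root_ge_zero mean_nonneg) auto
  have NT: "N u m ^ T = mean U' (\<lambda>u'. norm (es (A' u) (S' \<inter> cls (int p ^ B) m) u') ^ (2 * T))" for u m
    unfolding N_def using T by (intro real_root_pow_pos2 mean_nonneg) auto
  \<comment> \<open>Invariance is used for one \<open>u'\<close> at a time, so an arbitrary choice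
    of \<open>V u'\<close> will do; \<open>V\<close> need not respect products.\<close>
  have avg: "mean U G = mean U (\<lambda>u. mean U' (\<lambda>u'. G (\<lambda>n. u n * V u' n)))" for G
  proof -
    have "mean U' (\<lambda>u'. mean U (\<lambda>u. G (\<lambda>n. u n * V u' n))) = mean U' (\<lambda>u'. mean U G)"
      by (intro mean_cong mean_shift[OF U] V)
    then show ?thesis using mean_const[of U' "mean U G"] char_groupD[OF U'] by (subst mean_swap) simp
  qed
  have wV: "w (\<lambda>n. u n * V u' n) = w u" if "u' \<in> U'" for u u'
    by (rule w) (use V that in auto)
  have "mean U (\<lambda>u. w u * norm (es A (S \<inter> cls (int p ^ a) i) u) ^ (2 * T)) =
     mean U (\<lambda>u. w u * mean U' (\<lambda>u'. norm (es (A' u) S' u') ^ (2 * T)))"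
  proof -
    have "mean U (\<lambda>u. w u * norm (es A (S \<inter> cls (int p ^ a) i) u) ^ (2 * T)) =
       mean U (\<lambda>u. mean U' (\<lambda>u'. w (\<lambda>n. u n * V u' n) * norm (es A (S \<inter> cls (int p ^ a) i) (\<lambda>n. u n * V u' n)) ^ (2 * T)))"
      by (rule avg)
    also have "\<dots> = mean U (\<lambda>u. mean U' (\<lambda>u'. w u * norm (es (A' u) S' u') ^ (2 * T)))"
      by (intro mean_cong) (simp only: wV norm_zoom[OF _ Int_lower2] set1)
    finally show ?thesis by (simp only: mean_cmult)
  qed
  also have "\<dots> \<le> mean U (\<lambda>u. w u * (D * (\<Sum>m\<in>{0..<int p ^ B}. N u m) ^ T))"
  proof (intro mean_mono mult_left_mono w0)
    fix u
    show "mean U' (\<lambda>u'. norm (es (A' u) S' u') ^ (2 * T)) \<le> D * (\<Sum>m\<in>{0..<int p ^ B}. N u m) ^ T"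
      unfolding T_def U'_def
      by (intro decoupD[OF dec g' S' N0]) (use NT[of u] in \<open>simp add: T_def U'_def\<close>)
  qed
  also have "\<dots> = D * mean U (\<lambda>u. (\<Sum>m\<in>{0..<int p ^ B}. root T (w u) * N u m) ^ T)"
  proof -
    have "(\<Sum>m\<in>{0..<int p ^ B}. root T (w u) * N u m) ^ T = w u * (\<Sum>m\<in>{0..<int p ^ B}. N u m) ^ T" for u
      using T w0 by (simp add: power_mult_distrib flip: sum_distrib_left)
    then show ?thesis by (simp only: mean_cmult[symmetric] mult.left_commute)
  qed
  also have "\<dots> \<le> D * (\<Sum>m\<in>{0..<int p ^ B}. K (\<sigma> m)) ^ T"
  proof (intro mult_left_mono D mean_minkowski T K0)
    fix m assume m: "m \<in> {0..<int p ^ B}"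
    have "mean U (\<lambda>u. (root T (w u) * N u m) ^ T) =
       mean U (\<lambda>u. w u * mean U' (\<lambda>u'. norm (es (A' u) (S' \<inter> cls (int p ^ B) m) u') ^ (2 * T)))"
      using T w0 by (simp add: power_mult_distrib NT)
    also have "\<dots> = mean U (\<lambda>u. mean U' (\<lambda>u'. w u * norm (es (A' u) (S' \<inter> cls (int p ^ B) m) u') ^ (2 * T)))"
      by (simp only: mean_cmult)
    also have "\<dots> = mean U (\<lambda>u. mean U' (\<lambda>u'. w (\<lambda>n. u n * V u' n) *
         norm (es A (S \<inter> cls (int p ^ (a + B)) (\<sigma> m)) (\<lambda>n. u n * V u' n)) ^ (2 * T)))"
    proof (intro mean_cong)
      fix u u' assume u': "u' \<in> U'"
      have "S \<inter> cls (int p ^ (a + B)) (\<sigma> m) \<subseteq> cls (int p ^ a) i" using sub[OF m] by blast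
      then show "w u * norm (es (A' u) (S' \<inter> cls (int p ^ B) m) u') ^ (2 * T) = w (\<lambda>n. u n * V u' n) *
         norm (es A (S \<inter> cls (int p ^ (a + B)) (\<sigma> m)) (\<lambda>n. u n * V u' n)) ^ (2 * T)"
        using norm_zoom[OF u', of "S \<inter> cls (int p ^ (a + B)) (\<sigma> m)" u] by (simp only: wV[OF u'] set2)
    qed
    also have "\<dots> = mean U (\<lambda>u. w u * norm (es A (S \<inter> cls (int p ^ (a + B)) (\<sigma> m)) u) ^ (2 * T))"
      by (rule avg[symmetric])
    also have "\<dots> \<le> K (\<sigma> m) ^ T"
      unfolding T_def using bij m by (intro K) (auto simp: bij_betw_def)
    finally show "mean U (\<lambda>u. (root T (w u) * N u m) ^ T) \<le> K (\<sigma> m) ^ T" .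
  qed (use U T w0 N0 in \<open>auto simp: char_groupD real_root_ge_zero\<close>)
  also have "(\<Sum>m\<in>{0..<int p ^ B}. K (\<sigma> m)) = (\<Sum>j\<in>res (int p ^ (a + B)) (int p ^ a) i. K j)"
    by (rule sum.reindex_bij_betw[OF bij])
  finally show ?thesis by (simp add: T_def)
qed

definition hyp where
  "hyp p k b \<gamma> A S N \<longleftrightarrow> good p k \<gamma> \<and> finite S \<and> (\<forall>j::int. (0::real) \<le> N j) \<and>
     (\<forall>j\<in>{0..<int p ^ b}. mean (phases k \<gamma> (p ^ (k * b))) (\<lambda>u. norm (es A (S \<inter> cls (int p ^ b) j) u) ^ (2 * tri k))
         \<le> N j ^ tri k)"

definition ssum :: "nat \<Rightarrow> nat \<Rightarrow> (int \<Rightarrow> real) \<Rightarrow> nat \<Rightarrow> int \<Rightarrow> real" where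
  "ssum p b N a i = (\<Sum>j\<in>res (int p ^ b) (int p ^ a) i. N j)"

text \<open>The exponents add up to \<open>2 * tri k\<close>, and \<open>2 * tri l\<close> is
  critical in dimension \<open>l\<close>. So decoupling in dimension \<open>l\<close> can act on the
  first factor with the second one as a weight.\<close>

definition bil where
  "bil p k b \<gamma> A S l a i c i' = mean (phases k \<gamma> (p ^ (k * b)))
     (\<lambda>u. norm (es A (S \<inter> cls (int p ^ a) i) u) ^ (2 * tri l) *
          norm (es A (S \<inter> cls (int p ^ c) i') u) ^ (2 * (tri k - tri l)))"

definition decoup_exp :: "nat \<Rightarrow> nat \<Rightarrow> real \<Rightarrow> bool" where
  "decoup_exp p k \<eta> \<longleftrightarrow> (\<exists>C>0. \<forall>b. decoup p k b (C * real p powr (\<eta> * real b)))"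

text \<open>The parameter \<open>g\<close> measures the gain over the trivial bound; the divisibility of \<open>c\<close> makes the
  levels \<open>(k - l + 1) c / l\<close> of the iteration integers, and \<open>k\<^sup>n c \<le> b\<close> keeps them below \<open>b\<close>.\<close>

definition bil_bound :: "nat \<Rightarrow> nat \<Rightarrow> real \<Rightarrow> nat \<Rightarrow> nat \<Rightarrow> real \<Rightarrow> bool" where
  "bil_bound p k \<eta> n l g \<longleftrightarrow> (\<forall>\<mu>>0. \<exists>C>0. \<forall>b \<gamma> A S N a i c i'.
     hyp p k b \<gamma> A S N \<longrightarrow> 1 \<le> a \<longrightarrow> a \<le> b \<longrightarrow> 1 \<le> c \<longrightarrow> c \<le> b \<longrightarrow> fact k ^ n dvd c \<longrightarrow> k ^ n * c \<le> b \<longrightarrow>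
     l * a \<le> (k - l + 1) * c \<longrightarrow> \<not> int p dvd i - i' \<longrightarrow>
     bil p k b \<gamma> A S l a i c i' \<le> C * real p powr (\<mu> * real b + \<eta> * (real b - g * real c))
        * ssum p b N a i ^ tri l * ssum p b N c i' ^ (tri k - tri l))"

lemma ssum_nonneg: "(\<And>j. 0 \<le> N j) \<Longrightarrow> 0 \<le> ssum p b N a i"
  unfolding ssum_def by (intro sum_nonneg) auto

lemma ssum_refine:
  assumes "p > 0" "a \<le> a'" "a' \<le> b"
  shows "(\<Sum>j\<in>res (int p ^ a') (int p ^ a) i. ssum p b N a' j) = ssum p b N a i"
proof -
  have r: "res M m i = {0..<M} \<inter> cls m i" for M m i by (auto simp: res_def cls_def)
  show ?thesis
    using sum_cls_refine[of "{0..<int p ^ b}" "int p ^ a'" "int p ^ a" N i] assms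
    unfolding ssum_def r[of "int p ^ b"] by (simp add: le_imp_power_dvd)
qed

text \<open>Affine rescaling: a class modulo \<open>p ^ a\<close> of a sum at level \<open>b\<close>
  behaves like a full sum at level \<open>b - a\<close>. This is the case \<open>l = k\<close> with
  weight 1 of the local estimate.\<close>

lemma mean_class_bound:
  assumes dec: "decoup p k (b - a) D" and D: "D \<ge> 0" and h: "hyp p k b \<gamma> A S N"
    and p: "prime p" "k < p" and k: "1 \<le> k" and a: "1 \<le> a" "a \<le> b"
  shows "mean (phases k \<gamma> (p ^ (k * b))) (\<lambda>u. norm (es A (S \<inter> cls (int p ^ a) i) u) ^ (2 * tri k))
     \<le> D * ssum p b N a i ^ tri k"
proof -
  \<comment> \<open>For \<open>l = k\<close> no jet is prescribed at the second point, so any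
    integer incongruent to \<open>i\<close> can play its role.\<close>
  have np: "\<not> int p dvd i - (i + 1)"
    using p prime_gt_1_nat[of p] by simp
  have "mean (phases k \<gamma> (p ^ (k * b))) (\<lambda>u. 1 * norm (es A (S \<inter> cls (int p ^ a) i) u) ^ (2 * tri k))
     \<le> D * (\<Sum>j\<in>res (int p ^ (a + (b - a))) (int p ^ a) i. N j) ^ tri k"
    by (rule local_decoup[OF dec D _ p k _ a(1) np]) (use h a in \<open>auto simp: hyp_def res_def\<close>)
  then show ?thesis using a by (simp add: ssum_def)
qed

lemma mean_hoelder_prod:
  assumes U: "finite U" and th: "0 < \<theta>" "\<theta> < 1"
    and xy: "\<And>u. 0 \<le> x u" "\<And>u. (0::real) \<le> y u"
    and a: "real a = \<theta> * real a1 + (1 - \<theta>) * real a2" and b: "real b = \<theta> * real b1 + (1 - \<theta>) * real b2"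
    and M1: "mean U (\<lambda>u. x u ^ (2 * a1) * y u ^ (2 * b1)) \<le> M1"
    and M2: "mean U (\<lambda>u. x u ^ (2 * a2) * y u ^ (2 * b2)) \<le> M2"
  shows "mean U (\<lambda>u. x u ^ (2 * a) * y u ^ (2 * b)) \<le> M1 powr \<theta> * M2 powr (1 - \<theta>)"
proof (rule mean_hoelder[OF U th _ _ _ M1 M2])
  fix u
  have "x u ^ (2 * a) = (x u ^ (2 * a1)) powr \<theta> * (x u ^ (2 * a2)) powr (1 - \<theta>)"
    by (rule power_powr_combine[symmetric]) (use xy th a in auto)
  moreover have "y u ^ (2 * b) = (y u ^ (2 * b1)) powr \<theta> * (y u ^ (2 * b2)) powr (1 - \<theta>)"
    by (rule power_powr_combine[symmetric]) (use xy th b in auto)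
  ultimately show "x u ^ (2 * a) * y u ^ (2 * b) \<le>
      (x u ^ (2 * a1) * y u ^ (2 * b1)) powr \<theta> * (x u ^ (2 * a2) * y u ^ (2 * b2)) powr (1 - \<theta>)"
    using xy by (simp add: powr_mult mult_ac)
qed (use xy in auto)

lemma bound_interpolate:
  fixes V W C1 C2 P :: real
  assumes th: "0 < \<theta>" "\<theta> < 1" and V: "0 \<le> V" and W: "0 \<le> W" and C: "0 < C1" "0 < C2" and P: "0 < P"
    and a: "real a = \<theta> * real a1 + (1 - \<theta>) * real a2" and b: "real b = \<theta> * real b1 + (1 - \<theta>) * real b2"
    and ee: "ee = \<theta> * ee1 + (1 - \<theta>) * ee2"
  shows "(C1 * P powr ee1 * V ^ a1 * W ^ b1) powr \<theta> * (C2 * P powr ee2 * V ^ a2 * W ^ b2) powr (1 - \<theta>)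
     = (C1 powr \<theta> * C2 powr (1 - \<theta>)) * P powr ee * V ^ a * W ^ b"
proof -
  have "V ^ a = (V ^ a1) powr \<theta> * (V ^ a2) powr (1 - \<theta>)" "W ^ b = (W ^ b1) powr \<theta> * (W ^ b2) powr (1 - \<theta>)"
    using power_powr_combine[OF V th a] power_powr_combine[OF W th b] by simp_all
  moreover have "P powr ee = (P powr ee1) powr \<theta> * (P powr ee2) powr (1 - \<theta>)"
    by (simp add: ee powr_powr powr_add mult.commute)
  ultimately show ?thesis using V W C P by (simp add: powr_mult mult_ac)
qed

text \<open>With \<open>l = 0\<close> only the second factor remains, and its class has just
  \<open>b - c\<close> levels left to decouple. This is the only place where a gain originates; the
  iteration carries it to larger \<open>l\<close>.\<close>

lemma bil_bound_0:
  assumes E: "decoup_exp p k \<eta>" and p: "prime p" "k < p" and k: "1 \<le> k"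
  shows "bil_bound p k \<eta> n 0 1"
  unfolding bil_bound_def
proof (intro allI impI)
  fix \<mu> :: real assume \<mu>: "\<mu> > 0"
  obtain C where C: "C > 0" "\<And>b. decoup p k b (C * real p powr (\<eta> * real b))"
    using E by (auto simp: decoup_exp_def)
  have p1: "real p > 1" using p prime_gt_1_nat by simp
  show "\<exists>C>0. \<forall>b \<gamma> A S N a i c i'.
     hyp p k b \<gamma> A S N \<longrightarrow> 1 \<le> a \<longrightarrow> a \<le> b \<longrightarrow> 1 \<le> c \<longrightarrow> c \<le> b \<longrightarrow> fact k ^ n dvd c \<longrightarrow> k ^ n * c \<le> b \<longrightarrow>
     0 * a \<le> (k - 0 + 1) * c \<longrightarrow> \<not> int p dvd i - i' \<longrightarrow>
     bil p k b \<gamma> A S 0 a i c i' \<le> C * real p powr (\<mu> * real b + \<eta> * (real b - 1 * real c))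
        * ssum p b N a i ^ tri 0 * ssum p b N c i' ^ (tri k - tri 0)"
  proof (intro exI[of _ C] conjI allI impI C(1))
    fix b \<gamma> A S and N :: "int \<Rightarrow> real" and a c :: nat and i i' :: int
    assume h: "hyp p k b \<gamma> A S N" and c: "1 \<le> c" "c \<le> b"
    have "bil p k b \<gamma> A S 0 a i c i' = mean (phases k \<gamma> (p ^ (k * b))) (\<lambda>u. norm (es A (S \<inter> cls (int p ^ c) i') u) ^ (2 * tri k))"
      by (simp add: bil_def)
    also have "\<dots> \<le> C * real p powr (\<eta> * real (b - c)) * ssum p b N c i' ^ tri k"
      by (rule mean_class_bound[OF C(2) _ h p k c]) (use C in simp)
    also have "\<dots> \<le> C * real p powr (\<mu> * real b + \<eta> * (real b - 1 * real c)) * ssum p b N c i' ^ tri k"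
      using C p1 \<mu> c h by (intro mult_right_mono mult_left_mono powr_mono) (auto simp: of_nat_diff hyp_def intro!: zero_le_power ssum_nonneg)
    finally show "bil p k b \<gamma> A S 0 a i c i' \<le> C * real p powr (\<mu> * real b + \<eta> * (real b - 1 * real c))
        * ssum p b N a i ^ tri 0 * ssum p b N c i' ^ (tri k - tri 0)" by simp
  qed
qed

text \<open>Hoelder's inequality between the bounds for the two single classes, with the savings
  from their levels given away.\<close>

lemma bil_bound_base:
  assumes E: "decoup_exp p k \<eta>" and p: "prime p" "k < p" and l: "1 \<le> l" "l < k" and \<eta>: "\<eta> \<ge> 0"
  shows "bil_bound p k \<eta> 0 l 0"
  unfolding bil_bound_def
proof (intro allI impI)
  fix \<mu> :: real assume \<mu>: "\<mu> > 0"
  obtain C where C: "C > 0" "\<And>b. decoup p k b (C * real p powr (\<eta> * real b))"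
    using E by (auto simp: decoup_exp_def)
  have p1: "real p > 1" using p prime_gt_1_nat by simp
  have k: "1 \<le> k" using l by simp
  define \<theta> where "\<theta> = real (tri l) / real (tri k)"
  have tl: "tri l \<ge> 1" "tri k \<ge> 1" using l tri_pos[of l] tri_pos[of k] by auto
  have "tri l < tri k"
  proof -
    have "real l * (real l + 1) < real k * (real k + 1)" using l by (intro mult_strict_mono) auto
    then have "real (tri l) < real (tri k)" by (simp add: real_tri)
    then show ?thesis by simp
  qed
  then have th: "0 < \<theta>" "\<theta> < 1" using tl by (auto simp: \<theta>_def)
  have ab: "real (tri l) = \<theta> * real (tri k) + (1 - \<theta>) * real 0"
     "real (tri k - tri l) = \<theta> * real 0 + (1 - \<theta>) * real (tri k)"
    using tl \<open>tri l < tri k\<close> by (auto simp: \<theta>_def of_nat_diff field_simps)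
  show "\<exists>C>0. \<forall>b \<gamma> A S N a i c i'.
     hyp p k b \<gamma> A S N \<longrightarrow> 1 \<le> a \<longrightarrow> a \<le> b \<longrightarrow> 1 \<le> c \<longrightarrow> c \<le> b \<longrightarrow> fact k ^ 0 dvd c \<longrightarrow> k ^ 0 * c \<le> b \<longrightarrow>
     l * a \<le> (k - l + 1) * c \<longrightarrow> \<not> int p dvd i - i' \<longrightarrow>
     bil p k b \<gamma> A S l a i c i' \<le> C * real p powr (\<mu> * real b + \<eta> * (real b - 0 * real c))
        * ssum p b N a i ^ tri l * ssum p b N c i' ^ (tri k - tri l)"
  proof (intro exI[of _ C] conjI allI impI C(1))
    fix b \<gamma> A S and N :: "int \<Rightarrow> real" and a c :: nat and i i' :: int
    assume h: "hyp p k b \<gamma> A S N" and c: "1 \<le> c" "c \<le> b" and a: "1 \<le> a" "a \<le> b"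
    define ee where "ee = \<mu> * real b + \<eta> * (real b - 0 * real c)"
    have fin: "finite (phases k \<gamma> (p ^ (k * b)))" using p1 by (intro char_groupD(1) char_group_phases) auto
    have one: "mean (phases k \<gamma> (p ^ (k * b))) (\<lambda>u. norm (es A (S \<inter> cls (int p ^ a) i) u) ^ (2 * tri k))
        \<le> C * real p powr ee * ssum p b N a i ^ tri k" if a: "1 \<le> a" "a \<le> b" for a i
    proof -
      have "mean (phases k \<gamma> (p ^ (k * b))) (\<lambda>u. norm (es A (S \<inter> cls (int p ^ a) i) u) ^ (2 * tri k))
         \<le> C * real p powr (\<eta> * real (b - a)) * ssum p b N a i ^ tri k"
        by (rule mean_class_bound[OF C(2) _ h p k a]) (use C in simp)
      also have "\<dots> \<le> C * real p powr ee * ssum p b N a i ^ tri k"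
      proof -
        have "\<eta> * real (b - a) \<le> \<eta> * real b" using \<eta> a by (intro mult_left_mono) auto
        moreover have "0 \<le> \<mu> * real b" using \<mu> by simp
        ultimately have "\<eta> * real (b - a) \<le> ee" by (simp add: ee_def)
        then show ?thesis
          using C p1 h by (intro mult_right_mono mult_left_mono powr_mono) (auto simp: hyp_def intro!: zero_le_power ssum_nonneg)
      qed
      finally show ?thesis .
    qed
    have "bil p k b \<gamma> A S l a i c i' \<le> (C * real p powr ee * ssum p b N a i ^ tri k * ssum p b N c i' ^ 0) powr \<theta> *
        (C * real p powr ee * ssum p b N a i ^ 0 * ssum p b N c i' ^ tri k) powr (1 - \<theta>)"
      unfolding bil_def
      by (rule mean_hoelder_prod[OF fin th _ _ ab]) (use one[OF a] one[OF c] in auto)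
    also have "\<dots> = (C powr \<theta> * C powr (1 - \<theta>)) * real p powr ee * ssum p b N a i ^ tri l * ssum p b N c i' ^ (tri k - tri l)"
      by (rule bound_interpolate[OF th _ _ _ _ _ ab])
        (use h C p1 in \<open>auto simp: hyp_def algebra_simps intro!: zero_le_power ssum_nonneg\<close>)
    also have "C powr \<theta> * C powr (1 - \<theta>) = C" using C by (simp flip: powr_add)
    finally show "bil p k b \<gamma> A S l a i c i' \<le> C * real p powr (\<mu> * real b + \<eta> * (real b - 0 * real c))
        * ssum p b N a i ^ tri l * ssum p b N c i' ^ (tri k - tri l)" by (simp add: ee_def)
  qed
qed

lemma bil_bound_mono:
  assumes "bil_bound p k \<eta> n l g" "g' \<le> g" "\<eta> \<ge> 0" "p > 1"
  shows "bil_bound p k \<eta> n l g'"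
  unfolding bil_bound_def
proof (intro allI impI)
  fix \<mu> :: real assume "\<mu> > 0"
  then obtain C where C: "C > 0" "\<forall>b \<gamma> A S N a i c i'.
     hyp p k b \<gamma> A S N \<longrightarrow> 1 \<le> a \<longrightarrow> a \<le> b \<longrightarrow> 1 \<le> c \<longrightarrow> c \<le> b \<longrightarrow> fact k ^ n dvd c \<longrightarrow> k ^ n * c \<le> b \<longrightarrow>
     l * a \<le> (k - l + 1) * c \<longrightarrow> \<not> int p dvd i - i' \<longrightarrow>
     bil p k b \<gamma> A S l a i c i' \<le> C * real p powr (\<mu> * real b + \<eta> * (real b - g * real c))
        * ssum p b N a i ^ tri l * ssum p b N c i' ^ (tri k - tri l)"
    using assms(1) unfolding bil_bound_def by meson
  have "\<eta> * (real b - g * real c) \<le> \<eta> * (real b - g' * real c)" for b c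
    using assms by (intro mult_left_mono) (auto intro: mult_right_mono)
  then have le: "C * real p powr (\<mu> * real b + \<eta> * (real b - g * real c)) * X * Y
     \<le> C * real p powr (\<mu> * real b + \<eta> * (real b - g' * real c)) * X * Y" if "0 \<le> X" "0 \<le> Y" for b c X Y
    using C assms that by (intro mult_right_mono mult_left_mono powr_mono) auto
  show "\<exists>C>0. \<forall>b \<gamma> A S N a i c i'.
     hyp p k b \<gamma> A S N \<longrightarrow> 1 \<le> a \<longrightarrow> a \<le> b \<longrightarrow> 1 \<le> c \<longrightarrow> c \<le> b \<longrightarrow> fact k ^ n dvd c \<longrightarrow> k ^ n * c \<le> b \<longrightarrow>
     l * a \<le> (k - l + 1) * c \<longrightarrow> \<not> int p dvd i - i' \<longrightarrow>
     bil p k b \<gamma> A S l a i c i' \<le> C * real p powr (\<mu> * real b + \<eta> * (real b - g' * real c))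
        * ssum p b N a i ^ tri l * ssum p b N c i' ^ (tri k - tri l)"
  proof (intro exI[of _ C] conjI allI impI C(1))
    fix b \<gamma> A S and N :: "int \<Rightarrow> real" and a c :: nat and i i' :: int
    assume h: "hyp p k b \<gamma> A S N" and rest: "1 \<le> a" "a \<le> b" "1 \<le> c" "c \<le> b" "fact k ^ n dvd c" "k ^ n * c \<le> b"
      "l * a \<le> (k - l + 1) * c" "\<not> int p dvd i - i'"
    have "0 \<le> ssum p b N a i ^ tri l" "0 \<le> ssum p b N c i' ^ (tri k - tri l)"
      using h by (auto simp: hyp_def intro!: zero_le_power ssum_nonneg)
    then show "bil p k b \<gamma> A S l a i c i' \<le> C * real p powr (\<mu> * real b + \<eta> * (real b - g' * real c))
        * ssum p b N a i ^ tri l * ssum p b N c i' ^ (tri k - tri l)"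
      using C(2) h rest le by (meson order.trans)
  qed
qed

text \<open>Averaging only over characters that are flat on the second interval leaves its factor unchanged and
  turns the first interval into a curve in dimension \<open>l\<close>.\<close>

lemma bil_lower_dim:
  assumes dec: "decoup p l (a' - a) D" and D: "D \<ge> 0" and h: "hyp p k b \<gamma> A S N"
    and p: "prime p" "k < p" and l: "1 \<le> l" "l < k" and a: "1 \<le> a" "a \<le> a'" "a' \<le> b"
    and a'c: "l * a' = (k - l + 1) * c" and cb: "c \<le> b" and ii: "\<not> int p dvd i - i'" and X: "X \<ge> 0"
    and le: "\<And>j. j \<in> res (int p ^ a') (int p ^ a) i \<Longrightarrow>
        bil p k b \<gamma> A S l a' j c i' \<le> X * ssum p b N a' j ^ tri l * ssum p b N c i' ^ (tri k - tri l)"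
  shows "bil p k b \<gamma> A S l a i c i' \<le> (D * X) * ssum p b N a i ^ tri l * ssum p b N c i' ^ (tri k - tri l)"
proof -
  define T where "T = tri l"
  have T: "T \<ge> 1" using tri_pos[OF l(1)] by (simp add: T_def)
  have p0: "p > 0" using p by (simp add: prime_gt_0_nat)
  define Y where "Y = X * ssum p b N c i' ^ (tri k - tri l)"
  have N: "\<And>j. 0 \<le> N j" using h by (auto simp: hyp_def)
  have Y: "Y \<ge> 0" using X N by (auto simp: Y_def intro!: mult_nonneg_nonneg zero_le_power ssum_nonneg)
  define w where "w u = norm (es A (S \<inter> cls (int p ^ c) i') u) ^ (2 * (tri k - tri l))" for u
  \<comment> \<open>The factor that does not depend on the subclass is distributed as a T-th root,
    because the local estimate expects bounds that are T-th powers.\<close>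
  define K where "K j = ssum p b N a' j * root T Y" for j
  have aB: "a + (a' - a) = a'" using a by simp
  have "mean (phases k \<gamma> (p ^ (k * b))) (\<lambda>u. w u * norm (es A (S \<inter> cls (int p ^ a) i) u) ^ (2 * tri l))
    \<le> D * (\<Sum>j\<in>res (int p ^ (a + (a' - a))) (int p ^ a) i. K j) ^ tri l"
  proof (rule local_decoup[OF dec D _ p l(1) less_imp_le[OF l(2)] a(1) ii])
    show "l * (a + (a' - a)) \<le> k * b"
      unfolding aB a'c using l cb by (intro mult_mono) auto
  next
    fix u v :: "int \<Rightarrow> complex" assume "\<And>c. l * (a + (a' - a)) \<le> (k - l + 1) * c \<Longrightarrow> \<exists>\<omega>. norm \<omega> = 1 \<and> (\<forall>m. v (i' + int p ^ c * m) = \<omega>)"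
    then obtain \<omega> where \<omega>: "norm \<omega> = 1" "\<And>m. v (i' + int p ^ c * m) = \<omega>" unfolding aB using a'c by auto
    have "es A (S \<inter> cls (int p ^ c) i') (\<lambda>n. u n * v n) = \<omega> * es A (S \<inter> cls (int p ^ c) i') u"
    proof (rule es_const_phase)
      fix n assume "n \<in> S \<inter> cls (int p ^ c) i'"
      then obtain m where "n - i' = int p ^ c * m" by (auto simp: cls_def)
      then have "n = i' + int p ^ c * m" by simp
      then show "v n = \<omega>" using \<omega> by simp
    qed
    then show "w (\<lambda>n. u n * v n) = w u" using \<omega> by (simp add: w_def norm_mult)
  next
    fix j assume "j \<in> res (int p ^ (a + (a' - a))) (int p ^ a) i"
    then have "bil p k b \<gamma> A S l a' j c i' \<le> X * ssum p b N a' j ^ tri l * ssum p b N c i' ^ (tri k - tri l)"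
      unfolding aB by (rule le)
    also have "\<dots> = K j ^ tri l"
      using T Y by (simp add: K_def power_mult_distrib flip: T_def) (simp add: Y_def T_def)
    finally show "mean (phases k \<gamma> (p ^ (k * b))) (\<lambda>u. w u * norm (es A (S \<inter> cls (int p ^ (a + (a' - a))) j) u) ^ (2 * tri l)) \<le> K j ^ tri l"
      unfolding aB by (simp add: bil_def w_def mult.commute)
  qed (use h Y N in \<open>auto simp: hyp_def w_def K_def intro!: mult_nonneg_nonneg zero_le_power ssum_nonneg real_root_ge_zero\<close>)
  also have "(\<Sum>j\<in>res (int p ^ (a + (a' - a))) (int p ^ a) i. K j) = ssum p b N a i * root T Y"
    unfolding aB K_def sum_distrib_right[symmetric] ssum_refine[OF p0 a(2,3)] ..
  also have "D * (ssum p b N a i * root T Y) ^ tri l = (D * X) * ssum p b N a i ^ tri l * ssum p b N c i' ^ (tri k - tri l)"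
    using T Y by (simp add: power_mult_distrib flip: T_def) (simp add: Y_def T_def)
  finally show ?thesis by (simp add: bil_def w_def mult.commute)
qed

text \<open>The pair of exponents for \<open>l\<close> lies on the segment between the pair for
  \<open>k - l\<close> with the two factors exchanged and the pair for \<open>l - 1\<close>. This is
  what dictates \<theta> in the Hoelder step of the iteration.\<close>

lemma tri_identities:
  assumes l: "1 \<le> l" "l < k" and th: "\<theta> = 1 / real (k - l + 1)"
  shows "real (tri l) = \<theta> * real (tri k - tri (k - l)) + (1 - \<theta>) * real (tri (l - 1))"
    "real (tri k - tri l) = \<theta> * real (tri (k - l)) + (1 - \<theta>) * real (tri k - tri (l - 1))"
proof -
  have kl: "real (k - l) = real k - real l" using l by (simp add: of_nat_diff less_imp_le)
  then have w: "real (k - l + 1) = real k - real l + 1" by simp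
  have ne: "real k - real l + 1 \<noteq> 0" using l by simp
  have t: "real (tri k - tri (k - l)) = real k * (real k + 1) / 2 - (real k - real l) * (real k - real l + 1) / 2"
    "real (tri (k - l)) = (real k - real l) * (real k - real l + 1) / 2"
    "real (tri (l - 1)) = (real l - 1) * real l / 2"
    "real (tri k - tri l) = real k * (real k + 1) / 2 - real l * (real l + 1) / 2"
    "real (tri k - tri (l - 1)) = real k * (real k + 1) / 2 - (real l - 1) * real l / 2"
    using l by (simp_all add: real_tri of_nat_diff tri_mono kl)
  have th': "\<theta> * (real k - real l + 1) = 1" unfolding th w using ne by simp
  have "\<theta> * (real k * (real k + 1) / 2 - (real k - real l) * (real k - real l + 1) / 2 - (real l - 1) * real l / 2)
     = \<theta> * (real k - real l + 1) * real l" by (simp add: field_simps)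
  then show "real (tri l) = \<theta> * real (tri k - tri (k - l)) + (1 - \<theta>) * real (tri (l - 1))"
    unfolding t real_tri[of l] th' by (simp add: field_simps)
  have "\<theta> * ((real k - real l) * (real k - real l + 1) / 2 - (real k * (real k + 1) / 2 - (real l - 1) * real l / 2))
     = - (\<theta> * (real k - real l + 1) * real l)" by (simp add: field_simps)
  then show "real (tri k - tri l) = \<theta> * real (tri (k - l)) + (1 - \<theta>) * real (tri k - tri (l - 1))"
    unfolding t real_tri[of l] th' by (simp add: field_simps)
qed

text \<open>The first class is refined to the level a' with l a' = (k - l + 1) c, the finest one at
  which the characters in use are still constant on the second class; decoupling in dimension
  \<open>l\<close> makes this almost free. Hoelder's inequality then compares with
  \<open>k - l\<close>, where the factors change roles and the gain is g1 a', and with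
  \<open>l - 1\<close>, where it is g2 c. Since \<theta> a' = c / l, the two combine to the stated
  gain.\<close>

lemma bil_bound_step:
  assumes p: "prime p" "k < p" and l: "1 \<le> l" "l < k" and \<eta>: "\<eta> \<ge> 0"
    and El: "\<And>\<epsilon>. \<epsilon> > 0 \<Longrightarrow> decoup_exp p l \<epsilon>"
    and B1: "bil_bound p k \<eta> n (k - l) g1" and B2: "bil_bound p k \<eta> (Suc n) (l - 1) g2"
  shows "bil_bound p k \<eta> (Suc n) l (g1 / real l + real (k - l) / real (k - l + 1) * g2)" (is "bil_bound _ _ _ _ _ ?g")
  unfolding bil_bound_def
proof (intro allI impI)
  fix \<mu> :: real assume \<mu>: "\<mu> > 0"
  have p1: "real p > 1" using p prime_gt_1_nat by simp
  have p0: "p > 0" using p by (simp add: prime_gt_0_nat)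
  obtain C0 where C0: "C0 > 0" "\<And>b. decoup p l b (C0 * real p powr (\<mu> / 2 * real b))"
    using El[of "\<mu> / 2"] \<mu> by (auto simp: decoup_exp_def)
  have \<mu>2: "\<mu> / 2 > 0" using \<mu> by simp
  obtain C1 where C1: "C1 > 0" "\<And>b \<gamma> A S N a i c i'.
     hyp p k b \<gamma> A S N \<Longrightarrow> 1 \<le> a \<Longrightarrow> a \<le> b \<Longrightarrow> 1 \<le> c \<Longrightarrow> c \<le> b \<Longrightarrow> fact k ^ n dvd c \<Longrightarrow> k ^ n * c \<le> b \<Longrightarrow>
     (k - l) * a \<le> (k - (k - l) + 1) * c \<Longrightarrow> \<not> int p dvd i - i' \<Longrightarrow>
     bil p k b \<gamma> A S (k - l) a i c i' \<le> C1 * real p powr (\<mu> / 2 * real b + \<eta> * (real b - g1 * real c))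
        * ssum p b N a i ^ tri (k - l) * ssum p b N c i' ^ (tri k - tri (k - l))"
    using B1[unfolded bil_bound_def, rule_format, OF \<mu>2] by metis
  obtain C2 where C2: "C2 > 0" "\<And>b \<gamma> A S N a i c i'.
     hyp p k b \<gamma> A S N \<Longrightarrow> 1 \<le> a \<Longrightarrow> a \<le> b \<Longrightarrow> 1 \<le> c \<Longrightarrow> c \<le> b \<Longrightarrow> fact k ^ Suc n dvd c \<Longrightarrow> k ^ Suc n * c \<le> b \<Longrightarrow>
     (l - 1) * a \<le> (k - (l - 1) + 1) * c \<Longrightarrow> \<not> int p dvd i - i' \<Longrightarrow>
     bil p k b \<gamma> A S (l - 1) a i c i' \<le> C2 * real p powr (\<mu> / 2 * real b + \<eta> * (real b - g2 * real c))
        * ssum p b N a i ^ tri (l - 1) * ssum p b N c i' ^ (tri k - tri (l - 1))"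
    using B2[unfolded bil_bound_def, rule_format, OF \<mu>2] by metis
  define w where "w = k - l + 1"
  define \<theta> where "\<theta> = 1 / real w"
  have w: "w \<ge> 2" "w \<le> k" using l by (auto simp: w_def)
  have th: "0 < \<theta>" "\<theta> < 1" using w by (auto simp: \<theta>_def)
  have tid: "real (tri l) = \<theta> * real (tri k - tri (k - l)) + (1 - \<theta>) * real (tri (l - 1))"
    "real (tri k - tri l) = \<theta> * real (tri (k - l)) + (1 - \<theta>) * real (tri k - tri (l - 1))"
    using tri_identities[OF l, of \<theta>] by (simp_all add: \<theta>_def w_def)
  define C where "C = C1 powr \<theta> * C2 powr (1 - \<theta>)"
  have C: "C > 0" using C1 C2 by (simp add: C_def)
  show "\<exists>C>0. \<forall>b \<gamma> A S N a i c i'.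
     hyp p k b \<gamma> A S N \<longrightarrow> 1 \<le> a \<longrightarrow> a \<le> b \<longrightarrow> 1 \<le> c \<longrightarrow> c \<le> b \<longrightarrow> fact k ^ Suc n dvd c \<longrightarrow> k ^ Suc n * c \<le> b \<longrightarrow>
     l * a \<le> (k - l + 1) * c \<longrightarrow> \<not> int p dvd i - i' \<longrightarrow>
     bil p k b \<gamma> A S l a i c i' \<le> C * real p powr (\<mu> * real b + \<eta> * (real b - ?g * real c))
        * ssum p b N a i ^ tri l * ssum p b N c i' ^ (tri k - tri l)"
  proof (intro exI[of _ "C0 * C"] conjI allI impI)
    show "C0 * C > 0" using C0 C by simp
  next
    fix b \<gamma> A S and N :: "int \<Rightarrow> real" and a c :: nat and i i' :: int
    assume h: "hyp p k b \<gamma> A S N" and a: "1 \<le> a" "a \<le> b" and c: "1 \<le> c" "c \<le> b"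
      and fc: "fact k ^ Suc n dvd c" and kc: "k ^ Suc n * c \<le> b"
      and ac: "l * a \<le> (k - l + 1) * c" and ii: "\<not> int p dvd i - i'"
    have N: "\<And>j. 0 \<le> N j" using h by (auto simp: hyp_def)
    obtain c0 where c0: "c = fact k ^ n * (fact k * c0)" using fc by (auto simp: dvd_def mult_ac)
    obtain f where f: "(fact k :: nat) = l * f" using dvd_fact[of l k] l by (auto simp: dvd_def)
    \<comment> \<open>One of the factors \<open>fact k\<close> of \<open>c\<close> is spent:
      \<open>l\<close> divides it, so the new level is an integer, and the remaining power still
      divides it as \<open>B1\<close> requires. Likewise \<open>a' \<le> k * c\<close> is paid for
      by one power of \<open>k\<close> in \<open>k ^ Suc n * c \<le> b\<close>.\<close>
    define a' where "a' = w * (fact k ^ n * (f * c0))"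
    have la': "l * a' = w * c" by (simp add: a'_def c0 f mult_ac)
    have aa': "a \<le> a'"
    proof -
      have "l * a \<le> l * a'" using ac la' by (simp add: w_def)
      then show ?thesis using l by simp
    qed
    have a'k: "a' \<le> k * c"
    proof -
      have "a' \<le> l * a'" using l by simp
      also have "\<dots> \<le> k * c" unfolding la' using w by simp
      finally show ?thesis .
    qed
    have k1: "k \<ge> 1" using l by simp
    have kcb: "k * c \<le> b"
    proof -
      have "k * c * 1 \<le> k * c * k ^ n" using k1 by (intro mult_left_mono) auto
      moreover have "k ^ Suc n * c = k * c * k ^ n" by simp
      ultimately show ?thesis using kc by linarith
    qed
    have a'b: "a' \<le> b" using a'k kcb by linarith
    have fa': "fact k ^ n dvd a'" by (simp add: a'_def)
    have ka': "k ^ n * a' \<le> b"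
    proof -
      have "k ^ n * a' \<le> k ^ n * (k * c)" by (intro mult_left_mono a'k) simp
      moreover have "k ^ n * (k * c) = k ^ Suc n * c" by simp
      ultimately show ?thesis using kc by linarith
    qed
    have cond1: "(k - l) * c \<le> (k - (k - l) + 1) * a'"
    proof -
      have "l * ((k - l) * c) \<le> (l + 1) * (w * c)"
        by (simp add: w_def algebra_simps)
      also have "\<dots> = l * ((l + 1) * a')" unfolding la'[symmetric] by (simp only: mult_ac)
      finally have "(k - l) * c \<le> (l + 1) * a'" using l by simp
      then show ?thesis using l by simp
    qed
    have cond2: "(l - 1) * a' \<le> (k - (l - 1) + 1) * c"
    proof -
      have "l * ((l - 1) * a') = (l - 1) * (w * c)" unfolding la'[symmetric] by (simp add: mult_ac)
      also have "\<dots> \<le> l * ((w + 1) * c)" by (intro mult_mono) auto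
      finally have "(l - 1) * a' \<le> (w + 1) * c" using l by simp
      moreover have "k - (l - 1) + 1 = w + 1" using l by (simp add: w_def)
      ultimately show ?thesis by simp
    qed
    define ee where "ee = \<mu> / 2 * real b + \<eta> * (real b - ?g * real c)"
    have fin: "finite (phases k \<gamma> (p ^ (k * b)))" using p1 by (intro char_groupD(1) char_group_phases) auto
    have hol: "bil p k b \<gamma> A S l a' j c i' \<le> (C * real p powr ee) * ssum p b N a' j ^ tri l * ssum p b N c i' ^ (tri k - tri l)"
      if j: "j \<in> res (int p ^ a') (int p ^ a) i" for j
    proof -
      have pa: "int p dvd j - i"
        using j a by (auto simp: res_def intro: dvd_trans[OF dvd_power])
      have ji: "\<not> int p dvd j - i'"
      proof
        assume "int p dvd j - i'"
        then have "int p dvd (j - i') - (j - i)" using pa by (rule dvd_diff)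
        then show False using ii by simp
      qed
      then have ij: "\<not> int p dvd i' - j" by (simp add: dvd_diff_commute)
      have a'1: "1 \<le> a'" using a aa' by simp
      have m1: "mean (phases k \<gamma> (p ^ (k * b))) (\<lambda>u. norm (es A (S \<inter> cls (int p ^ a') j) u) ^ (2 * (tri k - tri (k - l))) *
          norm (es A (S \<inter> cls (int p ^ c) i') u) ^ (2 * tri (k - l)))
        \<le> C1 * real p powr (\<mu> / 2 * real b + \<eta> * (real b - g1 * real a'))
        * ssum p b N a' j ^ (tri k - tri (k - l)) * ssum p b N c i' ^ tri (k - l)"
        using C1(2)[OF h c a'1 a'b fa' ka' cond1 ij] by (simp add: bil_def mult_ac)
      have m2: "mean (phases k \<gamma> (p ^ (k * b))) (\<lambda>u. norm (es A (S \<inter> cls (int p ^ a') j) u) ^ (2 * tri (l - 1)) *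
          norm (es A (S \<inter> cls (int p ^ c) i') u) ^ (2 * (tri k - tri (l - 1))))
        \<le> C2 * real p powr (\<mu> / 2 * real b + \<eta> * (real b - g2 * real c))
        * ssum p b N a' j ^ tri (l - 1) * ssum p b N c i' ^ (tri k - tri (l - 1))"
        using C2(2)[OF h a'1 a'b c fc kc cond2 ji] by (simp add: bil_def)
      have "bil p k b \<gamma> A S l a' j c i' \<le>
         (C1 * real p powr (\<mu> / 2 * real b + \<eta> * (real b - g1 * real a'))
           * ssum p b N a' j ^ (tri k - tri (k - l)) * ssum p b N c i' ^ tri (k - l)) powr \<theta> *
         (C2 * real p powr (\<mu> / 2 * real b + \<eta> * (real b - g2 * real c))
           * ssum p b N a' j ^ tri (l - 1) * ssum p b N c i' ^ (tri k - tri (l - 1))) powr (1 - \<theta>)"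
        unfolding bil_def by (rule mean_hoelder_prod[OF fin th _ _ tid m1 m2]) auto
      also have "\<dots> = (C1 powr \<theta> * C2 powr (1 - \<theta>)) * real p powr ee * ssum p b N a' j ^ tri l * ssum p b N c i' ^ (tri k - tri l)"
      proof (rule bound_interpolate[OF th ssum_nonneg[OF N] ssum_nonneg[OF N] C1(1) C2(1) _ tid])
        have "real l * real a' = real w * real c" using la' by (metis of_nat_mult)
        then have "real a' = real w * real c / real l" using l by (simp add: field_simps)
        then have 1: "\<theta> * real a' = real c / real l" using w by (simp add: \<theta>_def)
        have 2: "real (k - l) / real (k - l + 1) = 1 - \<theta>"
          using w by (simp add: \<theta>_def w_def field_simps)
        have "\<theta> * (\<mu> / 2 * real b + \<eta> * (real b - g1 * real a')) + (1 - \<theta>) * (\<mu> / 2 * real b + \<eta> * (real b - g2 * real c))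
           = \<mu> / 2 * real b + \<eta> * (real b - (g1 * (\<theta> * real a') + (1 - \<theta>) * (g2 * real c)))"
          by (simp add: field_simps)
        also have "\<dots> = ee" unfolding 1 2 ee_def by (simp add: algebra_simps)
        finally show "ee = \<theta> * (\<mu> / 2 * real b + \<eta> * (real b - g1 * real a')) + (1 - \<theta>) * (\<mu> / 2 * real b + \<eta> * (real b - g2 * real c))"
          by simp
      qed (use p1 in auto)
      finally show ?thesis by (simp add: C_def)
    qed
    have "bil p k b \<gamma> A S l a i c i' \<le> (C0 * real p powr (\<mu> / 2 * real (a' - a)) * (C * real p powr ee))
        * ssum p b N a i ^ tri l * ssum p b N c i' ^ (tri k - tri l)"
      using la' C0(1) C by (intro bil_lower_dim[OF C0(2) _ h p l a(1) aa' a'b _ c(2) ii _ hol]) (auto simp: w_def)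
    also have "\<dots> \<le> (C0 * C * real p powr (\<mu> * real b + \<eta> * (real b - ?g * real c)))
        * ssum p b N a i ^ tri l * ssum p b N c i' ^ (tri k - tri l)"
    proof (intro mult_right_mono)
      have "real p powr (\<mu> / 2 * real (a' - a)) * real p powr ee \<le> real p powr (\<mu> * real b + \<eta> * (real b - ?g * real c))"
      proof -
        have "\<mu> / 2 * real (a' - a) \<le> \<mu> / 2 * real b" using \<mu> a'b by (intro mult_left_mono) auto
        then have "\<mu> / 2 * real (a' - a) + ee \<le> \<mu> * real b + \<eta> * (real b - ?g * real c)" by (simp add: ee_def)
        then show ?thesis using p1 by (simp flip: powr_add)
      qed
      then show "C0 * real p powr (\<mu> / 2 * real (a' - a)) * (C * real p powr ee) \<le> C0 * C * real p powr (\<mu> * real b + \<eta> * (real b - ?g * real c))"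
        using C0(1) C by (simp add: mult.assoc mult.left_commute)
    qed (auto intro!: zero_le_power ssum_nonneg N)
    finally show "bil p k b \<gamma> A S l a i c i' \<le> C0 * C * real p powr (\<mu> * real b + \<eta> * (real b - ?g * real c))
        * ssum p b N a i ^ tri l * ssum p b N c i' ^ (tri k - tri l)" .
  qed
qed

text \<open>The profile l (k - l) is a fixed point of the recursion g(l) = g(k - l) / l + (k - l) /
  (k - l + 1) g(l - 1) with g(0) = 0. The true value at \<open>l = 0\<close> is 1, and this excess
  adds to the profile in every round, so the gain grows linearly in \<open>n\<close> without
  bound.\<close>

lemma bil_bound_iterate:
  assumes p: "prime p" "k < p" and \<eta>: "\<eta> \<ge> 0" and k: "2 \<le> k" and E: "decoup_exp p k \<eta>"
    and El: "\<And>l \<epsilon>. 1 \<le> l \<Longrightarrow> l < k \<Longrightarrow> \<epsilon> > 0 \<Longrightarrow> decoup_exp p l \<epsilon>"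
    and l: "1 \<le> l" "l < k"
  shows "bil_bound p k \<eta> n l (real n / (real k)\<^sup>2 * (real l * (real k - real l)))"
  using l
proof (induction n arbitrary: l)
  case 0
  then show ?case using bil_bound_base[OF E p _ _ \<eta>] by simp
next
  case (Suc n)
  define lm where "lm = real n / (real k)\<^sup>2"
  have p1: "p > 1" using p prime_gt_1_nat by simp
  \<comment> \<open>Within one round the boundary value 1 propagates through the induction on
    \<open>l\<close> as (k - l) / k, which is at least l (k - l) / k^2, the increment of the
    profile.\<close>
  have inner: "bil_bound p k \<eta> (Suc n) l (lm * (real l * (real k - real l)) + (real k - real l) / real k)" if "l < k" for l
    using that
  proof (induction l)
    case 0
    then show ?case using bil_bound_0[OF E p] k by simp
  next
    case (Suc l)
    define m where "m = Suc l"
    have m: "1 \<le> m" "m < k" using Suc.prems by (auto simp: m_def)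
    have B1: "bil_bound p k \<eta> n (k - m) (lm * (real (k - m) * (real k - real (k - m))))"
      using Suc.prems \<open>\<And>l. 1 \<le> l \<Longrightarrow> l < k \<Longrightarrow> bil_bound p k \<eta> n l (real n / (real k)\<^sup>2 * (real l * (real k - real l)))\<close>[of "k - m"] m
      by (simp add: lm_def)
    have B2: "bil_bound p k \<eta> (Suc n) (m - 1) (lm * (real l * (real k - real l)) + (real k - real l) / real k)"
      using Suc by (simp add: m_def)
    have st: "bil_bound p k \<eta> (Suc n) m (lm * (real (k - m) * (real k - real (k - m))) / real m
        + real (k - m) / real (k - m + 1) * (lm * (real l * (real k - real l)) + (real k - real l) / real k))"
      by (rule bil_bound_step[OF p m \<eta> El[OF m] B1 B2])
    have km: "real (k - m) = real k - real m" "real (k - m + 1) = real k - real l" "real l = real m - 1"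
      using m by (auto simp: m_def of_nat_diff)
    have ne: "real k - real l \<noteq> 0" "real m \<noteq> 0" "real k \<noteq> 0" using m by (auto simp: m_def)
    have "lm * (real (k - m) * (real k - real (k - m))) / real m = lm * (real k - real m)"
      unfolding km(1) using ne by simp
    moreover have "real (k - m) / real (k - m + 1) * (lm * (real l * (real k - real l)) + (real k - real l) / real k)
      = lm * ((real k - real m) * real l) + (real k - real m) / real k"
      unfolding km(1,2) using ne by (simp add: field_simps)
    ultimately have "lm * (real (k - m) * (real k - real (k - m))) / real m
        + real (k - m) / real (k - m + 1) * (lm * (real l * (real k - real l)) + (real k - real l) / real k)
      = lm * (real m * (real k - real m)) + (real k - real m) / real k"
      unfolding km(3) by (simp add: algebra_simps)
    then show ?case using st by (simp add: m_def)
  qed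
  have "real (Suc n) / (real k)\<^sup>2 * (real l * (real k - real l)) \<le> lm * (real l * (real k - real l)) + (real k - real l) / real k"
  proof -
    have "(real k - real l) * (real l / real k) \<le> (real k - real l) * 1"
      using Suc.prems by (intro mult_left_mono) auto
    then have "(real k - real l) * (real l / real k) / real k \<le> (real k - real l) / real k"
      by (intro divide_right_mono) auto
    moreover have "real (Suc n) / (real k)\<^sup>2 * (real l * (real k - real l)) =
        lm * (real l * (real k - real l)) + (real k - real l) * (real l / real k) / real k"
      using k by (simp add: lm_def power2_eq_square field_simps)
    ultimately show ?thesis by linarith
  qed
  then show ?case using bil_bound_mono[OF inner[OF Suc.prems(2)] _ \<eta> p1] by blast
qed

section \<open>Decoupling\<close>

lemma decoup_mono:
  assumes "decoup p k b D" "D \<le> D'"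
  shows "decoup p k b D'"
  unfolding decoup_def
proof (intro allI impI)
  fix \<gamma> A and S :: "int set" and N :: "int \<Rightarrow> real"
  assume h: "good p k \<gamma>" "finite S" "\<forall>j. 0 \<le> N j" "\<forall>j\<in>{0..<int p ^ b}. mean (phases k \<gamma> (p ^ (k * b)))
         (\<lambda>u. norm (es A (S \<inter> cls (int p ^ b) j) u) ^ (2 * tri k)) \<le> N j ^ tri k"
  have "mean (phases k \<gamma> (p ^ (k * b))) (\<lambda>u. norm (es A S u) ^ (2 * tri k))
         \<le> D * (\<Sum>j\<in>{0..<int p ^ b}. N j) ^ tri k"
    using assms(1) h unfolding decoup_def by blast
  also have "\<dots> \<le> D' * (\<Sum>j\<in>{0..<int p ^ b}. N j) ^ tri k"
    using assms(2) h by (intro mult_right_mono zero_le_power sum_nonneg) auto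
  finally show "mean (phases k \<gamma> (p ^ (k * b))) (\<lambda>u. norm (es A S u) ^ (2 * tri k))
         \<le> D' * (\<Sum>j\<in>{0..<int p ^ b}. N j) ^ tri k" .
qed

lemma decoup_exp_trivial:
  assumes p: "prime p" and k: "1 \<le> k"
  shows "decoup_exp p k (real (tri k))"
  unfolding decoup_exp_def
proof (intro exI[of _ 1] conjI allI)
  fix b
  have p0: "p > 0" using p by (simp add: prime_gt_0_nat)
  have "real p ^ (b * tri k) = real p powr (real (b * tri k))" using p0 by (simp only: powr_realpow of_nat_0_less_iff)
  then have "real p ^ (b * tri k) = 1 * real p powr (real (tri k) * real b)" by (simp add: mult.commute)
  then show "decoup p k b (1 * real p powr (real (tri k) * real b))"
    using decoup_trivial[OF p0 k, of b] by simp
qed auto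

lemma tri_ge_3: "2 \<le> k \<Longrightarrow> 3 \<le> tri k"
  using tri_mono[of 2 k] by (simp add: tri_def)

lemma res_card: "p > 0 \<Longrightarrow> a \<le> c \<Longrightarrow> card (res (int p ^ c) (int p ^ a) i) \<le> p ^ c"
proof -
  assume "p > 0"
  have "card (res (int p ^ c) (int p ^ a) i) \<le> card {0..<int p ^ c}"
    by (intro card_mono) (auto simp: res_def)
  then show ?thesis by (simp add: nat_power_eq)
qed

text \<open>Passing from level \<open>1\<close> to level \<open>c\<close> in the second interval costs \<open>p\<^bsup>O(c)\<^esup>\<close>, which is
  paid for by the gain \<open>\<eta> g c\<close>.\<close>

lemma bilinear_level_one:
  assumes bb: "\<And>j. j \<in> res (int p ^ c) (int p ^ 1) i' \<Longrightarrow>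
      bil p k b \<gamma> A S 1 1 i c j \<le> M * ssum p b N 1 i ^ tri 1 * ssum p b N c j ^ (tri k - tri 1)"
    and p: "prime p" and k: "2 \<le> k" and c: "1 \<le> c" "c \<le> b" and S: "finite S" and N: "\<And>j. 0 \<le> N j" and M: "M \<ge> 0"
  shows "mean (phases k \<gamma> (p ^ (k * b))) (\<lambda>u. norm (es A (S \<inter> cls (int p) i) u) ^ 2 *
        norm (es A (S \<inter> cls (int p) i') u) ^ (2 * (tri k - 1)))
      \<le> (real p ^ c) ^ (2 * (tri k - 1)) * M * (ssum p b N 1 i * ssum p b N 1 i' ^ (tri k - 1))"
proof -
  have p0: "p > 0" using p by (simp add: prime_gt_0_nat)
  define T where "T = tri k - 1"
  have T: "T \<ge> 1" using tri_ge_3[OF k] by (simp add: T_def)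
  obtain m where m: "2 * T = Suc m" using T by (cases "2 * T") auto
  define J where "J = res (int p ^ c) (int p ^ 1) i'"
  have J: "finite J" "real (card J) \<le> real p ^ c"
    using res_card[OF p0 c(1), of i'] by (auto simp: J_def simp flip: of_nat_power)
  define U where "U = phases k \<gamma> (p ^ (k * b))"
  have "mean U (\<lambda>u. norm (es A (S \<inter> cls (int p) i) u) ^ 2 * norm (es A (S \<inter> cls (int p) i') u) ^ (2 * T))
     \<le> mean U (\<lambda>u. \<Sum>j\<in>J. real (card J) ^ m * (norm (es A (S \<inter> cls (int p) i) u) ^ 2 * norm (es A (S \<inter> cls (int p ^ c) j) u) ^ (2 * T)))"
  proof (intro mean_mono)
    fix u
    have "es A (S \<inter> cls (int p ^ 1) i') u = (\<Sum>j\<in>J. es A (S \<inter> cls (int p ^ c) j) u)"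
      unfolding J_def using p0 c by (intro es_refine S) (auto intro: le_imp_power_dvd)
    then have "norm (es A (S \<inter> cls (int p) i') u) ^ (2 * T) \<le> real (card J) ^ m * (\<Sum>j\<in>J. norm (es A (S \<inter> cls (int p ^ c) j) u) ^ (2 * T))"
      unfolding m using norm_sum_power_le[OF J(1), of "\<lambda>j. es A (S \<inter> cls (int p ^ c) j) u" m] by simp
    then have "norm (es A (S \<inter> cls (int p) i) u) ^ 2 * norm (es A (S \<inter> cls (int p) i') u) ^ (2 * T)
      \<le> norm (es A (S \<inter> cls (int p) i) u) ^ 2 * (real (card J) ^ m * (\<Sum>j\<in>J. norm (es A (S \<inter> cls (int p ^ c) j) u) ^ (2 * T)))"
      by (intro mult_left_mono) auto
    then show "norm (es A (S \<inter> cls (int p) i) u) ^ 2 * norm (es A (S \<inter> cls (int p) i') u) ^ (2 * T)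
      \<le> (\<Sum>j\<in>J. real (card J) ^ m * (norm (es A (S \<inter> cls (int p) i) u) ^ 2 * norm (es A (S \<inter> cls (int p ^ c) j) u) ^ (2 * T)))"
      by (simp add: sum_distrib_left mult_ac)
  qed
  also have "\<dots> = (\<Sum>j\<in>J. real (card J) ^ m * bil p k b \<gamma> A S 1 1 i c j)"
    unfolding mean_sum mean_cmult by (simp add: bil_def U_def T_def)
  also have "\<dots> \<le> (\<Sum>j\<in>J. (real p ^ c) ^ m * (M * (ssum p b N 1 i * ssum p b N 1 i' ^ T)))"
  proof (intro sum_mono mult_mono power_mono J)
    fix j assume j: "j \<in> J"
    have "ssum p b N c j \<le> (\<Sum>j\<in>J. ssum p b N c j)"
      using j J by (intro member_le_sum) (auto intro: ssum_nonneg N)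
    also have "\<dots> = ssum p b N 1 i'" unfolding J_def by (rule ssum_refine[OF p0 c])
    finally have "ssum p b N c j ^ T \<le> ssum p b N 1 i' ^ T" by (intro power_mono ssum_nonneg N)
    then have "M * (ssum p b N 1 i * ssum p b N c j ^ T) \<le> M * (ssum p b N 1 i * ssum p b N 1 i' ^ T)"
      by (intro mult_left_mono M ssum_nonneg N)
    moreover have "bil p k b \<gamma> A S 1 1 i c j \<le> M * (ssum p b N 1 i * ssum p b N c j ^ T)"
      using bb[of j] j by (simp add: J_def T_def mult.assoc)
    ultimately show "bil p k b \<gamma> A S 1 1 i c j \<le> M * (ssum p b N 1 i * ssum p b N 1 i' ^ T)" by simp
  qed (auto simp: bil_def intro!: mean_nonneg)
  also have "\<dots> = real (card J) * ((real p ^ c) ^ m * (M * (ssum p b N 1 i * ssum p b N 1 i' ^ T)))" by simp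
  also have "\<dots> \<le> real p ^ c * ((real p ^ c) ^ m * (M * (ssum p b N 1 i * ssum p b N 1 i' ^ T)))"
    by (intro mult_right_mono J mult_nonneg_nonneg zero_le_power ssum_nonneg N M) auto
  also have "\<dots> = (real p ^ c) ^ (2 * T) * M * (ssum p b N 1 i * ssum p b N 1 i' ^ T)"
    unfolding m by simp
  finally show ?thesis by (simp add: U_def T_def)
qed

text \<open>The narrow part consists of single classes modulo \<open>p\<close> with
  \<open>b - 1\<close> levels left. The sum of the T-th powers of the \<open>s i\<close> is at most
  the T-th power of their sum, so this part costs only the factor
  \<open>(1 + \<delta>) ^ (2 * tri k)\<close>. The broad part involves incongruent classes and falls
  under \<open>bl\<close>.\<close>

lemma broad_narrow_decoup:
  assumes dec: "decoup p k (b - 1) D" and D: "D \<ge> 0" and p: "prime p" "k < p" and k: "2 \<le> k" and b: "1 \<le> b"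
    and \<delta>: "\<delta> > 0" and X: "X \<ge> 0"
    and bl: "\<And>\<gamma> A S N i i'. hyp p k b \<gamma> A S N \<Longrightarrow> \<not> int p dvd i - i' \<Longrightarrow>
      mean (phases k \<gamma> (p ^ (k * b))) (\<lambda>u. norm (es A (S \<inter> cls (int p) i) u) ^ 2 *
        norm (es A (S \<inter> cls (int p) i') u) ^ (2 * (tri k - 1))) \<le> X * (ssum p b N 1 i * ssum p b N 1 i' ^ (tri k - 1))"
  shows "decoup p k b ((1 + \<delta>) ^ (2 * tri k) * D +
     real p ^ (2 * tri k) * (real p / \<delta>) ^ (2 * (tri k - 1)) * (real p * real p * X))"
  unfolding decoup_def
proof (intro allI impI)
  fix \<gamma> A and S :: "int set" and N :: "int \<Rightarrow> real"
  assume g: "good p k \<gamma>" and S: "finite S" and N': "\<forall>j. 0 \<le> N j" and le: "\<forall>j\<in>{0..<int p ^ b}. mean (phases k \<gamma> (p ^ (k * b)))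
         (\<lambda>u. norm (es A (S \<inter> cls (int p ^ b) j) u) ^ (2 * tri k)) \<le> N j ^ tri k"
  have h: "hyp p k b \<gamma> A S N" using g S N' le by (simp add: hyp_def)
  have N: "\<And>j. 0 \<le> N j" using N' by simp
  have p0: "p > 0" using p by (simp add: prime_gt_0_nat)
  define U where "U = phases k \<gamma> (p ^ (k * b))"
  define J where "J = {0..<int p}"
  have J: "finite J" "card J = p" by (auto simp: J_def)
  define T where "T = tri k"
  have T: "T \<ge> 3" using tri_ge_3[OF k] by (simp add: T_def)
  define C where "C = real p ^ (2 * T) * (real p / \<delta>) ^ (2 * (T - 1))"
  have C: "C \<ge> 0" using \<delta> by (simp add: C_def)
  define s where "s i = ssum p b N 1 i" for i
  have s0: "0 \<le> s i" for i unfolding s_def by (intro ssum_nonneg N)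
  have tot: "(\<Sum>i\<in>J. s i) = (\<Sum>j\<in>{0..<int p ^ b}. N j)"
    using ssum_refine[OF p0, of 0 1 b N 0] b by (simp add: J_def s_def res_1 ssum_def)
  define Z where "Z = (\<Sum>j\<in>{0..<int p ^ b}. N j)"
  have sZ: "s i \<le> Z" if "i \<in> J" for i
    unfolding Z_def tot[symmetric] using that J s0 by (intro member_le_sum) auto
  have Z0: "Z \<ge> 0" unfolding Z_def using N by (intro sum_nonneg) auto
  let ?f = "\<lambda>i u. norm (es A (S \<inter> cls (int p) i) u)"
  have "mean U (\<lambda>u. norm (es A S u) ^ (2 * T)) \<le> mean U (\<lambda>u. (1 + \<delta>) ^ (2 * T) * (\<Sum>i\<in>J. ?f i u ^ (2 * T))
      + C * (\<Sum>i\<in>J. \<Sum>j\<in>J - {i}. ?f i u ^ 2 * ?f j u ^ (2 * (T - 1))))"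
  proof (intro mean_mono)
    fix u
    have "es A S u = (\<Sum>i\<in>J. es A (S \<inter> cls (int p) i) u)" unfolding J_def using p0 by (intro es_split S) auto
    then show "norm (es A S u) ^ (2 * T) \<le> (1 + \<delta>) ^ (2 * T) * (\<Sum>i\<in>J. ?f i u ^ (2 * T))
      + C * (\<Sum>i\<in>J. \<Sum>j\<in>J - {i}. ?f i u ^ 2 * ?f j u ^ (2 * (T - 1)))"
      using broad_narrow[OF J(1) \<delta>, of T "\<lambda>i. es A (S \<inter> cls (int p) i) u"] T by (simp add: C_def J(2))
  qed
  also have "\<dots> = (1 + \<delta>) ^ (2 * T) * (\<Sum>i\<in>J. mean U (\<lambda>u. ?f i u ^ (2 * T)))
      + C * (\<Sum>i\<in>J. \<Sum>j\<in>J - {i}. mean U (\<lambda>u. ?f i u ^ 2 * ?f j u ^ (2 * (T - 1))))"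
    by (simp add: mean_add mean_cmult mean_sum)
  also have "\<dots> \<le> (1 + \<delta>) ^ (2 * T) * (D * Z ^ T) + C * (real p * real p * X * Z ^ T)"
  proof (intro add_mono mult_left_mono C)
    have "(\<Sum>i\<in>J. mean U (\<lambda>u. ?f i u ^ (2 * T))) \<le> (\<Sum>i\<in>J. D * s i ^ T)"
      unfolding U_def T_def s_def using mean_class_bound[OF dec D h p _ _ b] k by (intro sum_mono) auto
    also have "\<dots> = D * (\<Sum>i\<in>J. s i ^ T)" by (simp add: sum_distrib_left)
    also have "\<dots> \<le> D * (\<Sum>i\<in>J. s i) ^ T"
      using T s0 J by (intro mult_left_mono D sum_power_le_power_sum) auto
    finally show "(\<Sum>i\<in>J. mean U (\<lambda>u. ?f i u ^ (2 * T))) \<le> D * Z ^ T" by (simp add: tot Z_def)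
  next
    have "(\<Sum>i\<in>J. \<Sum>j\<in>J - {i}. mean U (\<lambda>u. ?f i u ^ 2 * ?f j u ^ (2 * (T - 1)))) \<le> (\<Sum>i\<in>J. \<Sum>j\<in>J - {i}. X * Z ^ T)"
    proof (intro sum_mono)
      fix i j assume ij: "i \<in> J" "j \<in> J - {i}"
      then have "\<not> int p dvd i - j" by (auto simp: J_def mod_eq_dvd_iff[symmetric])
      then have "mean U (\<lambda>u. ?f i u ^ 2 * ?f j u ^ (2 * (T - 1))) \<le> X * (s i * s j ^ (T - 1))"
        unfolding U_def T_def s_def by (rule bl[OF h])
      also have "\<dots> \<le> X * (Z * Z ^ (T - 1))"
        using ij s0 Z0 by (intro mult_left_mono X mult_mono power_mono sZ) auto
      also have "Z * Z ^ (T - 1) = Z ^ T" using T by (cases T) auto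
      finally show "mean U (\<lambda>u. ?f i u ^ 2 * ?f j u ^ (2 * (T - 1))) \<le> X * Z ^ T" .
    qed
    also have "\<dots> \<le> (\<Sum>i\<in>J. \<Sum>j\<in>J. X * Z ^ T)"
      using J X Z0 by (intro sum_mono sum_mono2) auto
    also have "\<dots> = real p * real p * X * Z ^ T" by (simp add: J)
    finally show "(\<Sum>i\<in>J. \<Sum>j\<in>J - {i}. mean U (\<lambda>u. ?f i u ^ 2 * ?f j u ^ (2 * (T - 1)))) \<le> real p * real p * X * Z ^ T" .
  qed (use \<delta> in auto)
  also have "\<dots> = ((1 + \<delta>) ^ (2 * T) * D + C * (real p * real p * X)) * Z ^ T"
    by (simp add: distrib_right mult.assoc)
  finally show "mean (phases k \<gamma> (p ^ (k * b))) (\<lambda>u. norm (es A S u) ^ (2 * tri k))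
         \<le> ((1 + \<delta>) ^ (2 * tri k) * D +
     real p ^ (2 * tri k) * (real p / \<delta>) ^ (2 * (tri k - 1)) * (real p * real p * X)) * (\<Sum>j\<in>{0..<int p ^ b}. N j) ^ tri k"
    by (simp add: U_def T_def C_def Z_def)
qed

text \<open>The number of rounds, and with it the saving \<tau>, is fixed by \<eta>0 before \<eta>
  is chosen. This uniformity is what lets the saving be subtracted again and again.\<close>

lemma bilinear_exp_bound:
  assumes p: "prime p" "k < p" and k: "2 \<le> k" and \<eta>0: "\<eta>0 > 0"
    and El: "\<And>l \<epsilon>. 1 \<le> l \<Longrightarrow> l < k \<Longrightarrow> \<epsilon> > 0 \<Longrightarrow> decoup_exp p l \<epsilon>"
  shows "\<exists>\<tau>>0. \<forall>\<eta>\<ge>\<eta>0. decoup_exp p k \<eta> \<longrightarrow> (\<exists>C>0. \<exists>Q\<ge>1. \<forall>b\<ge>Q. \<forall>\<gamma> A S N i i'. hyp p k b \<gamma> A S N \<longrightarrow> \<not> int p dvd i - i' \<longrightarrow>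
      mean (phases k \<gamma> (p ^ (k * b))) (\<lambda>u. norm (es A (S \<inter> cls (int p) i) u) ^ 2 *
        norm (es A (S \<inter> cls (int p) i') u) ^ (2 * (tri k - 1)))
      \<le> C * real p powr ((\<eta> - \<tau>) * real b) * (ssum p b N 1 i * ssum p b N 1 i' ^ (tri k - 1)))"
proof -
  have p1: "real p > 1" using p prime_gt_1_nat by simp
  \<comment> \<open>Chosen so that \<eta>0 g is at least \<open>2 * tri k + 1\<close>: the part
    \<open>2 * tri k\<close> pays for passing from level 1 to level \<open>c\<close>, and the
    remaining 1 leaves the saving p^(-c).\<close>
  define R where "R = (2 * real (tri k) + 1) / \<eta>0"
  obtain n where n: "real n \<ge> R * (real k)\<^sup>2" using real_arch_simple by blast
  define g where "g = real n / (real k)\<^sup>2 * (real 1 * (real k - real 1))"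
  have g: "\<eta>0 * g \<ge> 2 * real (tri k) + 1"
  proof -
    have "R \<le> real n / (real k)\<^sup>2" using n k by (simp add: field_simps)
    moreover have "real n / (real k)\<^sup>2 * 1 \<le> real n / (real k)\<^sup>2 * (real k - 1)"
      using k by (intro mult_left_mono) auto
    ultimately have "R \<le> g" by (simp add: g_def)
    then have "\<eta>0 * R \<le> \<eta>0 * g" using \<eta>0 by (intro mult_left_mono) auto
    then show ?thesis using \<eta>0 by (simp add: R_def)
  qed
  define \<mu> where "\<mu> = 1 / (2 * real k ^ n)"
  have \<mu>: "\<mu> > 0" using k by (simp add: \<mu>_def)
  define F where "F = (fact k :: nat) ^ n"
  define Q where "Q = F * k ^ n"
  have F1: "F \<ge> 1" by (simp add: F_def Suc_leI)
  have Q1: "Q \<ge> 1" using k F1 by (simp add: Q_def Suc_leI)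
  show ?thesis
  proof (rule exI[of _ \<mu>], intro conjI \<mu> allI impI)
    fix \<eta> assume \<eta>: "\<eta> \<ge> \<eta>0" and E: "decoup_exp p k \<eta>"
    have "bil_bound p k \<eta> n 1 g"
      unfolding g_def by (rule bil_bound_iterate[OF p _ k E El]) (use \<eta> \<eta>0 k in auto)
    then obtain C where C: "C > 0" "\<And>b \<gamma> A S N a i c i'.
     hyp p k b \<gamma> A S N \<Longrightarrow> 1 \<le> a \<Longrightarrow> a \<le> b \<Longrightarrow> 1 \<le> c \<Longrightarrow> c \<le> b \<Longrightarrow> fact k ^ n dvd c \<Longrightarrow> k ^ n * c \<le> b \<Longrightarrow>
     1 * a \<le> (k - 1 + 1) * c \<Longrightarrow> \<not> int p dvd i - i' \<Longrightarrow>
     bil p k b \<gamma> A S 1 a i c i' \<le> C * real p powr (\<mu> * real b + \<eta> * (real b - g * real c))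
        * ssum p b N a i ^ tri 1 * ssum p b N c i' ^ (tri k - tri 1)"
      using \<mu> unfolding bil_bound_def by metis
    define C' where "C' = C * real p powr real F"
    have C': "C' > 0" using C p1 by (simp add: C'_def)
    have "mean (phases k \<gamma> (p ^ (k * b))) (\<lambda>u. norm (es A (S \<inter> cls (int p) i) u) ^ 2 *
        norm (es A (S \<inter> cls (int p) i') u) ^ (2 * (tri k - 1)))
      \<le> C' * real p powr ((\<eta> - \<mu>) * real b) * (ssum p b N 1 i * ssum p b N 1 i' ^ (tri k - 1))"
      if b: "b \<ge> Q" and h: "hyp p k b \<gamma> A S N" and ii: "\<not> int p dvd i - i'" for b \<gamma> A S N i i'
    proof -
      \<comment> \<open>The largest multiple of \<open>F\<close> with
        \<open>k ^ n * c \<le> b\<close>. Up to a bounded error it equals b / k^n = 2 \<mu> b, so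
        p^(-c) outweighs the loss p^(\<mu> b) and still leaves p^(-\<mu> b).\<close>
      define c where "c = F * (b div Q)"
      have "b div Q \<ge> 1" using b Q1 by (simp add: Suc_leI div_greater_zero_iff)
      then have c1: "1 \<le> c" using F1 by (simp add: c_def Suc_leI)
      have "k ^ n * c = Q * (b div Q)" by (simp add: c_def Q_def)
      also have "\<dots> \<le> b" by simp
      finally have kc: "k ^ n * c \<le> b" .
      have "1 * c \<le> k ^ n * c" using k by (intro mult_right_mono) auto
      then have cb: "c \<le> b" using kc by linarith
      have fc: "fact k ^ n dvd c" by (simp add: c_def F_def)
      define M where "M = C * real p powr (\<mu> * real b + \<eta> * (real b - g * real c))"
      have M: "M \<ge> 0" using C by (simp add: M_def)
      have S: "finite S" and N: "\<And>j. 0 \<le> N j" using h by (auto simp: hyp_def)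
      have "mean (phases k \<gamma> (p ^ (k * b))) (\<lambda>u. norm (es A (S \<inter> cls (int p) i) u) ^ 2 *
        norm (es A (S \<inter> cls (int p) i') u) ^ (2 * (tri k - 1)))
        \<le> (real p ^ c) ^ (2 * (tri k - 1)) * M * (ssum p b N 1 i * ssum p b N 1 i' ^ (tri k - 1))"
      proof (rule bilinear_level_one[OF _ p(1) k c1 cb S N M])
        fix j assume j: "j \<in> res (int p ^ c) (int p ^ 1) i'"
        have "\<not> int p dvd i - j"
        proof
          assume "int p dvd i - j"
          moreover have "int p dvd j - i'" using j by (simp add: res_def)
          ultimately have "int p dvd (i - j) + (j - i')" by (rule dvd_add)
          then show False using ii by simp
        qed
        then show "bil p k b \<gamma> A S 1 1 i c j \<le> M * ssum p b N 1 i ^ tri 1 * ssum p b N c j ^ (tri k - tri 1)"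
          unfolding M_def using c1 cb k by (intro C(2)[OF h _ _ c1 cb fc kc]) auto
      qed
      also have "\<dots> \<le> C' * real p powr ((\<eta> - \<mu>) * real b) * (ssum p b N 1 i * ssum p b N 1 i' ^ (tri k - 1))"
      proof (intro mult_right_mono mult_nonneg_nonneg zero_le_power ssum_nonneg N)
        have "real b < real Q * (real (b div Q) + 1)"
        proof -
          have "b < Q * (b div Q) + Q" using Q1 mult_div_mod_eq[of Q b] mod_less_divisor[of Q b] by linarith
          then have "real b < real (Q * (b div Q) + Q)" by (simp only: of_nat_less_iff)
          then show ?thesis by (simp add: algebra_simps)
        qed
        also have "\<dots> = real k ^ n * (real c + real F)" by (simp add: Q_def c_def algebra_simps)
        finally have "real b / real k ^ n \<le> real c + real F" using k by (simp add: field_simps)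
        then have cc: "2 * (\<mu> * real b) \<le> real c + real F" by (simp add: \<mu>_def)
        have "\<eta>0 * g \<le> \<eta> * g" using \<eta> k by (intro mult_right_mono) (auto simp: g_def)
        then have "(2 * real (tri k) + 1) * real c \<le> (\<eta> * g) * real c" using g by (intro mult_right_mono) auto
        moreover have "real (2 * (tri k - 1)) * real c \<le> 2 * real (tri k) * real c" by (intro mult_right_mono) auto
        ultimately have ex: "real (2 * (tri k - 1)) * real c + (\<mu> * real b + \<eta> * (real b - g * real c)) \<le> real F + (\<eta> - \<mu>) * real b"
          using cc by (simp add: algebra_simps)
        have "(real p ^ c) ^ (2 * (tri k - 1)) = real p powr (real (2 * (tri k - 1)) * real c)"
          using p1 by (simp add: powr_realpow[symmetric] powr_powr power_mult[symmetric] mult.commute)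
        then have "(real p ^ c) ^ (2 * (tri k - 1)) * M = C * real p powr (real (2 * (tri k - 1)) * real c + (\<mu> * real b + \<eta> * (real b - g * real c)))"
          by (simp add: M_def powr_add)
        also have "\<dots> \<le> C * real p powr (real F + (\<eta> - \<mu>) * real b)"
          using C p1 ex by (intro mult_left_mono powr_mono) auto
        finally show "(real p ^ c) ^ (2 * (tri k - 1)) * M \<le> C' * real p powr ((\<eta> - \<mu>) * real b)"
          by (simp add: C'_def powr_add)
      qed
      finally show ?thesis .
    qed
    then show "\<exists>C>0. \<exists>Q\<ge>1. \<forall>b\<ge>Q. \<forall>\<gamma> A S N i i'. hyp p k b \<gamma> A S N \<longrightarrow> \<not> int p dvd i - i' \<longrightarrow>
      mean (phases k \<gamma> (p ^ (k * b))) (\<lambda>u. norm (es A (S \<inter> cls (int p) i) u) ^ 2 *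
        norm (es A (S \<inter> cls (int p) i') u) ^ (2 * (tri k - 1)))
      \<le> C * real p powr ((\<eta> - \<mu>) * real b) * (ssum p b N 1 i * ssum p b N 1 i' ^ (tri k - 1))"
      using C' Q1 by (intro exI[of _ C'] conjI exI[of _ Q]) auto
  qed
qed

text \<open>Induction on the level: the narrow part inherits the constant of level
  \<open>b - 1\<close> and must not accumulate losses, the broad part already has the desired
  size.\<close>

lemma decoup_exp_from_bilinear:
  assumes p: "prime p" "k < p" and k: "2 \<le> k" and \<eta>: "\<eta> > 0" and C: "C > 0" and Q: "Q \<ge> 1"
    and bl: "\<And>b \<gamma> A S N i i'. b \<ge> Q \<Longrightarrow> hyp p k b \<gamma> A S N \<Longrightarrow> \<not> int p dvd i - i' \<Longrightarrow>
      mean (phases k \<gamma> (p ^ (k * b))) (\<lambda>u. norm (es A (S \<inter> cls (int p) i) u) ^ 2 *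
        norm (es A (S \<inter> cls (int p) i') u) ^ (2 * (tri k - 1)))
      \<le> C * real p powr (\<eta> * real b) * (ssum p b N 1 i * ssum p b N 1 i' ^ (tri k - 1))"
  shows "decoup_exp p k \<eta>"
proof -
  have p1: "real p > 1" using p prime_gt_1_nat by simp
  have p0: "p > 0" using p by (simp add: prime_gt_0_nat)
  define T where "T = tri k"
  have T: "T \<ge> 3" using tri_ge_3[OF k] by (simp add: T_def)
  \<comment> \<open>Makes \<open>(1 + \<delta>) ^ (2 * T)\<close> equal to p^(\<eta>/2), half of the
    factor p^\<eta> that one more level allows; the other half is the contraction
    \<open>q < 1\<close>.\<close>
  define \<delta> where "\<delta> = real p powr (\<eta> / (4 * real T)) - 1"
  have "\<eta> / (4 * real T) > 0" using \<eta> T by simp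
  then have \<delta>: "\<delta> > 0" using p1 powr_less_mono[of 0 "\<eta> / (4 * real T)" "real p"] by (simp add: \<delta>_def)
  have \<delta>T: "(1 + \<delta>) ^ (2 * T) = real p powr (\<eta> / 2)"
  proof -
    have "(1 + \<delta>) ^ (2 * T) = (real p powr (\<eta> / (4 * real T))) powr real (2 * T)"
      using p1 by (subst powr_realpow) (auto simp: \<delta>_def)
    also have "\<dots> = real p powr (\<eta> / (4 * real T) * real (2 * T))" by (simp add: powr_powr)
    also have "\<eta> / (4 * real T) * real (2 * T) = \<eta> / 2" using T by simp
    finally show ?thesis .
  qed
  define C2 where "C2 = real p ^ (2 * T) * (real p / \<delta>) ^ (2 * (T - 1)) * (real p * real p * C)"
  have C2: "C2 \<ge> 0" using C \<delta> by (simp add: C2_def)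
  define q where "q = real p powr (- \<eta> / 2)"
  have q: "q < 1" using p1 \<eta> powr_less_mono[of "- \<eta> / 2" 0 "real p"] by (simp add: q_def)
  \<comment> \<open>The first entry covers the levels below \<open>Q\<close> by the trivial bound,
    the second solves \<open>M * q + C2 \<le> M\<close>.\<close>
  define M where "M = max (real p ^ (Q * T)) (C2 / (1 - q))"
  have M: "M \<ge> real p ^ (Q * T)" "M * (1 - q) \<ge> C2"
    using q by (auto simp: M_def field_simps max_def)
  have M0: "M > 0" using M(1) p1 zero_less_power[of "real p" "Q * T"] by linarith
  have "decoup p k b (M * real p powr (\<eta> * real b))" for b
  proof (induction b rule: less_induct)
    case (less b)
    show ?case
    proof (cases "b < Q")
      case True
      have "real p ^ (b * T) \<le> real p ^ (Q * T)" using p1 True by (intro power_increasing) auto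
      also have "\<dots> \<le> M * 1" using M by simp
      also have "\<dots> \<le> M * real p powr (\<eta> * real b)"
        using M0 p1 \<eta> by (intro mult_left_mono ge_one_powr_ge_zero) auto
      finally show ?thesis using k by (intro decoup_mono[OF decoup_trivial[OF p0]]) (auto simp: T_def)
    next
      case False
      then have b: "b \<ge> Q" "b \<ge> 1" using Q by auto
      have "decoup p k (b - 1) (M * real p powr (\<eta> * real (b - 1)))" using b by (intro less) auto
      then have "decoup p k b ((1 + \<delta>) ^ (2 * tri k) * (M * real p powr (\<eta> * real (b - 1))) +
         real p ^ (2 * tri k) * (real p / \<delta>) ^ (2 * (tri k - 1)) * (real p * real p * (C * real p powr (\<eta> * real b))))"
        using M0 C by (rule_tac broad_narrow_decoup[OF _ _ p k b(2) \<delta> _ bl[OF b(1)]]) auto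
      then show ?thesis
      proof (rule decoup_mono)
        have "\<eta> / 2 + \<eta> * real (b - 1) = \<eta> * real b + (- \<eta> / 2)" using b by (simp add: of_nat_diff field_simps)
        then have "real p powr (\<eta> / 2) * real p powr (\<eta> * real (b - 1)) = real p powr (\<eta> * real b) * q"
          unfolding q_def powr_add[symmetric] by (simp only:)
        then have "(1 + \<delta>) ^ (2 * tri k) * (M * real p powr (\<eta> * real (b - 1))) = M * q * real p powr (\<eta> * real b)"
          using \<delta>T unfolding T_def by (simp add: mult_ac)
        then have "(1 + \<delta>) ^ (2 * tri k) * (M * real p powr (\<eta> * real (b - 1))) +
         real p ^ (2 * tri k) * (real p / \<delta>) ^ (2 * (tri k - 1)) * (real p * real p * (C * real p powr (\<eta> * real b)))
         = (M * q + C2) * real p powr (\<eta> * real b)" by (simp add: C2_def T_def algebra_simps)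
        also have "\<dots> \<le> M * real p powr (\<eta> * real b)"
          using M(2) by (intro mult_right_mono) (auto simp: algebra_simps)
        finally show "(1 + \<delta>) ^ (2 * tri k) * (M * real p powr (\<eta> * real (b - 1))) +
         real p ^ (2 * tri k) * (real p / \<delta>) ^ (2 * (tri k - 1)) * (real p * real p * (C * real p powr (\<eta> * real b)))
         \<le> M * real p powr (\<eta> * real b)" .
      qed
    qed
  qed
  then show ?thesis using M0 by (auto simp: decoup_exp_def)
qed

lemma decoup_exp_mono:
  assumes "decoup_exp p k \<eta>" "\<eta> \<le> \<eta>'" "p > 1"
  shows "decoup_exp p k \<eta>'"
proof -
  obtain C where C: "C > 0" "\<And>b. decoup p k b (C * real p powr (\<eta> * real b))"
    using assms by (auto simp: decoup_exp_def)
  have "decoup p k b (C * real p powr (\<eta>' * real b))" for b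
    using C assms by (intro decoup_mono[OF C(2)] mult_left_mono powr_mono mult_right_mono) auto
  then show ?thesis using C by (auto simp: decoup_exp_def)
qed

text \<open>From the trivial exponent \<open>tri k\<close>, each round subtracts \<tau>. As \<tau>
  stays the same as long as the exponent is at least \<open>\<eta>0\<close>, finitely many rounds
  reach \<open>\<eta>0\<close>.\<close>

lemma decoup_exp_step:
  assumes p: "prime p" "k < p" and k: "2 \<le> k" and \<eta>0: "\<eta>0 > 0"
    and El: "\<And>l \<epsilon>. 1 \<le> l \<Longrightarrow> l < k \<Longrightarrow> \<epsilon> > 0 \<Longrightarrow> decoup_exp p l \<epsilon>"
  shows "decoup_exp p k \<eta>0"
proof -
  have p1: "p > 1" using p prime_gt_1_nat by simp
  from bilinear_exp_bound[OF p k \<eta>0 El] obtain \<tau> where \<tau>: "\<tau> > 0" and bb: "\<And>\<eta>. \<eta> \<ge> \<eta>0 \<Longrightarrow> decoup_exp p k \<eta> \<Longrightarrow> (\<exists>C>0. \<exists>Q\<ge>1. \<forall>b\<ge>Q. \<forall>\<gamma> A S N i i'. hyp p k b \<gamma> A S N \<longrightarrow> \<not> int p dvd i - i' \<longrightarrow>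
      mean (phases k \<gamma> (p ^ (k * b))) (\<lambda>u. norm (es A (S \<inter> cls (int p) i) u) ^ 2 *
        norm (es A (S \<inter> cls (int p) i') u) ^ (2 * (tri k - 1)))
      \<le> C * real p powr ((\<eta> - \<tau>) * real b) * (ssum p b N 1 i * ssum p b N 1 i' ^ (tri k - 1)))"
    by blast
  have step: "decoup_exp p k (max \<eta>0 (\<eta> - \<tau>))" if \<eta>: "\<eta> \<ge> \<eta>0" "decoup_exp p k \<eta>" for \<eta>
  proof -
    obtain C Q where C: "C > 0" "Q \<ge> 1" and bl: "\<And>b \<gamma> A S N i i'. b \<ge> Q \<Longrightarrow> hyp p k b \<gamma> A S N \<Longrightarrow> \<not> int p dvd i - i' \<Longrightarrow>
      mean (phases k \<gamma> (p ^ (k * b))) (\<lambda>u. norm (es A (S \<inter> cls (int p) i) u) ^ 2 *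
        norm (es A (S \<inter> cls (int p) i') u) ^ (2 * (tri k - 1)))
      \<le> C * real p powr ((\<eta> - \<tau>) * real b) * (ssum p b N 1 i * ssum p b N 1 i' ^ (tri k - 1))"
      using bb[OF \<eta>] by blast
    show ?thesis
    proof (rule decoup_exp_from_bilinear[OF p k _ C])
      fix b \<gamma> A S N and i i' :: int assume h: "b \<ge> Q" "hyp p k b \<gamma> A S N" "\<not> int p dvd i - i'"
      have "mean (phases k \<gamma> (p ^ (k * b))) (\<lambda>u. norm (es A (S \<inter> cls (int p) i) u) ^ 2 *
        norm (es A (S \<inter> cls (int p) i') u) ^ (2 * (tri k - 1)))
      \<le> C * real p powr ((\<eta> - \<tau>) * real b) * (ssum p b N 1 i * ssum p b N 1 i' ^ (tri k - 1))"
        by (rule bl[OF h])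
      also have "\<dots> \<le> C * real p powr (max \<eta>0 (\<eta> - \<tau>) * real b) * (ssum p b N 1 i * ssum p b N 1 i' ^ (tri k - 1))"
        using C p1 h(2)
        by (intro mult_right_mono mult_left_mono powr_mono) (auto simp: hyp_def intro!: mult_nonneg_nonneg zero_le_power ssum_nonneg)
      finally show "mean (phases k \<gamma> (p ^ (k * b))) (\<lambda>u. norm (es A (S \<inter> cls (int p) i) u) ^ 2 *
        norm (es A (S \<inter> cls (int p) i') u) ^ (2 * (tri k - 1)))
      \<le> C * real p powr (max \<eta>0 (\<eta> - \<tau>) * real b) * (ssum p b N 1 i * ssum p b N 1 i' ^ (tri k - 1))" .
    qed (use \<eta>0 in auto)
  qed
  have it: "decoup_exp p k (max \<eta>0 (real (tri k) - real m * \<tau>))" for m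
  proof (induction m)
    case 0
    show ?case by (rule decoup_exp_mono[OF decoup_exp_trivial[OF p(1)]]) (use k p1 in auto)
  next
    case (Suc m)
    have "decoup_exp p k (max \<eta>0 (max \<eta>0 (real (tri k) - real m * \<tau>) - \<tau>))" by (rule step[OF _ Suc]) simp
    then show ?case using \<tau> by (rule_tac decoup_exp_mono[OF _ _ p1]) (auto simp: algebra_simps)
  qed
  obtain m where "real m * \<tau> > real (tri k)" using reals_Archimedean3[OF \<tau>] by blast
  then show ?thesis using it[of m] \<eta>0 by simp
qed

text \<open>Strong induction, since the bilinear iteration in dimension \<open>k\<close> decouples
  the first factor in every smaller dimension; orthogonality starts it.\<close>

theorem decoupling:
  assumes p: "prime p" "k < p" and k: "1 \<le> k" and \<epsilon>: "\<epsilon> > 0"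
  shows "decoup_exp p k \<epsilon>"
  using k p(2) \<epsilon>
proof (induction k arbitrary: \<epsilon> rule: less_induct)
  case (less k)
  show ?case
  proof (cases "k = 1")
    case True
    have p1: "real p > 1" using p prime_gt_1_nat by simp
    have "decoup p 1 b (1 * real p powr (\<epsilon> * real b))" for b
      using less.prems p1 by (intro decoup_mono[OF decoup_1[OF p(1)]]) (auto intro!: ge_one_powr_ge_zero)
    then show ?thesis unfolding True decoup_exp_def by (intro exI[of _ 1]) auto
  next
    case False
    show ?thesis by (rule decoup_exp_step[OF p(1)]) (use less False in auto)
  qed
qed

section \<open>Mean values\<close>

definition expo :: "nat \<Rightarrow> nat \<Rightarrow> nat \<Rightarrow> nat" where
  "expo r d j = (if j = r then d else j)"

text \<open>Chosen just above the largest possible value of a power sum of \<open>tri r\<close>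
  numbers in [0, N]: two such sums that agree modulo this number are equal, so the mean over the
  grid counts integer solutions exactly. At the same time a grid step is short enough for the phase
  to vary by at most a constant for n up to N.\<close>

definition modl :: "nat \<Rightarrow> nat \<Rightarrow> nat \<Rightarrow> nat \<Rightarrow> nat" where
  "modl r d N j = tri r * N ^ expo r d j + 1"

definition grid :: "nat \<Rightarrow> nat \<Rightarrow> nat \<Rightarrow> (nat \<Rightarrow> int) set" where
  "grid r d N = PiE {1..r} (\<lambda>j. {0..<int (modl r d N j)})"

definition gchar :: "nat \<Rightarrow> nat \<Rightarrow> nat \<Rightarrow> (nat \<Rightarrow> int) \<Rightarrow> int \<Rightarrow> complex" where
  "gchar r d N g n = e (\<Sum>j=1..r. real_of_int (g j * n ^ expo r d j) / real (modl r d N j))"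

lemma modl_pos: "modl r d N j > 0"
  by (simp add: modl_def)

lemma finite_grid: "finite (grid r d N)"
  unfolding grid_def by (intro finite_PiE) auto

lemma card_grid: "card (grid r d N) = (\<Prod>j=1..r. modl r d N j)"
  unfolding grid_def by (subst card_PiE) auto

lemma grid_ne: "grid r d N \<noteq> {}"
  unfolding grid_def PiE_eq_empty_iff by (auto simp: modl_pos)

lemma norm_power_expand:
  fixes z :: "'a \<Rightarrow> complex"
  assumes "finite S"
  shows "of_real (norm (\<Sum>n\<in>S. z n) ^ (2 * s)) =
    (\<Sum>f\<in>PiE {..<s} (\<lambda>_. S). \<Sum>h\<in>PiE {..<s} (\<lambda>_. S). (\<Prod>i<s. z (f i)) * cnj (\<Prod>i<s. z (h i)))"
proof -
  have pw: "(\<Sum>n\<in>S. z n) ^ s = (\<Sum>f\<in>PiE {..<s} (\<lambda>_. S). \<Prod>i<s. z (f i))"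
    using prod_sum_PiE[of "{..<s}" "\<lambda>_. S" "\<lambda>_ n. z n"] assms by simp
  have "of_real (norm (\<Sum>n\<in>S. z n) ^ (2 * s)) = (\<Sum>n\<in>S. z n) ^ s * cnj ((\<Sum>n\<in>S. z n) ^ s)"
  proof -
    have "of_real (norm (\<Sum>n\<in>S. z n) ^ (2 * s)) = (of_real ((norm (\<Sum>n\<in>S. z n))\<^sup>2) :: complex) ^ s"
      by (simp add: power_mult)
    then show ?thesis by (simp only: complex_norm_square power_mult_distrib complex_cnj_power)
  qed
  then show ?thesis unfolding pw by (simp only: cnj_sum sum_product)
qed

lemma sum_swap3:
  fixes F :: "'x \<Rightarrow> 'f \<Rightarrow> 'h \<Rightarrow> 'z::comm_monoid_add"
  shows "(\<Sum>x\<in>X. \<Sum>f\<in>A. \<Sum>h\<in>B. F x f h) = (\<Sum>f\<in>A. \<Sum>h\<in>B. \<Sum>x\<in>X. F x f h)"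
proof -
  have "(\<Sum>x\<in>X. \<Sum>f\<in>A. \<Sum>h\<in>B. F x f h) = (\<Sum>f\<in>A. \<Sum>x\<in>X. \<Sum>h\<in>B. F x f h)" by (rule sum.swap)
  also have "\<dots> = (\<Sum>f\<in>A. \<Sum>h\<in>B. \<Sum>x\<in>X. F x f h)" by (intro sum.cong refl sum.swap)
  finally show ?thesis .
qed

lemma mean_counts:
  fixes ch :: "'x \<Rightarrow> 'a \<Rightarrow> complex"
  assumes S: "finite S" and X: "finite X" "X \<noteq> {}"
    and det: "\<And>f h. f \<in> PiE {..<s} (\<lambda>_. S) \<Longrightarrow> h \<in> PiE {..<s} (\<lambda>_. S) \<Longrightarrow>
      (\<Sum>x\<in>X. (\<Prod>i<s. ch x (f i)) * cnj (\<Prod>i<s. ch x (h i))) = (if P f h then of_nat (card X) else 0)"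
  shows "mean X (\<lambda>x. norm (\<Sum>n\<in>S. ch x n) ^ (2 * s)) =
     (\<Sum>f\<in>PiE {..<s} (\<lambda>_. S). \<Sum>h\<in>PiE {..<s} (\<lambda>_. S). if P f h then 1 else 0)"
proof -
  have c: "real (card X) > 0" using X by (simp add: card_gt_0_iff)
  have "(of_real (\<Sum>x\<in>X. norm (\<Sum>n\<in>S. ch x n) ^ (2 * s)) :: complex) =
     (\<Sum>f\<in>PiE {..<s} (\<lambda>_. S). \<Sum>h\<in>PiE {..<s} (\<lambda>_. S). if P f h then of_nat (card X) else 0)"
    unfolding of_real_sum norm_power_expand[OF S]
    by (subst sum_swap3, intro sum.cong refl det)
  also have "\<dots> = of_real (\<Sum>f\<in>PiE {..<s} (\<lambda>_. S). \<Sum>h\<in>PiE {..<s} (\<lambda>_. S). if P f h then real (card X) else 0)"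
    by (simp add: if_distrib cong: if_cong)
  finally have "(\<Sum>x\<in>X. norm (\<Sum>n\<in>S. ch x n) ^ (2 * s)) =
     (\<Sum>f\<in>PiE {..<s} (\<lambda>_. S). \<Sum>h\<in>PiE {..<s} (\<lambda>_. S). if P f h then real (card X) else 0)"
    by (simp only: of_real_eq_iff)
  also have "\<dots> = (\<Sum>f\<in>PiE {..<s} (\<lambda>_. S). \<Sum>h\<in>PiE {..<s} (\<lambda>_. S). if P f h then 1 else 0) * real (card X)"
    unfolding sum_distrib_right by (intro sum.cong refl) auto
  finally show ?thesis using c by (simp add: mean_def)
qed

text \<open>The product is itself multiplicative in \<open>u\<close>, so its sum over the group is
  either the full cardinality or zero.\<close>

lemma char_group_detects:
  assumes U: "char_group U"
  shows "(\<Sum>u\<in>U. (\<Prod>i<s. u (f i)) * cnj (\<Prod>i<s. u (h i))) =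
    (if \<forall>u\<in>U. (\<Prod>i<s. u (f i)) = (\<Prod>i<s. u (h i)) then of_nat (card U) else 0)"
proof -
  define W where "W u = (\<Prod>i<s. u (f i)) * cnj (\<Prod>i<s. u (h i))" for u :: "int \<Rightarrow> complex"
  have n1: "cnj (\<Prod>i<s. u (h i)) * (\<Prod>i<s. u (h i)) = 1" if "u \<in> U" for u
  proof -
    have "norm (\<Prod>i<s. u (h i)) = 1" using char_groupD(3)[OF U that] by (simp add: prod_norm[symmetric])
    then show ?thesis using complex_norm_square[of "\<Prod>i<s. u (h i)"] by (simp add: mult.commute)
  qed
  have W1: "W u = 1 \<longleftrightarrow> (\<Prod>i<s. u (f i)) = (\<Prod>i<s. u (h i))" if "u \<in> U" for u
  proof
    assume "W u = 1"
    then have "(\<Prod>i<s. u (f i)) * (cnj (\<Prod>i<s. u (h i)) * (\<Prod>i<s. u (h i))) = (\<Prod>i<s. u (h i))"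
      by (simp add: W_def mult.assoc[symmetric])
    then show "(\<Prod>i<s. u (f i)) = (\<Prod>i<s. u (h i))" by (simp only: n1[OF that] mult_1_right)
  next
    assume "(\<Prod>i<s. u (f i)) = (\<Prod>i<s. u (h i))"
    then show "W u = 1" using n1[OF that] by (simp add: W_def mult.commute)
  qed
  show ?thesis
  proof (cases "\<forall>u\<in>U. (\<Prod>i<s. u (f i)) = (\<Prod>i<s. u (h i))")
    case True
    then have "(\<Sum>u\<in>U. W u) = of_nat (card U)" using W1 by simp
    then show ?thesis unfolding if_P[OF True] W_def .
  next
    case False
    then obtain v where v: "v \<in> U" "W v \<noteq> 1" using W1 by blast
    have "(\<Sum>u\<in>U. W u) = (\<Sum>u\<in>U. W (\<lambda>n. u n * v n))" using sum_shift[OF U v(1), of W] by simp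
    also have "\<dots> = W v * (\<Sum>u\<in>U. W u)" by (simp add: W_def prod.distrib sum_distrib_left mult_ac)
    finally have "(1 - W v) * (\<Sum>u\<in>U. W u) = 0" by (simp add: algebra_simps)
    then have "(\<Sum>u\<in>U. W u) = 0" using v by simp
    then show ?thesis unfolding if_not_P[OF False] W_def .
  qed
qed

lemma sum_e_int:
  assumes q: "q > 0"
  shows "(\<Sum>a\<in>{0..<int q}. e (real_of_int (a * \<Delta>) / real q)) = (if int q dvd \<Delta> then of_nat q else 0)"
proof (cases "int q dvd \<Delta>")
  case True
  then have "e (real_of_int (a * \<Delta>) / real q) = 1" for a
    using e_div_cong[of q "a * \<Delta>" 0] q by simp
  then show ?thesis using True by simp
next
  case False
  define z where "z = e (real_of_int \<Delta> / real q)"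
  have z1: "z \<noteq> 1"
  proof
    assume "z = 1"
    then obtain c where "real_of_int \<Delta> / real q = of_int c" by (auto simp: z_def e_eq_1_iff elim!: Ints_cases)
    then have "real_of_int \<Delta> = real_of_int (c * int q)" using q by (simp add: field_simps)
    then show False using False by (simp only: of_int_eq_iff) simp
  qed
  have pw: "e (real k * x) = e x ^ k" for k x
    by (induction k) (simp_all add: distrib_right e_add)
  have "(\<Sum>a\<in>{0..<int q}. e (real_of_int (a * \<Delta>) / real q)) = (\<Sum>k<q. e (real_of_int (int k * \<Delta>) / real q))"
    by (rule sum.reindex_bij_witness[of _ int nat]) auto
  also have "\<dots> = (\<Sum>k<q. z ^ k)"
    by (intro sum.cong refl) (simp add: z_def pw[symmetric] mult.commute)
  also have "\<dots> = (z ^ q - 1) / (z - 1)" using z1 by (rule geometric_sum)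
  also have "z ^ q = 1" using q by (simp add: z_def pw[symmetric])
  finally show ?thesis using False by simp
qed

lemma e_sum: "e (\<Sum>i\<in>I. f i) = (\<Prod>i\<in>I. e (f i))"
  by (induction I rule: infinite_finite_induct) (auto simp: e_add)

lemma grid_detects:
  assumes f: "f \<in> PiE {..<s} (\<lambda>_. S)" and h: "h \<in> PiE {..<s} (\<lambda>_. S)" and S: "S \<subseteq> {0..int N}" and s: "s = tri r"
  shows "(\<Sum>g\<in>grid r d N. (\<Prod>i<s. gchar r d N g (f i)) * cnj (\<Prod>i<s. gchar r d N g (h i))) =
     (if \<forall>j\<in>{1..r}. (\<Sum>i<s. f i ^ expo r d j) = (\<Sum>i<s. h i ^ expo r d j) then of_nat (card (grid r d N)) else 0)"
proof -
  define \<Delta> where "\<Delta> j = (\<Sum>i<s. f i ^ expo r d j) - (\<Sum>i<s. h i ^ expo r d j)" for j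
  have prod: "(\<Prod>i<s. gchar r d N g (f i)) = e (\<Sum>j=1..r. real_of_int (g j * (\<Sum>i<s. f i ^ expo r d j)) / real (modl r d N j))" for g f
  proof -
    have "(\<Prod>i<s. gchar r d N g (f i)) = e (\<Sum>i<s. \<Sum>j=1..r. real_of_int (g j * f i ^ expo r d j) / real (modl r d N j))"
      by (simp add: gchar_def e_sum)
    also have "(\<Sum>i<s. \<Sum>j=1..r. real_of_int (g j * f i ^ expo r d j) / real (modl r d N j)) =
       (\<Sum>j=1..r. real_of_int (g j * (\<Sum>i<s. f i ^ expo r d j)) / real (modl r d N j))"
      by (subst sum.swap) (simp add: sum_distrib_left sum_divide_distrib)
    finally show ?thesis .
  qed
  have W: "(\<Prod>i<s. gchar r d N g (f i)) * cnj (\<Prod>i<s. gchar r d N g (h i)) = (\<Prod>j=1..r. e (real_of_int (g j * \<Delta> j) / real (modl r d N j)))" for g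
    unfolding prod e_minus[symmetric] e_add[symmetric] e_sum[symmetric]
    by (simp add: \<Delta>_def right_diff_distrib diff_divide_distrib sum_subtractf)
  have bd: "\<bar>\<Delta> j\<bar> < int (modl r d N j)" if j: "j \<in> {1..r}" for j
  proof -
    have b: "0 \<le> (\<Sum>i<s. k i ^ expo r d j)" "(\<Sum>i<s. k i ^ expo r d j) \<le> int (tri r * N ^ expo r d j)"
      if "k \<in> PiE {..<s} (\<lambda>_. S)" for k
    proof -
      have k: "k i \<in> {0..int N}" if "i < s" for i using \<open>k \<in> _\<close> S that by (auto simp: PiE_def Pi_def)
      show "0 \<le> (\<Sum>i<s. k i ^ expo r d j)" using k by (intro sum_nonneg) auto
      have "(\<Sum>i<s. k i ^ expo r d j) \<le> (\<Sum>i<s. int N ^ expo r d j)"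
        using k by (intro sum_mono power_mono) auto
      then show "(\<Sum>i<s. k i ^ expo r d j) \<le> int (tri r * N ^ expo r d j)" by (simp add: s)
    qed
    show ?thesis using b[OF f] b[OF h] by (simp add: \<Delta>_def modl_def)
  qed
  have dv: "int (modl r d N j) dvd \<Delta> j \<longleftrightarrow> \<Delta> j = 0" if "j \<in> {1..r}" for j
    using bd[OF that] by (metis dvd_0_right dvd_imp_le_int abs_of_nat not_le)
  have "(\<Sum>g\<in>grid r d N. (\<Prod>i<s. gchar r d N g (f i)) * cnj (\<Prod>i<s. gchar r d N g (h i))) =
      (\<Prod>j=1..r. \<Sum>a\<in>{0..<int (modl r d N j)}. e (real_of_int (a * \<Delta> j) / real (modl r d N j)))"
    unfolding W grid_def by (subst prod_sum_PiE) auto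
  also have "\<dots> = (\<Prod>j=1..r. if \<Delta> j = 0 then of_nat (modl r d N j) else 0)"
    by (intro prod.cong refl) (simp only: sum_e_int[OF modl_pos] dv)
  also have "\<dots> = (if \<forall>j\<in>{1..r}. \<Delta> j = 0 then of_nat (card (grid r d N)) else 0)"
    by (auto simp: card_grid intro: prod.cong)
  finally show ?thesis by (simp add: \<Delta>_def)
qed

text \<open>Both moments count pairs \<open>(f, h)\<close>, and by \<open>imp\<close> every pair
  counted on the left is counted on the right. This passage from the integers to characters modulo a
  power of \<open>p\<close> relies on all coefficients being 1.\<close>

lemma grid_mean_le_group_mean:
  assumes S: "finite S" "S \<subseteq> {0..int N}" and U: "char_group U"
    and imp: "\<And>f h u. f \<in> PiE {..<tri r} (\<lambda>_. S) \<Longrightarrow> h \<in> PiE {..<tri r} (\<lambda>_. S) \<Longrightarrow>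
       \<forall>j\<in>{1..r}. (\<Sum>i<tri r. f i ^ expo r d j) = (\<Sum>i<tri r. h i ^ expo r d j) \<Longrightarrow> u \<in> U \<Longrightarrow>
       (\<Prod>i<tri r. u (\<sigma> (f i))) = (\<Prod>i<tri r. u (\<sigma> (h i)))"
  shows "mean (grid r d N) (\<lambda>g. norm (\<Sum>n\<in>S. gchar r d N g n) ^ (2 * tri r)) \<le>
         mean U (\<lambda>u. norm (\<Sum>n\<in>S. u (\<sigma> n)) ^ (2 * tri r))"
proof -
  let ?F = "PiE {..<tri r} (\<lambda>_. S)"
  have "mean (grid r d N) (\<lambda>g. norm (\<Sum>n\<in>S. gchar r d N g n) ^ (2 * tri r)) =
     (\<Sum>f\<in>?F. \<Sum>h\<in>?F. if \<forall>j\<in>{1..r}. (\<Sum>i<tri r. f i ^ expo r d j) = (\<Sum>i<tri r. h i ^ expo r d j) then 1 else 0)"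
    by (rule mean_counts[OF S(1) finite_grid grid_ne grid_detects[OF _ _ S(2)]]) auto
  also have "\<dots> \<le> (\<Sum>f\<in>?F. \<Sum>h\<in>?F. if \<forall>u\<in>U. (\<Prod>i<tri r. u (\<sigma> (f i))) = (\<Prod>i<tri r. u (\<sigma> (h i))) then 1 else 0)"
  proof (intro sum_mono)
    fix f h assume fh: "f \<in> ?F" "h \<in> ?F"
    have if_le: "(if A then 1 else 0) \<le> (if B then 1 else (0::real))" if "A \<longrightarrow> B" for A B
      using that by auto
    show "(if \<forall>j\<in>{1..r}. (\<Sum>i<tri r. f i ^ expo r d j) = (\<Sum>i<tri r. h i ^ expo r d j) then 1 else 0)
      \<le> (if \<forall>u\<in>U. (\<Prod>i<tri r. u (\<sigma> (f i))) = (\<Prod>i<tri r. u (\<sigma> (h i))) then 1 else (0::real))"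
      by (rule if_le, rule impI, rule ballI, rule imp[OF fh])
  qed
  also have "\<dots> = mean U (\<lambda>u. norm (\<Sum>n\<in>S. u (\<sigma> n)) ^ (2 * tri r))"
    by (rule mean_counts[symmetric, OF S(1) char_groupD(1,2)[OF U]])
       (rule char_group_detects[OF U, of "\<lambda>i. \<sigma> (_ i)" _ "\<lambda>i. \<sigma> (_ i)"])
  finally show ?thesis .
qed

lemma jet_monom:
  "jet i s (monom 1 d) = (if s \<le> d then int (d choose s) * i ^ (d - s) else 0)"
proof -
  have "pcompose (monom 1 d) [:i, 1:] = [:i, 1:] ^ d"
    by (induction d) (simp_all add: monom_Suc pcompose_pCons monom_0 one_pCons)
  then show ?thesis
    by (auto simp: jet_def coeff_linear_poly_power degree_linear_power intro!: coeff_eq_0)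
qed

text \<open>The monomial t^d provides the jet of order \<open>r\<close>: its value (d choose r)
  i^(d-r) is a unit modulo \<open>p\<close>, because \<open>d < p\<close> and \<open>i\<close> is
  not divisible by \<open>p\<close>. Orders below \<open>r\<close> are then corrected by a
  polynomial in t - i of degree less than \<open>r\<close>.\<close>

lemma mon_jets_surj:
  assumes p: "prime p" "d < p" and r: "1 \<le> r" "r \<le> d" and i: "\<not> int p dvd i"
  shows "\<exists>w. \<forall>s\<in>{1..r}. int p ^ K dvd jet i s (lin r (\<lambda>j. monom 1 (expo r d j)) w) - v s"
proof -
  define mon where "mon = (\<lambda>j. monom 1 (expo r d j) :: int poly)"
  have pp: "prime (int p)" using p by simp
  have "\<exists>w. \<forall>s\<in>{1..r}. int p ^ K dvd jet i s (lin r mon w) - v s"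
  proof (rule lift_surj_mod[where L = "\<lambda>s w. jet i s (lin r mon w)"])
    fix s w w' c
    show "jet i s (lin r mon (\<lambda>j. w j + c * w' j)) = jet i s (lin r mon w) + c * jet i s (lin r mon w')"
      by (simp add: jet_lin distrib_right sum.distrib sum_distrib_left mult.assoc)
  next
    fix v :: "nat \<Rightarrow> int"
    have "\<not> int p dvd int (d choose r)"
    proof
      assume "int p dvd int (d choose r)"
      then have "p dvd (d choose r)" by simp
      moreover have "fact r * fact (d - r) * (d choose r) = (fact d :: nat)" using r by (intro binomial_fact_lemma) 
      ultimately have "p dvd fact d" by (metis dvd_mult)
      then show False using p by (simp add: prime_dvd_fact_iff)
    qed
    moreover have "\<not> int p dvd i ^ (d - r)" using pp i prime_dvd_power by blast
    ultimately have "\<not> int p dvd jet i r (monom 1 d)" using r pp by (simp add: jet_monom prime_dvd_mult_iff)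
    then obtain c where c: "int p dvd jet i r (monom 1 d) * c - v r" using prime_solve_mod[OF pp] by blast
    define v' where "v' s = v s - c * jet i s (monom 1 d)" for s
    define Q where "Q = (\<Sum>s=1..<r. smult (v' s) ([:- i, 1:] ^ s))"
    have "pcompose Q [:i, 1:] = (\<Sum>s=1..<r. monom (v' s) s)"
      unfolding Q_def pcompose_sum pcompose_smult pcompose_power
      by (intro sum.cong refl) (simp add: pcompose_pCons monom_altdef)
    then have jQ: "jet i s Q = (if s \<in> {1..<r} then v' s else 0)" for s
      by (simp add: jet_def coeff_sum coeff_monom)
    have degQ: "coeff Q s = 0" if "s \<ge> r" for s
    proof -
      have "degree Q \<le> r - 1" unfolding Q_def
        by (intro degree_sum_le) (auto intro: order.trans[OF degree_smult_le] simp: degree_linear_power)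
      then show ?thesis using that r by (intro coeff_eq_0) simp
    qed
    define w where "w j = (if j = r then c else coeff Q j)" for j
    have L: "lin r mon w = (Q - [:coeff Q 0:]) + smult c (monom 1 d)"
    proof -
      have "lin r mon w = (\<Sum>j=1..<r. smult (coeff Q j) (monom 1 j)) + smult c (monom 1 d)"
      proof -
        have "{1..r} = insert r {1..<r}" using r by auto
        then show ?thesis unfolding lin_def by (simp add: w_def mon_def expo_def add.commute)
      qed
      also have "(\<Sum>j=1..<r. smult (coeff Q j) (monom 1 j)) = Q - [:coeff Q 0:]"
      proof (rule poly_eqI)
        fix s
        have "coeff (\<Sum>j=1..<r. smult (coeff Q j) (monom 1 j)) s = (if s \<in> {1..<r} then coeff Q s else 0)"
          by (simp add: coeff_sum if_distrib[of "\<lambda>x. _ * x"] cong: if_cong)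
        then show "coeff (\<Sum>j=1..<r. smult (coeff Q j) (monom 1 j)) s = coeff (Q - [:coeff Q 0:]) s"
          using degQ[of s] by (cases s) auto
      qed
      finally show ?thesis .
    qed
    show "\<exists>w. \<forall>s\<in>{1..r}. int p dvd jet i s (lin r mon w) - v s"
    proof (intro exI[of _ w] ballI)
      fix s assume s: "s \<in> {1..r}"
      have "jet i s (Q - [:coeff Q 0:]) = jet i s Q"
        using jet_add[of i s "Q - [:coeff Q 0:]" "[:coeff Q 0:]"] jet_const[of s i "coeff Q 0"] s by simp
      then have "jet i s (lin r mon w) - v s = jet i s Q + c * jet i s (monom 1 d) - v s"
        unfolding L jet_add jet_smult by simp
      also have "int p dvd \<dots>"
        using c s by (cases "s = r") (auto simp: jQ v'_def mult.commute)
      finally show "int p dvd jet i s (lin r mon w) - v s" .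
    qed
  qed
  then show ?thesis by (simp add: mon_def)
qed

text \<open>On a residue class \<open>n = p\<^sup>v (i + p m)\<close> with \<open>p \<nmid> i\<close>, solutions of the system in \<open>n\<close> are solutions of a
  system in \<open>m\<close> given by a good curve modulo any power of \<open>p\<close>.\<close>

lemma mean_value_piece:
  assumes dec: "decoup p r b D" and D: "D \<ge> 0" and p: "prime p" "d < p" and r: "1 \<le> r" "r \<le> d" and i: "\<not> int p dvd i"
    and S: "finite S" "S \<subseteq> {0..int N}" and Sf: "\<And>n. n \<in> S \<Longrightarrow> n = int p ^ v * (i + int p * \<sigma> n)"
    and \<sigma>: "\<And>n. n \<in> S \<Longrightarrow> \<sigma> n \<in> {0..<int p ^ b}"
  shows "mean (grid r d N) (\<lambda>g. norm (\<Sum>n\<in>S. gchar r d N g n) ^ (2 * tri r)) \<le> D * real (card S) ^ tri r"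
proof -
  have p0: "p > 0" using p by (simp add: prime_gt_0_nat)
  have T: "tri r \<ge> 1" using r by (intro tri_pos) auto
  \<comment> \<open>Level \<open>b\<close> needs \<open>r * b\<close> digits, and dividing the
    coordinate \<open>h\<close> by p^h costs up to \<open>r\<close> more.\<close>
  define K where "K = r * b + r"
  define mon where "mon = (\<lambda>j. monom 1 (expo r d j) :: int poly)"
  have "\<forall>h\<in>{1..r}. \<exists>w. \<forall>s\<in>{1..r}. int p ^ K dvd jet i s (lin r mon w) - (if s = h then 1 else 0)"
    unfolding mon_def by (intro ballI mon_jets_surj[OF p r i])
  then obtain w where w: "\<And>h s. h \<in> {1..r} \<Longrightarrow> s \<in> {1..r} \<Longrightarrow> int p ^ K dvd jet i s (lin r mon (w h)) - (if s = h then 1 else 0)"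
    by metis
  define P where "P h = lin r mon (w h)" for h
  have "\<forall>h\<in>{1..r}. \<exists>\<delta>. \<forall>m. int p ^ K dvd poly (P h) (i + int p ^ 1 * m)
      - (poly (P h) i + int p ^ (1 * h) * poly (monom 1 h + smult (int p) \<delta>) m)"
    unfolding P_def by (intro ballI zoom_poly[OF p0 order_refl] w) auto
  then obtain \<delta> where \<delta>: "\<And>h m. h \<in> {1..r} \<Longrightarrow> int p ^ K dvd poly (P h) (i + int p * m)
      - (poly (P h) i + int p ^ h * poly (monom 1 h + smult (int p) (\<delta> h)) m)"
    by (metis power_one_right mult_1)
  define \<gamma> where "\<gamma> h = monom 1 h + smult (int p) (\<delta> h)" for h
  have g: "good p r \<gamma>" by (auto simp: good_def \<gamma>_def)
  define U where "U = phases r \<gamma> (p ^ (r * b))"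
  have q: "p ^ (r * b) > 0" using p0 by simp
  have U: "char_group U" unfolding U_def by (rule char_group_phases[OF q])
  have inj: "inj_on \<sigma> S" by (rule inj_onI) (metis Sf)
  have "mean (grid r d N) (\<lambda>g. norm (\<Sum>n\<in>S. gchar r d N g n) ^ (2 * tri r)) \<le>
         mean U (\<lambda>u. norm (\<Sum>n\<in>S. u (\<sigma> n)) ^ (2 * tri r))"
  proof (rule grid_mean_le_group_mean[OF S U])
    fix f h u assume f: "f \<in> PiE {..<tri r} (\<lambda>_. S)" and h: "h \<in> PiE {..<tri r} (\<lambda>_. S)"
      and eq: "\<forall>j\<in>{1..r}. (\<Sum>i<tri r. f i ^ expo r d j) = (\<Sum>i<tri r. h i ^ expo r d j)" and u: "u \<in> U"
    obtain y :: "nat \<Rightarrow> int" where y: "u = (\<lambda>n. e (real_of_int (\<Sum>j=1..r. y j * poly (\<gamma> j) n) / real (p ^ (r * b))))"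
      using u by (auto simp: U_def phases_def)
    define F where "F k = (\<lambda>t. i + int p * \<sigma> (k t))" for k :: "nat \<Rightarrow> int"
    have sc: "(\<Sum>t<tri r. k t ^ a) = (int p ^ v) ^ a * (\<Sum>t<tri r. F k t ^ a)" if "k \<in> PiE {..<tri r} (\<lambda>_. S)" for k a
    proof -
      have "k t = int p ^ v * F k t" if "t < tri r" for t
        using Sf[of "k t"] \<open>k \<in> _\<close> that by (auto simp: F_def)
      then have "k t ^ a = (int p ^ v) ^ a * F k t ^ a" if "t < tri r" for t
        using that by (metis power_mult_distrib)
      then show ?thesis unfolding sum_distrib_left by (intro sum.cong) auto
    qed
    have eqF: "(\<Sum>t<tri r. F f t ^ expo r d j) = (\<Sum>t<tri r. F h t ^ expo r d j)" if "j \<in> {1..r}" for j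
      using eq that sc[OF f] sc[OF h] p0 by fastforce
    have eqP: "(\<Sum>t<tri r. poly (P a) (F f t)) = (\<Sum>t<tri r. poly (P a) (F h t))" for a
    proof -
      have "(\<Sum>t<tri r. poly (P a) (F k t)) = (\<Sum>j=1..r. w a j * (\<Sum>t<tri r. F k t ^ expo r d j))" for k
        unfolding P_def poly_lin sum_distrib_left by (subst sum.swap) (simp add: mon_def poly_monom)
      then show ?thesis using eqF by simp
    qed
    have dv: "int p ^ (r * b) dvd (\<Sum>t<tri r. poly (\<gamma> a) (\<sigma> (f t))) - (\<Sum>t<tri r. poly (\<gamma> a) (\<sigma> (h t)))" if a: "a \<in> {1..r}" for a
    proof -
      have "int p ^ K dvd (\<Sum>t<tri r. poly (P a) (F k t)) - (\<Sum>t<tri r. poly (P a) i + int p ^ a * poly (\<gamma> a) (\<sigma> (k t)))" for k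
        unfolding sum_subtractf[symmetric] F_def \<gamma>_def by (intro dvd_sum \<delta> a)
      from dvd_diff[OF this[of h] this[of f]]
      have "int p ^ K dvd int p ^ a * ((\<Sum>t<tri r. poly (\<gamma> a) (\<sigma> (f t))) - (\<Sum>t<tri r. poly (\<gamma> a) (\<sigma> (h t))))"
        by (simp add: eqP sum.distrib right_diff_distrib sum_distrib_left)
      moreover have "int p ^ (a + r * b) dvd int p ^ K" using a by (intro le_imp_power_dvd) (auto simp: K_def)
      ultimately have "int p ^ a * int p ^ (r * b) dvd int p ^ a * ((\<Sum>t<tri r. poly (\<gamma> a) (\<sigma> (f t))) - (\<Sum>t<tri r. poly (\<gamma> a) (\<sigma> (h t))))"
        by (metis dvd_trans power_add)
      then show ?thesis using p0 by simp
    qed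
    have pr: "(\<Prod>t<tri r. u (k t)) = e (real_of_int (\<Sum>a=1..r. y a * (\<Sum>t<tri r. poly (\<gamma> a) (k t))) / real (p ^ (r * b)))" for k :: "nat \<Rightarrow> int"
    proof -
      have "(\<Prod>t<tri r. u (k t)) = e (real_of_int (\<Sum>t<tri r. \<Sum>a=1..r. y a * poly (\<gamma> a) (k t)) / real (p ^ (r * b)))"
        by (simp add: y e_sum[symmetric] sum_divide_distrib)
      also have "(\<Sum>t<tri r. \<Sum>a=1..r. y a * poly (\<gamma> a) (k t)) = (\<Sum>a=1..r. y a * (\<Sum>t<tri r. poly (\<gamma> a) (k t)))"
        by (subst sum.swap) (simp add: sum_distrib_left)
      finally show ?thesis .
    qed
    show "(\<Prod>t<tri r. u (\<sigma> (f t))) = (\<Prod>t<tri r. u (\<sigma> (h t)))"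
      unfolding pr
    proof (rule e_div_cong[OF _ q])
      have "int (p ^ (r * b)) dvd (\<Sum>a=1..r. y a * ((\<Sum>t<tri r. poly (\<gamma> a) (\<sigma> (f t))) - (\<Sum>t<tri r. poly (\<gamma> a) (\<sigma> (h t)))))"
        using dv by (intro dvd_sum dvd_mult) simp
      then show "int (p ^ (r * b)) dvd (\<Sum>a=1..r. y a * (\<Sum>t<tri r. poly (\<gamma> a) (\<sigma> (f t)))) -
          (\<Sum>a=1..r. y a * (\<Sum>t<tri r. poly (\<gamma> a) (\<sigma> (h t))))"
        by (simp add: right_diff_distrib sum_subtractf)
    qed
  qed
  also have "\<dots> = mean U (\<lambda>u. norm (es (\<lambda>_. 1) (\<sigma> ` S) u) ^ (2 * tri r))"
    by (intro mean_cong) (simp add: es_def sum.reindex[OF inj])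
  \<comment> \<open>The numbers \<open>\<sigma> n\<close> lie below \<open>p ^ b\<close> and are
    distinct, so each class modulo \<open>p ^ b\<close> holds at most one of them and its norm bound
    is an indicator.\<close>
  also have "\<dots> \<le> D * (\<Sum>j\<in>{0..<int p ^ b}. if j \<in> \<sigma> ` S then 1 else 0) ^ tri r"
    unfolding U_def
  proof (rule decoupD[OF dec g])
    fix j assume j: "j \<in> {0..<int p ^ b}"
    have "\<sigma> ` S \<inter> cls (int p ^ b) j = (if j \<in> \<sigma> ` S then {j} else {})"
    proof -
      have "m = j" if "m \<in> \<sigma> ` S" "int p ^ b dvd m - j" for m
        using that j \<sigma> by (auto simp: mod_eq_dvd_iff[symmetric])
      then show ?thesis by (auto simp: cls_def)
    qed
    then have "norm (es (\<lambda>_. 1) (\<sigma> ` S \<inter> cls (int p ^ b) j) u) ^ (2 * tri r) = (if j \<in> \<sigma> ` S then 1 else 0) ^ tri r"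
      if "u \<in> phases r \<gamma> (p ^ (r * b))" for u
      using char_groupD(3)[OF U] that T by (simp add: es_def U_def power_0_left)
    then have "mean (phases r \<gamma> (p ^ (r * b))) (\<lambda>u. norm (es (\<lambda>_. 1) (\<sigma> ` S \<inter> cls (int p ^ b) j) u) ^ (2 * tri r))
      = mean (phases r \<gamma> (p ^ (r * b))) (\<lambda>u. (if j \<in> \<sigma> ` S then 1 else 0) ^ tri r)"
      by (intro mean_cong)
    also have "\<dots> = (if j \<in> \<sigma> ` S then 1 else 0) ^ tri r"
      using mean_const char_groupD(1,2)[OF U] unfolding U_def by blast
    finally show "mean (phases r \<gamma> (p ^ (r * b))) (\<lambda>u. norm (es (\<lambda>_. 1) (\<sigma> ` S \<inter> cls (int p ^ b) j) u) ^ (2 * tri r))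
      \<le> (if j \<in> \<sigma> ` S then 1 else 0) ^ tri r" by simp
  qed (use S in auto)
  also have "(\<Sum>j\<in>{0..<int p ^ b}. if j \<in> \<sigma> ` S then 1 else 0) = real (card ({0..<int p ^ b} \<inter> \<sigma> ` S))"
    by (simp add: sum.If_cases)
  also have "{0..<int p ^ b} \<inter> \<sigma> ` S = \<sigma> ` S" using \<sigma> by auto
  also have "card (\<sigma> ` S) = card S" by (rule card_image[OF inj])
  finally show ?thesis .
qed

lemma power_le_exp:
  fixes x c :: real
  assumes x: "x > 1" and c: "c > 0"
  shows "\<exists>C>0. \<forall>b::nat. (real b * y) ^ k \<le> C * x powr (c * real b)"
proof (cases "k = 0")
  case True
  then show ?thesis using x c by (intro exI[of _ 1]) (auto intro!: ge_one_powr_ge_zero)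
next
  case False
  define a where "a = c / real k"
  have a: "a > 0" using c False by (simp add: a_def)
  have lx: "ln x > 0" using x by simp
  define M where "M = (\<bar>y\<bar> + 1) / (a * ln x)"
  have M: "M > 0" unfolding M_def using a lx by (intro divide_pos_pos mult_pos_pos) auto
  have "(real b * y) ^ k \<le> M ^ k * x powr (c * real b)" for b :: nat
  proof -
    have "a * ln x * real b \<le> exp (a * ln x * real b)"
      using exp_ge_add_one_self[of "a * ln x * real b"] by linarith
    also have "\<dots> = x powr (a * real b)" using x by (simp add: powr_def mult_ac)
    finally have "real b \<le> x powr (a * real b) / (a * ln x)" using a lx by (simp add: field_simps)
    then have "real b * \<bar>y\<bar> \<le> x powr (a * real b) / (a * ln x) * (\<bar>y\<bar> + 1)"
      using a lx by (intro mult_mono) auto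
    then have "real b * \<bar>y\<bar> \<le> M * x powr (a * real b)" by (simp add: M_def mult_ac)
    then have "(real b * \<bar>y\<bar>) ^ k \<le> (M * x powr (a * real b)) ^ k" by (intro power_mono) auto
    also have "\<dots> = M ^ k * x powr (c * real b)"
      using x False by (simp add: power_mult_distrib powr_power a_def)
    finally have "(real b * \<bar>y\<bar>) ^ k \<le> M ^ k * x powr (c * real b)" .
    moreover have "(real b * y) ^ k \<le> (real b * \<bar>y\<bar>) ^ k"
      using power_abs[of "real b * y" k] abs_ge_self[of "(real b * y) ^ k"] by (simp add: abs_mult)
    ultimately show ?thesis by linarith
  qed
  then show ?thesis using M by (intro exI[of _ "M ^ k"]) auto
qed

text \<open>The integers up to \<open>N\<close> are split by their p-adic valuation and the residue
  of the unit part. There are O(log N) pieces; a power of their number is lost, which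
  \<open>N powr \<epsilon>\<close> absorbs.\<close>

theorem mean_value:
  assumes r: "1 \<le> r" "r \<le> d" and \<epsilon>: "\<epsilon> > 0"
  shows "\<exists>C>0. \<forall>N\<ge>1. \<forall>S\<subseteq>{1..int N}. mean (grid r d N) (\<lambda>g. norm (\<Sum>n\<in>S. gchar r d N g n) ^ (2 * tri r))
     \<le> C * real N powr \<epsilon> * real (card S) ^ tri r"
proof -
  obtain p where p: "prime p" "d < p" using bigger_prime by blast
  have p1: "real p > 1" "p \<ge> 2" using p prime_gt_1_nat[of p] by auto
  have p0: "p > 0" using p1 by simp
  define T where "T = tri r"
  have T: "T \<ge> 1" using r tri_pos by (simp add: T_def)
  have rp: "r < p" using r p by simp
  have \<epsilon>2: "\<epsilon> / 2 > 0" using \<epsilon> by simp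
  obtain C0 where C0: "C0 > 0" "\<And>b. decoup p r b (C0 * real p powr (\<epsilon> / 2 * real b))"
    using decoupling[OF p(1) rp r(1) \<epsilon>2] by (auto simp: decoup_exp_def)
  obtain C1 where C1: "C1 > 0" "\<And>b::nat. (real b * real p) ^ (2 * T) \<le> C1 * real p powr (\<epsilon> / 2 * real b)"
    using power_le_exp[OF p1(1) \<epsilon>2] by blast
  define C where "C = C1 * C0 * real p powr \<epsilon>"
  have C: "C > 0" using C0 C1 p1 by (simp add: C_def)
  have "mean (grid r d N) (\<lambda>g. norm (\<Sum>n\<in>S. gchar r d N g n) ^ (2 * T))
     \<le> C * real N powr \<epsilon> * real (card S) ^ T" if N: "N \<ge> 1" and S: "S \<subseteq> {1..int N}" for N S
  proof -
    obtain n0 where n0: "p ^ n0 \<le> N" "N < p ^ (n0 + 1)" using ex_power_ivl1[OF p1(2) N] by blast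
    define b where "b = n0 + 1"
    have fS: "finite S" using S finite_subset by blast
    \<comment> \<open>Separating the valuation first is needed because interpolation with the
      monomials 1, ..., r-1, d works only around units.\<close>
    define \<kappa> where "\<kappa> n = (multiplicity (int p) n, (n div int p ^ multiplicity (int p) n) mod int p)" for n
    define I where "I = {..n0} \<times> {1..<int p}"
    have I: "finite I" "real (card I) \<le> real b * real p"
    proof -
      show "finite I" by (simp add: I_def)
      have "card I = (n0 + 1) * (p - 1)" using p0 by (simp add: I_def card_cartesian_product nat_diff_distrib)
      also have "\<dots> \<le> b * p" unfolding b_def by (intro mult_mono) auto
      finally show "real (card I) \<le> real b * real p" by (metis of_nat_le_iff of_nat_mult)
    qed
    have pp: "prime (int p)" using p by simp
    have dec: "\<kappa> n \<in> I \<and> n = int p ^ fst (\<kappa> n) * (snd (\<kappa> n) + int p * ((n div int p ^ fst (\<kappa> n)) div int p)) \<and>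
        (n div int p ^ fst (\<kappa> n)) div int p \<in> {0..<int p ^ b}" if n: "n \<in> S" for n
    proof -
      have n1: "n \<ge> 1" "n \<le> int N" using S n by auto
      define v where "v = multiplicity (int p) n"
      define m where "m = n div int p ^ v"
      have nm: "n = int p ^ v * m" unfolding m_def v_def by (simp add: multiplicity_dvd)
      have ndv: "\<not> int p dvd m"
        unfolding m_def v_def using n1 pp multiplicity_decompose[of n "int p"] p1 by simp
      have m1: "m \<ge> 1" using nm n1 p0 by (metis int_one_le_iff_zero_less zero_less_mult_pos zero_less_power of_nat_0_less_iff)
      have "int p ^ v \<le> int p ^ v * m" using m1 p0 by simp
      then have "int p ^ v < int p ^ (n0 + 1)" using nm n1 n0(2) by (metis le_less_trans of_nat_less_iff of_nat_power order.trans)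
      then have "v \<le> n0" using p1 power_less_imp_less_exp[of "int p" v "n0 + 1"] by simp
      moreover have "m mod int p \<in> {1..<int p}"
      proof -
        have "m mod int p \<noteq> 0" using ndv by (simp add: dvd_eq_mod_eq_0)
        moreover have "0 \<le> m mod int p" "m mod int p < int p" using p0 by simp_all
        ultimately show ?thesis unfolding atLeastLessThan_iff by linarith
      qed
      ultimately have c1: "\<kappa> n \<in> I" by (simp add: \<kappa>_def I_def v_def[symmetric] m_def[symmetric])
      have c2: "n = int p ^ v * (m mod int p + int p * (m div int p))" using nm by simp
      have c3: "m div int p \<in> {0..<int p ^ b}"
      proof -
        have "m div int p \<le> m" using m1 p1 zdiv_mono2[of m 1 "int p"] by simp
        also have "m \<le> int p ^ v * m" using m1 p0 by simp
        also have "\<dots> < int p ^ b" unfolding nm[symmetric] b_def using n1 n0(2) by (metis le_less_trans of_nat_less_iff of_nat_power)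
        finally show ?thesis using m1 p0 by (simp add: pos_imp_zdiv_nonneg_iff)
      qed
      have k: "fst (\<kappa> n) = v" "snd (\<kappa> n) = m mod int p" by (simp_all add: \<kappa>_def v_def m_def)
      show ?thesis unfolding k m_def[symmetric] using c1 c2 c3 by blast
    qed
    define Sx where "Sx x = {n\<in>S. \<kappa> n = x}" for x
    define D where "D = C0 * real p powr (\<epsilon> / 2 * real b)"
    have D: "D \<ge> 0" using C0 by (simp add: D_def)
    obtain t where t: "2 * T = Suc t" using T by (cases "2 * T") auto
    have "mean (grid r d N) (\<lambda>g. norm (\<Sum>n\<in>S. gchar r d N g n) ^ (2 * T)) \<le>
      mean (grid r d N) (\<lambda>g. real (card I) ^ t * (\<Sum>x\<in>I. norm (\<Sum>n\<in>Sx x. gchar r d N g n) ^ (2 * T)))"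
    proof (intro mean_mono)
      fix g
      have "(\<Sum>n\<in>S. gchar r d N g n) = (\<Sum>x\<in>I. \<Sum>n\<in>Sx x. gchar r d N g n)"
        unfolding Sx_def using dec by (intro sum.group[symmetric] fS I) auto
      then show "norm (\<Sum>n\<in>S. gchar r d N g n) ^ (2 * T) \<le> real (card I) ^ t * (\<Sum>x\<in>I. norm (\<Sum>n\<in>Sx x. gchar r d N g n) ^ (2 * T))"
        unfolding t using norm_sum_power_le[OF I(1), of "\<lambda>x. \<Sum>n\<in>Sx x. gchar r d N g n" t] by simp
    qed
    also have "\<dots> = real (card I) ^ t * (\<Sum>x\<in>I. mean (grid r d N) (\<lambda>g. norm (\<Sum>n\<in>Sx x. gchar r d N g n) ^ (2 * T)))"
      by (simp only: mean_cmult mean_sum)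
    also have "\<dots> \<le> real (card I) ^ t * (\<Sum>x\<in>I. D * real (card S) ^ T)"
    proof (intro mult_left_mono sum_mono)
      fix x assume x: "x \<in> I"
      obtain v i where vi: "x = (v, i)" by fastforce
      have "\<not> int p dvd i" using x by (auto simp: I_def vi dest: zdvd_imp_le)
      moreover have "finite (Sx x)" "Sx x \<subseteq> {0..int N}" using fS S by (auto simp: Sx_def)
      moreover have "n = int p ^ v * (i + int p * ((n div int p ^ v) div int p))"
          "(n div int p ^ v) div int p \<in> {0..<int p ^ b}" if "n \<in> Sx x" for n
      proof -
        have n: "n \<in> S" "fst (\<kappa> n) = v" "snd (\<kappa> n) = i" using that by (auto simp: Sx_def vi)
        show "n = int p ^ v * (i + int p * ((n div int p ^ v) div int p))"
          "(n div int p ^ v) div int p \<in> {0..<int p ^ b}" using dec[OF n(1)] unfolding n(2,3) by blast+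
      qed
      ultimately have "mean (grid r d N) (\<lambda>g. norm (\<Sum>n\<in>Sx x. gchar r d N g n) ^ (2 * tri r)) \<le> D * real (card (Sx x)) ^ tri r"
        using mean_value_piece[OF C0(2)[of b, folded D_def] D p r, of i "Sx x" N v "\<lambda>n. (n div int p ^ v) div int p"] by blast
      also have "\<dots> \<le> D * real (card S) ^ tri r"
        using fS by (intro mult_left_mono D power_mono) (auto simp: Sx_def intro!: card_mono)
      finally show "mean (grid r d N) (\<lambda>g. norm (\<Sum>n\<in>Sx x. gchar r d N g n) ^ (2 * T)) \<le> D * real (card S) ^ T"
        by (simp add: T_def)
    qed auto
    also have "\<dots> = real (card I) ^ (2 * T) * (D * real (card S) ^ T)" by (simp add: t)
    also have "\<dots> \<le> (C1 * real p powr (\<epsilon> / 2 * real b)) * (D * real (card S) ^ T)"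
      using I D by (intro mult_right_mono order.trans[OF power_mono C1(2)]) auto
    also have "\<dots> = C1 * C0 * (real p powr (\<epsilon> / 2 * real b) * real p powr (\<epsilon> / 2 * real b)) * real (card S) ^ T"
      by (simp add: D_def mult_ac)
    also have "real p powr (\<epsilon> / 2 * real b) * real p powr (\<epsilon> / 2 * real b) = (real p ^ b) powr \<epsilon>"
      using p1 by (simp add: powr_add[symmetric] powr_realpow[symmetric] powr_powr mult.commute)
    also have "C1 * C0 * (real p ^ b) powr \<epsilon> * real (card S) ^ T \<le> C1 * C0 * (real p * real N) powr \<epsilon> * real (card S) ^ T"
    proof (intro mult_right_mono mult_left_mono powr_mono2)
      have "p ^ b \<le> p * N" using n0 by (simp add: b_def)
      then show "real p ^ b \<le> real p * real N" by (metis of_nat_le_iff of_nat_mult of_nat_power)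
    qed (use \<epsilon> C0 C1 in auto)
    also have "\<dots> = C * real N powr \<epsilon> * real (card S) ^ T"
      by (simp add: C_def powr_mult mult_ac)
    finally show ?thesis .
  qed
  then show ?thesis using C by (auto simp: T_def)
qed

section \<open>Partial summation and dyadic blocks\<close>

text \<open>Summation by parts: a smooth factor costs one plus its total variation, provided all
  partial sums are under control. Hence maximal partial sums occur from here on.\<close>

lemma abel_bound:
  fixes c \<phi> :: "nat \<Rightarrow> complex"
  assumes A: "\<And>k. k \<le> m \<Longrightarrow> norm (\<Sum>n<k. c n) \<le> A" and \<phi>: "norm (\<phi> m) \<le> 1"
  shows "norm (\<Sum>n<m. c n * \<phi> n) \<le> A * (1 + (\<Sum>n<m. norm (\<phi> (Suc n) - \<phi> n)))"
proof -
  have id: "(\<Sum>n<m. c n * \<phi> n) = (\<Sum>n<m. c n) * \<phi> m - (\<Sum>n<m. (\<Sum>k<Suc n. c k) * (\<phi> (Suc n) - \<phi> n))" for m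
    by (induction m) (simp_all add: algebra_simps)
  have A0: "A \<ge> 0" using A[of 0] by simp
  have "norm (\<Sum>n<m. c n * \<phi> n) \<le> norm ((\<Sum>n<m. c n) * \<phi> m) + norm (\<Sum>n<m. (\<Sum>k<Suc n. c k) * (\<phi> (Suc n) - \<phi> n))"
    unfolding id[of m] by (rule norm_triangle_ineq4)
  also have "\<dots> \<le> A * 1 + (\<Sum>n<m. A * norm (\<phi> (Suc n) - \<phi> n))"
  proof (intro add_mono order.trans[OF norm_sum] sum_mono)
    show "norm ((\<Sum>n<m. c n) * \<phi> m) \<le> A * 1"
      unfolding norm_mult using A[of m] \<phi> A0 by (intro mult_mono) auto
    fix n assume "n \<in> {..<m}"
    then show "norm ((\<Sum>k<Suc n. c k) * (\<phi> (Suc n) - \<phi> n)) \<le> A * norm (\<phi> (Suc n) - \<phi> n)"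
      unfolding norm_mult using A[of "Suc n"] by (intro mult_right_mono) auto
  qed
  finally show ?thesis by (simp add: distrib_left sum_distrib_left)
qed

lemma norm_e_diff_le: "norm (e x - e y) \<le> 2 * pi * \<bar>x - y\<bar>"
proof -
  have "e x - e y = e y * (e (x - y) - 1)" using e_add[of y "x - y"] by (simp add: algebra_simps)
  then have "norm (e x - e y) = norm (exp (\<i> * of_real (2 * pi * (x - y))) - 1)"
    by (simp add: norm_mult e_def mult_ac)
  also have "\<dots> \<le> \<bar>2 * pi * (x - y)\<bar>"
    unfolding dist_exp_i_1 using abs_sin_x_le_abs_x[of "2 * pi * (x - y) / 2"] by simp
  finally show ?thesis by (simp add: abs_mult)
qed

text \<open>Binary expansion of the length \<open>m\<close>: a prefix is a disjoint union of at most
  \<open>K + 1\<close> dyadic blocks. The set of blocks does not depend on \<open>m\<close>, so a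
  fixed family of moments controls prefixes of all lengths.\<close>

lemma dyadic_prefix_bound:
  fixes c :: "nat \<Rightarrow> complex"
  assumes B: "\<And>l j. l \<le> K \<Longrightarrow> a * 2 ^ K \<le> j * 2 ^ l \<Longrightarrow> (j + 1) * 2 ^ l \<le> (a + 1) * 2 ^ K \<Longrightarrow>
      norm (\<Sum>n\<in>{j * 2 ^ l..<(j + 1) * 2 ^ l}. c n) \<le> B"
    and m: "m \<le> 2 ^ K"
  shows "norm (\<Sum>n\<in>{a * 2 ^ K..<a * 2 ^ K + m}. c n) \<le> real (K + 1) * B"
  using assms
proof (induction K arbitrary: a m)
  case 0
  have b: "norm (c a) \<le> B" using 0(1)[of 0 a] by simp
  then have "B \<ge> 0" using norm_ge_zero order.trans by blast
  then show ?case using 0(2) b by (cases "m = 0") (auto simp: le_Suc_eq)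
next
  case (Suc K)
  have B0: "B \<ge> 0"
    by (rule order.trans[OF norm_ge_zero Suc.prems(1)[of "Suc K" a, OF order_refl order_refl order_refl]])
  show ?case
  proof (cases "m \<le> 2 ^ K")
    case True
    have "norm (\<Sum>n\<in>{(2 * a) * 2 ^ K..<(2 * a) * 2 ^ K + m}. c n) \<le> real (K + 1) * B"
      by (rule Suc.IH[OF Suc.prems(1) True]) (auto simp: algebra_simps)
    also have "\<dots> \<le> real (Suc K + 1) * B" using B0 by (intro mult_right_mono) auto
    finally show ?thesis by (simp add: mult_ac)
  next
    case False
    define m' where "m' = m - 2 ^ K"
    have m': "m = 2 ^ K + m'" "m' \<le> 2 ^ K" using False Suc.prems(2) by (auto simp: m'_def)
    have h1: "norm (\<Sum>n\<in>{(2 * a + 1) * 2 ^ K..<(2 * a + 1) * 2 ^ K + m'}. c n) \<le> real (K + 1) * B"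
      by (rule Suc.IH[OF Suc.prems(1) m'(2)]) (auto simp: algebra_simps)
    have h2: "norm (\<Sum>n\<in>{(2 * a) * 2 ^ K..<(2 * a + 1) * 2 ^ K}. c n) \<le> B"
      by (rule Suc.prems(1)) (auto simp: algebra_simps)
    have heq: "(\<Sum>n\<in>{a * 2 ^ Suc K..<a * 2 ^ Suc K + m}. c n) =
      (\<Sum>n\<in>{(2 * a) * 2 ^ K..<(2 * a + 1) * 2 ^ K}. c n) + (\<Sum>n\<in>{(2 * a + 1) * 2 ^ K..<(2 * a + 1) * 2 ^ K + m'}. c n)"
    proof -
      have "a * 2 ^ Suc K = (2 * a) * 2 ^ K" "a * 2 ^ Suc K + m = (2 * a + 1) * 2 ^ K + m'"
        by (simp_all add: m'(1) algebra_simps)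
      then show ?thesis by (simp only:) (rule sum.atLeastLessThan_concat[symmetric]; simp)
    qed
    have "norm (\<Sum>n\<in>{a * 2 ^ Suc K..<a * 2 ^ Suc K + m}. c n) \<le> B + real (K + 1) * B"
      unfolding heq by (rule norm_triangle_le, rule add_mono[OF h2 h1])
    then show ?thesis by (simp add: algebra_simps)
  qed
qed

section \<open>Large values\<close>

definition psum :: "nat \<Rightarrow> nat \<Rightarrow> (nat \<Rightarrow> real) \<Rightarrow> nat \<Rightarrow> complex" where
  "psum r d \<theta> m = (\<Sum>n<m. e (\<Sum>j=1..r. \<theta> j * real (n + 1) ^ expo r d j))"

text \<open>The box of side \<open>1 / modl r d N j\<close> containing \<theta>, named by its corner
  in the grid. The reduction modulo \<open>modl\<close> reflects that only \<theta> modulo 1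
  matters.\<close>

definition cell :: "nat \<Rightarrow> nat \<Rightarrow> nat \<Rightarrow> (nat \<Rightarrow> real) \<Rightarrow> nat \<Rightarrow> int" where
  "cell r d N \<theta> = restrict (\<lambda>j. \<lfloor>\<theta> j * real (modl r d N j)\<rfloor> mod int (modl r d N j)) {1..r}"

lemma cell_in_grid: "cell r d N \<theta> \<in> grid r d N"
  unfolding cell_def grid_def by (auto simp: modl_pos)

lemma le_tri: "r \<le> tri r"
  using tri_def[of r] by (cases r) auto

text \<open>Moving \<theta> to the corner of its cell multiplies the n-th term by a phase whose
  total variation is at most 1, up to the factor 2 pi, since the \<open>r\<close> coordinates
  contribute at most \<open>1 / tri r\<close> each.\<close>

lemma psum_cell:
  assumes V: "norm (psum r d \<theta> m) \<ge> V" and m: "m \<le> N" and r: "1 \<le> r"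
  shows "\<exists>k\<le>m. norm (\<Sum>n<k. gchar r d N (cell r d N \<theta>) (int (n + 1))) \<ge> V / (1 + 2 * pi)"
proof -
  define q where "q = modl r d N"
  define \<beta> where "\<beta> j = \<theta> j - real_of_int \<lfloor>\<theta> j * real (q j)\<rfloor> / real (q j)" for j
  \<comment> \<open>The minimum with \<open>N\<close> acts only at \<open>n = m = N\<close>: partial
    summation evaluates the phase one step beyond the last term, where it must stay bounded.\<close>
  define \<psi> where "\<psi> n = (\<Sum>j=1..r. \<beta> j * real (min (n + 1) N) ^ expo r d j)" for n
  define \<phi> where "\<phi> n = e (\<psi> n)" for n
  define c where "c n = gchar r d N (cell r d N \<theta>) (int (n + 1))" for n
  have q0: "real (q j) > 0" for j using modl_pos by (simp add: q_def)
  have \<beta>0: "0 \<le> \<beta> j" and \<beta>1: "\<beta> j \<le> 1 / real (q j)" for j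
  proof -
    define t where "t = \<theta> j * real (q j) - real_of_int \<lfloor>\<theta> j * real (q j)\<rfloor>"
    have t: "0 \<le> t" "t \<le> 1" unfolding t_def by linarith+
    have "\<beta> j = t / real (q j)"
      using q0[of j] by (simp add: \<beta>_def t_def diff_divide_distrib)
    then show "0 \<le> \<beta> j" "\<beta> j \<le> 1 / real (q j)"
      using q0[of j] t by (auto intro!: divide_nonneg_pos divide_right_mono)
  qed
  have split: "e (\<Sum>j=1..r. \<theta> j * real (n + 1) ^ expo r d j) = c n * \<phi> n" if "n < m" for n
  proof -
    have mn: "min (n + 1) N = n + 1" using that m by simp
    have "c n * \<phi> n = e ((\<Sum>j=1..r. real_of_int (cell r d N \<theta> j * int (n + 1) ^ expo r d j) / real (q j)) + \<psi> n)"
      by (simp only: c_def \<phi>_def gchar_def e_add q_def)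
    also have "\<dots> = e (\<Sum>j=1..r. \<theta> j * real (n + 1) ^ expo r d j)"
    proof (rule e_add_int)
      have "(\<Sum>j=1..r. real_of_int (cell r d N \<theta> j * int (n + 1) ^ expo r d j) / real (q j)) + \<psi> n - (\<Sum>j=1..r. \<theta> j * real (n + 1) ^ expo r d j)
        = (\<Sum>j=1..r. real_of_int (- (\<lfloor>\<theta> j * real (q j)\<rfloor> div int (q j)) * int (n + 1) ^ expo r d j))"
        unfolding \<psi>_def mn sum.distrib[symmetric] sum_subtractf[symmetric]
      proof (intro sum.cong refl)
        fix j assume j: "j \<in> {1..r}"
        define f where "f = \<lfloor>\<theta> j * real (q j)\<rfloor>"
        define X where "X = real (n + 1) ^ expo r d j"
        have "f mod int (q j) = f - int (q j) * (f div int (q j))" by (simp add: minus_mult_div_eq_mod)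
        then have cj: "real_of_int (cell r d N \<theta> j) = real_of_int f - real (q j) * real_of_int (f div int (q j))"
          using j by (simp add: cell_def q_def f_def)
        have "real_of_int (cell r d N \<theta> j * int (n + 1) ^ expo r d j) / real (q j) + \<beta> j * X - \<theta> j * X
          = real_of_int (cell r d N \<theta> j) * X / real (q j) - real_of_int f / real (q j) * X"
          by (simp add: \<beta>_def X_def f_def algebra_simps)
        also have "\<dots> = - real_of_int (f div int (q j)) * X"
          unfolding cj using q0[of j] by (simp add: field_simps)
        finally show "real_of_int (cell r d N \<theta> j * int (n + 1) ^ expo r d j) / real (q j) + \<beta> j * real (n + 1) ^ expo r d j - \<theta> j * real (n + 1) ^ expo r d j
          = real_of_int (- (\<lfloor>\<theta> j * real (q j)\<rfloor> div int (q j)) * int (n + 1) ^ expo r d j)"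
          by (simp add: X_def f_def)
      qed
      then show "(\<Sum>j=1..r. real_of_int (cell r d N \<theta> j * int (n + 1) ^ expo r d j) / real (q j)) + \<psi> n - (\<Sum>j=1..r. \<theta> j * real (n + 1) ^ expo r d j) \<in> \<int>"
        by (simp only: of_int_sum[symmetric] Ints_of_int)
    qed
    finally show ?thesis by simp
  qed
  define A where "A = Max ((\<lambda>k. norm (\<Sum>n<k. c n)) ` {..m})"
  have "A \<in> (\<lambda>k. norm (\<Sum>n<k. c n)) ` {..m}"
    unfolding A_def by (intro Max_in) auto
  then obtain k where k: "k \<le> m" "A = norm (\<Sum>n<k. c n)" by auto
  have A: "norm (\<Sum>n<i. c n) \<le> A" if "i \<le> m" for i
    unfolding A_def using that by (intro Max_ge) auto
  have A0: "A \<ge> 0" by (simp add: k(2))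
  have mono: "\<psi> n \<le> \<psi> (Suc n)" for n
    unfolding \<psi>_def by (intro sum_mono mult_left_mono power_mono \<beta>0) auto
  have "(\<Sum>n<m. norm (\<phi> (Suc n) - \<phi> n)) \<le> (\<Sum>n<m. 2 * pi * (\<psi> (Suc n) - \<psi> n))"
  proof (intro sum_mono)
    fix n
    show "norm (\<phi> (Suc n) - \<phi> n) \<le> 2 * pi * (\<psi> (Suc n) - \<psi> n)"
      using norm_e_diff_le[of "\<psi> (Suc n)" "\<psi> n"] mono[of n] by (simp add: \<phi>_def)
  qed
  also have "\<dots> = 2 * pi * (\<psi> m - \<psi> 0)"
    by (simp add: sum_distrib_left[symmetric] sum_lessThan_telescope)
  also have "\<dots> \<le> 2 * pi * 1"
  proof (intro mult_left_mono)
    have "0 \<le> \<psi> 0" unfolding \<psi>_def by (intro sum_nonneg mult_nonneg_nonneg \<beta>0) auto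
    moreover have "\<psi> m \<le> (\<Sum>j=1..r. 1 / real (tri r))"
      unfolding \<psi>_def
    proof (intro sum_mono)
      fix j
      have t: "real (tri r) > 0" using tri_pos[OF r] by simp
      have "\<beta> j * real (min (m + 1) N) ^ expo r d j \<le> 1 / real (q j) * real N ^ expo r d j"
        using \<beta>0 \<beta>1 by (intro mult_mono power_mono) auto
      also have "\<dots> \<le> 1 / real (tri r)"
        using t q0[of j] by (simp add: q_def modl_def field_simps)
      finally show "\<beta> j * real (min (m + 1) N) ^ expo r d j \<le> 1 / real (tri r)" .
    qed
    moreover have "(\<Sum>j=1..r. 1 / real (tri r)) \<le> 1" using le_tri[of r] tri_pos[OF r] by simp
    ultimately show "\<psi> m - \<psi> 0 \<le> 1" by linarith
  qed auto
  finally have var: "(\<Sum>n<m. norm (\<phi> (Suc n) - \<phi> n)) \<le> 2 * pi" by simp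
  have "psum r d \<theta> m = (\<Sum>n<m. c n * \<phi> n)" unfolding psum_def by (intro sum.cong refl split) auto
  then have "V \<le> norm (\<Sum>n<m. c n * \<phi> n)" using V by simp
  also have "\<dots> \<le> A * (1 + (\<Sum>n<m. norm (\<phi> (Suc n) - \<phi> n)))"
    by (rule abel_bound[OF A]) (auto simp: \<phi>_def)
  also have "\<dots> \<le> A * (1 + 2 * pi)" using var A0 by (intro mult_left_mono) auto
  finally have "V / (1 + 2 * pi) \<le> A" using pi_gt_zero by (simp add: pos_divide_le_eq add_pos_pos)
  then show ?thesis using k unfolding c_def by auto
qed

text \<open>Chebyshev's inequality, after the sum up to \<open>k\<close>, whose length depends on
  \<open>g\<close>, has been replaced by the largest dyadic block. The maximum over blocks is
  bounded by the sum over all of them. Level \<open>l\<close> has 2^(K-l) blocks contributing 2^(l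
  T) each, so every level stays below 2^(K T) and only a factor \<open>K + 1\<close> is
  lost.\<close>

lemma grid_large_values:
  assumes r: "1 \<le> r" "r \<le> d" and \<epsilon>: "\<epsilon> > 0"
  shows "\<exists>C>0. \<forall>K \<Theta> V. \<Theta> \<subseteq> grid r d (2 ^ K) \<longrightarrow> 0 < V \<longrightarrow>
     (\<forall>g\<in>\<Theta>. \<exists>k\<le>2 ^ K. norm (\<Sum>n<k. gchar r d (2 ^ K) g (int (n + 1))) \<ge> V) \<longrightarrow>
     real (card \<Theta>) * V ^ (2 * tri r) \<le> C * (2 ^ K) powr \<epsilon> * (2 ^ K) ^ tri r * real (card (grid r d (2 ^ K)))"
proof -
  define T where "T = tri r"
  have T: "T \<ge> 1" using r tri_pos by (simp add: T_def)
  have \<epsilon>2: "\<epsilon> / 2 > 0" using \<epsilon> by simp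
  obtain C0 where C0: "C0 > 0" "\<And>N S. N \<ge> 1 \<Longrightarrow> S \<subseteq> {1..int N} \<Longrightarrow> mean (grid r d N) (\<lambda>g. norm (\<Sum>n\<in>S. gchar r d N g n) ^ (2 * T))
     \<le> C0 * real N powr (\<epsilon> / 2) * real (card S) ^ T"
    using mean_value[OF r \<epsilon>2] unfolding T_def by blast
  obtain C1 where C1: "C1 > 0" "\<And>K::nat. (real K * 1) ^ (2 * T + 1) \<le> C1 * 2 powr (\<epsilon> / 2 * real K)"
    using power_le_exp[of 2 "\<epsilon> / 2" 1 "2 * T + 1"] \<epsilon>2 by auto
  define C where "C = C0 * (C1 * 2 powr (\<epsilon> / 2))"
  have C: "C > 0" using C0 C1 by (simp add: C_def)
  have main: "real (card \<Theta>) * V ^ (2 * T) \<le> C * (2 ^ K) powr \<epsilon> * (2 ^ K) ^ T * real (card (grid r d (2 ^ K)))"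
    if \<Theta>: "\<Theta> \<subseteq> grid r d (2 ^ K)" and V: "0 < V"
     and large: "\<And>g. g \<in> \<Theta> \<Longrightarrow> \<exists>k\<le>2 ^ K. norm (\<Sum>n<k. gchar r d (2 ^ K) g (int (n + 1))) \<ge> V" for K \<Theta> V
  proof -
    define N where "N = (2::nat) ^ K"
    have N1: "N \<ge> 1" by (simp add: N_def)
    define B where "B = (SIGMA l:{..K}. {..<(2::nat) ^ (K - l)})"
    have B: "finite B" by (simp add: B_def)
    define blk where "blk = (\<lambda>(l, j). {j * (2::nat) ^ l..<(j + 1) * 2 ^ l})"
    define X where "X g = (\<Sum>x\<in>B. norm (\<Sum>n\<in>blk x. gchar r d N g (int (n + 1))) ^ (2 * T))" for g
    have V_le: "V ^ (2 * T) \<le> real (K + 1) ^ (2 * T) * X g" if g: "g \<in> \<Theta>" for g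
    proof -
      define M where "M = Max ((\<lambda>x. norm (\<Sum>n\<in>blk x. gchar r d N g (int (n + 1)))) ` B)"
      have "(0, 0) \<in> B" by (simp add: B_def)
      then have Bne: "B \<noteq> {}" by blast
      have "M \<in> (\<lambda>x. norm (\<Sum>n\<in>blk x. gchar r d N g (int (n + 1)))) ` B"
        unfolding M_def using B Bne by (intro Max_in) auto
      then obtain x where x: "x \<in> B" "M = norm (\<Sum>n\<in>blk x. gchar r d N g (int (n + 1)))" by auto
      have "M ^ (2 * T) \<le> X g" unfolding X_def x(2) using B x(1)
        by (intro member_le_sum[where f = "\<lambda>x. norm (\<Sum>n\<in>blk x. gchar r d N g (int (n + 1))) ^ (2 * T)"]) auto
      obtain k where k: "k \<le> 2 ^ K" "norm (\<Sum>n<k. gchar r d N g (int (n + 1))) \<ge> V"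
        using large[OF g] by (auto simp: N_def)
      have "norm (\<Sum>n\<in>{0 * 2 ^ K..<0 * 2 ^ K + k}. gchar r d N g (int (n + 1))) \<le> real (K + 1) * M"
      proof (rule dyadic_prefix_bound[OF _ k(1)])
        fix l j assume l: "l \<le> K" and j: "(j + 1) * 2 ^ l \<le> (0 + 1) * (2::nat) ^ K"
        have "(2::nat) ^ K = 2 ^ (K - l) * 2 ^ l" using l by (simp flip: power_add)
        then have "(j + 1) * 2 ^ l \<le> 2 ^ (K - l) * 2 ^ l" using j by simp
        then have "j + 1 \<le> 2 ^ (K - l)" unfolding mult_le_cancel2 by simp
        then have "j < 2 ^ (K - l)" by simp
        then have "(l, j) \<in> B" using l by (simp add: B_def)
        then have "norm (\<Sum>n\<in>blk (l, j). gchar r d N g (int (n + 1))) \<le> M"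
          unfolding M_def using B by (intro Max_ge) (auto intro!: imageI)
        then show "norm (\<Sum>n\<in>{j * 2 ^ l..<(j + 1) * 2 ^ l}. gchar r d N g (int (n + 1))) \<le> M"
          by (simp add: blk_def)
      qed
      then have "V \<le> real (K + 1) * M" using k(2) by (simp add: lessThan_atLeast0)
      then have "V ^ (2 * T) \<le> (real (K + 1) * M) ^ (2 * T)" using V by (intro power_mono) auto
      also have "\<dots> = real (K + 1) ^ (2 * T) * M ^ (2 * T)" by (simp only: power_mult_distrib)
      also have "\<dots> \<le> real (K + 1) ^ (2 * T) * X g" using \<open>M ^ (2 * T) \<le> X g\<close> by (intro mult_left_mono) auto
      finally show ?thesis .
    qed
    have G: "real (card (grid r d N)) > 0" using finite_grid grid_ne by (simp add: card_gt_0_iff)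
    have block: "(\<Sum>g\<in>grid r d N. norm (\<Sum>n\<in>blk x. gchar r d N g (int (n + 1))) ^ (2 * T))
       \<le> real (card (grid r d N)) * (C0 * real N powr (\<epsilon> / 2) * (2 ^ fst x) ^ T)" if x: "x \<in> B" for x
    proof -
      obtain l j where lj: "x = (l, j)" by fastforce
      have l: "l \<le> K" "j < 2 ^ (K - l)" using x by (auto simp: B_def lj)
      define S where "S = (\<lambda>n. int (n + 1)) ` blk x"
      have inj: "inj_on (\<lambda>n. int (n + 1)) (blk x)" by (auto simp: inj_on_def)
      have "(j + 1) * 2 ^ l \<le> 2 ^ (K - l) * 2 ^ l" using l by (intro mult_right_mono) auto
      also have "\<dots> = N" using l by (simp add: N_def flip: power_add)
      finally have "S \<subseteq> {1..int N}" by (auto simp: S_def blk_def lj)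
      have cS: "card S = 2 ^ l" unfolding S_def card_image[OF inj] by (simp add: blk_def lj)
      have "mean (grid r d N) (\<lambda>g. norm (\<Sum>n\<in>blk x. gchar r d N g (int (n + 1))) ^ (2 * T))
        = mean (grid r d N) (\<lambda>g. norm (\<Sum>n\<in>S. gchar r d N g n) ^ (2 * T))"
        unfolding S_def sum.reindex[OF inj] comp_def ..
      also have "\<dots> \<le> C0 * real N powr (\<epsilon> / 2) * (2 ^ l) ^ T"
        using C0(2)[OF N1 \<open>S \<subseteq> _\<close>] by (simp add: cS)
      finally show ?thesis using G by (simp add: mean_def lj pos_divide_le_eq mult_ac)
    qed
    have "real (card \<Theta>) * V ^ (2 * T) = (\<Sum>g\<in>\<Theta>. V ^ (2 * T))" by simp
    also have "\<dots> \<le> (\<Sum>g\<in>\<Theta>. real (K + 1) ^ (2 * T) * X g)" by (intro sum_mono V_le)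
    also have "\<dots> \<le> (\<Sum>g\<in>grid r d N. real (K + 1) ^ (2 * T) * X g)"
      using \<Theta> finite_grid by (intro sum_mono2) (auto simp: N_def X_def intro!: sum_nonneg mult_nonneg_nonneg)
    also have "\<dots> = real (K + 1) ^ (2 * T) * (\<Sum>x\<in>B. \<Sum>g\<in>grid r d N. norm (\<Sum>n\<in>blk x. gchar r d N g (int (n + 1))) ^ (2 * T))"
      unfolding X_def sum_distrib_left[symmetric] by (subst sum.swap) simp
    also have "\<dots> \<le> real (K + 1) ^ (2 * T) * (\<Sum>x\<in>B. real (card (grid r d N)) * (C0 * real N powr (\<epsilon> / 2) * (2 ^ fst x) ^ T))"
      by (intro mult_left_mono sum_mono block) auto
    also have "\<dots> = real (K + 1) ^ (2 * T) * (real (card (grid r d N)) * (C0 * real N powr (\<epsilon> / 2)) * (\<Sum>x\<in>B. (2 ^ fst x) ^ T))"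
      by (simp add: sum_distrib_left mult_ac)
    also have "\<dots> \<le> real (K + 1) ^ (2 * T) * (real (card (grid r d N)) * (C0 * real N powr (\<epsilon> / 2)) * (real (K + 1) * (2 ^ K) ^ T))"
    proof (intro mult_left_mono)
      have "(\<Sum>x\<in>B. ((2::real) ^ fst x) ^ T) = (\<Sum>l\<le>K. \<Sum>j<(2::nat) ^ (K - l). (2 ^ l) ^ T)"
        unfolding B_def by (subst sum.Sigma) (simp_all add: case_prod_unfold)
      also have "\<dots> \<le> (\<Sum>l\<le>K. (2 ^ K) ^ T)"
      proof (intro sum_mono)
        fix l assume "l \<in> {..K}"
        then have l: "l \<le> K" by simp
        have "(\<Sum>j<(2::nat) ^ (K - l). ((2::real) ^ l) ^ T) = 2 ^ (K - l) * (2 ^ l) ^ T" by simp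
        also have "\<dots> \<le> (2 ^ (K - l)) ^ T * (2 ^ l) ^ T"
          using T by (intro mult_right_mono self_le_power) auto
        also have "\<dots> = (2 ^ (K - l) * 2 ^ l) ^ T" by (simp only: power_mult_distrib)
        also have "(2::real) ^ (K - l) * 2 ^ l = 2 ^ K" using l by (simp flip: power_add)
        finally show "(\<Sum>j<(2::nat) ^ (K - l). ((2::real) ^ l) ^ T) \<le> (2 ^ K) ^ T" .
      qed
      finally show "(\<Sum>x\<in>B. ((2::real) ^ fst x) ^ T) \<le> real (K + 1) * (2 ^ K) ^ T" by simp
    qed (use C0 in auto)
    also have "\<dots> = real (K + 1) ^ (2 * T + 1) * (real (card (grid r d N)) * (C0 * real N powr (\<epsilon> / 2)) * (2 ^ K) ^ T)"
      by simp
    also have "\<dots> \<le> (C1 * 2 powr (\<epsilon> / 2 * real (K + 1))) * (real (card (grid r d N)) * (C0 * real N powr (\<epsilon> / 2)) * (2 ^ K) ^ T)"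
      using C1(2)[of "K + 1"] C0 by (intro mult_right_mono) auto
    also have "2 powr (\<epsilon> / 2 * real (K + 1)) = 2 powr (\<epsilon> / 2) * real N powr (\<epsilon> / 2)"
    proof -
      have "real N = 2 powr real K" by (simp add: N_def powr_realpow)
      then show ?thesis by (simp add: powr_powr powr_add[symmetric] distrib_left add_divide_distrib mult.commute)
    qed
    also have "C1 * (2 powr (\<epsilon> / 2) * real N powr (\<epsilon> / 2)) * (real (card (grid r d N)) * (C0 * real N powr (\<epsilon> / 2)) * (2 ^ K) ^ T)
       = C * (real N powr (\<epsilon> / 2) * real N powr (\<epsilon> / 2)) * (2 ^ K) ^ T * real (card (grid r d N))"
      by (simp add: C_def mult_ac)
    also have "real N powr (\<epsilon> / 2) * real N powr (\<epsilon> / 2) = real N powr \<epsilon>"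
      by (simp add: powr_add[symmetric])
    finally show ?thesis by (simp add: N_def)
  qed
  show ?thesis
    by (intro exI[of _ C] conjI C allI impI) (use main in \<open>simp add: T_def\<close>)
qed

lemma sum_expo: "1 \<le> r \<Longrightarrow> (\<Sum>j=1..r. expo r d j) + r = tri r + d"
proof (induction r rule: nat_induct_at_least)
  case base
  then show ?case by (simp add: expo_def)
next
  case (Suc r)
  have "(\<Sum>j=1..r. j) = tri r" by (induction r) (simp_all add: tri_def)
  moreover have "tri (Suc r) = tri r + Suc r" unfolding tri_def by simp
  ultimately show ?case by (simp add: expo_def)
qed

lemma card_grid_le:
  assumes "N \<ge> 1" "1 \<le> r" "r \<le> d"
  shows "real (card (grid r d N)) \<le> real (tri r + 1) ^ r * real N ^ (tri r + d - r)"
proof -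
  have "real (card (grid r d N)) = (\<Prod>j=1..r. real (modl r d N j))" by (simp add: card_grid)
  also have "\<dots> \<le> (\<Prod>j=1..r. real (tri r + 1) * real N ^ expo r d j)"
  proof (intro prod_mono conjI)
    fix j
    have "1 \<le> real N ^ expo r d j" using assms by (intro one_le_power) auto
    then show "real (modl r d N j) \<le> real (tri r + 1) * real N ^ expo r d j"
      by (simp add: modl_def algebra_simps)
  qed auto
  also have "\<dots> = real (tri r + 1) ^ r * real N ^ (\<Sum>j=1..r. expo r d j)"
    by (simp add: prod.distrib power_sum)
  also have "(\<Sum>j=1..r. expo r d j) = tri r + d - r" using sum_expo[OF assms(2), of d] by simp
  finally show ?thesis .
qed

text \<open>A difference of two prefixes is allowed because translated sums live on intervals that
  do not start at 1.\<close>

theorem large_values: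
  assumes r: "1 \<le> r" "r \<le> d" and \<epsilon>: "\<epsilon> > 0"
  shows "\<exists>C>0. \<forall>K \<Theta> V. 0 < V \<longrightarrow>
     (\<forall>g\<in>\<Theta>. \<exists>\<theta> a b. g = cell r d (2 ^ K) \<theta> \<and> a \<le> b \<and> b \<le> 2 ^ K \<and> norm (psum r d \<theta> b - psum r d \<theta> a) \<ge> V) \<longrightarrow>
     finite \<Theta> \<and> real (card \<Theta>) * V ^ (2 * tri r) \<le> C * (2 ^ K) powr (\<epsilon> + 2 * real (tri r) + real d - real r)"
proof -
  obtain C0 where C0: "C0 > 0" and gl: "\<forall>K \<Theta> V. \<Theta> \<subseteq> grid r d (2 ^ K) \<longrightarrow> 0 < V \<longrightarrow>
     (\<forall>g\<in>\<Theta>. \<exists>k\<le>2 ^ K. norm (\<Sum>n<k. gchar r d (2 ^ K) g (int (n + 1))) \<ge> V) \<longrightarrow>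
     real (card \<Theta>) * V ^ (2 * tri r) \<le> C0 * (2 ^ K) powr \<epsilon> * (2 ^ K) ^ tri r * real (card (grid r d (2 ^ K)))"
    using grid_large_values[OF r \<epsilon>] by (elim exE conjE) (rule that)
  \<comment> \<open>A factor 2 for choosing the larger of the two prefixes, and
    \<open>1 + 2 * pi\<close> for moving to the corner of the cell.\<close>
  define Q where "Q = 2 * (1 + 2 * pi)"
  have Q: "Q > 0" using pi_gt_zero by (simp add: Q_def add_pos_pos)
  define C where "C = C0 * real (tri r + 1) ^ r * Q ^ (2 * tri r)"
  have C: "C > 0" using C0 Q by (simp add: C_def)
  have "finite \<Theta> \<and> real (card \<Theta>) * V ^ (2 * tri r) \<le> C * (2 ^ K) powr (\<epsilon> + 2 * real (tri r) + real d - real r)"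
    if V: "0 < V" and large: "\<forall>g\<in>\<Theta>. \<exists>\<theta> a b. g = cell r d (2 ^ K) \<theta> \<and> a \<le> b \<and> b \<le> 2 ^ K \<and> norm (psum r d \<theta> b - psum r d \<theta> a) \<ge> V"
    for K \<Theta> V
  proof -
    define N where "N = (2::nat) ^ K"
    have sub: "\<Theta> \<subseteq> grid r d (2 ^ K)"
    proof
      fix g assume "g \<in> \<Theta>"
      then obtain \<theta> where "g = cell r d (2 ^ K) \<theta>" using large by blast
      then show "g \<in> grid r d (2 ^ K)" by (simp only: cell_in_grid)
    qed
    have "real (card \<Theta>) * (V / Q) ^ (2 * tri r) \<le> C0 * (2 ^ K) powr \<epsilon> * (2 ^ K) ^ tri r * real (card (grid r d (2 ^ K)))"
    proof (rule gl[rule_format, OF sub])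
      show "0 < V / Q" using V Q by simp
      fix g assume "g \<in> \<Theta>"
      then obtain \<theta> a b where g: "g = cell r d N \<theta>" and ab: "a \<le> b" "b \<le> N" "norm (psum r d \<theta> b - psum r d \<theta> a) \<ge> V"
        using large by (auto simp: N_def)
      have "norm (psum r d \<theta> b) \<ge> V / 2 \<or> norm (psum r d \<theta> a) \<ge> V / 2"
        using ab(3) norm_triangle_ineq4[of "psum r d \<theta> b" "psum r d \<theta> a"] by linarith
      then obtain m where m: "m \<le> N" "norm (psum r d \<theta> m) \<ge> V / 2" using ab by (meson order.trans)
      obtain k where "k \<le> m" "norm (\<Sum>n<k. gchar r d N g (int (n + 1))) \<ge> V / 2 / (1 + 2 * pi)"
        using psum_cell[OF m(2,1) r(1)] unfolding g by blast
      then show "\<exists>k\<le>2 ^ K. norm (\<Sum>n<k. gchar r d (2 ^ K) g (int (n + 1))) \<ge> V / Q"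
        using m(1) by (intro exI[of _ k]) (auto simp: Q_def N_def)
    qed
    then have "real (card \<Theta>) * V ^ (2 * tri r) \<le> Q ^ (2 * tri r) * (C0 * (2 ^ K) powr \<epsilon> * (2 ^ K) ^ tri r * real (card (grid r d (2 ^ K))))"
      using Q by (simp add: power_divide pos_divide_le_eq mult.commute)
    also have "\<dots> \<le> Q ^ (2 * tri r) * (C0 * (2 ^ K) powr \<epsilon> * (2 ^ K) ^ tri r * (real (tri r + 1) ^ r * (2 ^ K) ^ (tri r + d - r)))"
      using card_grid_le[of "2 ^ K" r d] r C0 Q by (intro mult_left_mono) auto
    also have "\<dots> = C * ((2 ^ K) powr \<epsilon> * (2 ^ K) ^ (tri r + (tri r + d - r)))"
      by (simp add: C_def power_add mult_ac)
    also have "(2 ^ K) powr \<epsilon> * (2 ^ K) ^ (tri r + (tri r + d - r)) = (2 ^ K) powr (\<epsilon> + 2 * real (tri r) + real d - real r)"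
      using r le_tri[of r] by (simp add: powr_realpow[symmetric] powr_add[symmetric] of_nat_diff algebra_simps)
    finally show ?thesis using sub finite_grid finite_subset by blast
  qed
  then show ?thesis using C by blast
qed

section \<open>Counting cells through the last coordinate\<close>

definition weyl :: "nat \<Rightarrow> real \<Rightarrow> nat \<Rightarrow> complex" where
  "weyl d x m = (\<Sum>n=1..m. e (x * real n ^ d))"

lemma weyl_alt: "weyl d x m = (\<Sum>n<m. e (x * real (n + 1) ^ d))"
  unfolding weyl_def by (rule sum.reindex_bij_witness[of _ Suc "\<lambda>n. n - 1"]) auto

lemma weyl_psum:
  assumes "1 \<le> r"
  shows "psum r d (\<lambda>j. if j = r then x else 0) m = weyl d x m"
proof -
  have "(\<Sum>j=1..r. (if j = r then x else 0) * real (n + 1) ^ expo r d j) = x * real (n + 1) ^ d" for n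
  proof -
    have "(\<Sum>j=1..r. (if j = r then x else 0) * real (n + 1) ^ expo r d j) =
       (\<Sum>j=1..r. if j = r then x * real (n + 1) ^ d else 0)"
      by (intro sum.cong) (auto simp: expo_def)
    then show ?thesis using assms by simp
  qed
  then show ?thesis unfolding psum_def weyl_alt by (simp only:)
qed

lemma cell_nth:
  assumes "j \<in> {1..r}"
  shows "cell r d N \<theta> j = \<lfloor>\<theta> j * real (modl r d N j)\<rfloor> mod int (modl r d N j)"
  using assms by (simp add: cell_def)

lemma floor_index_bounds:
  assumes "0 \<le> x" "x < 1" "q > (0::nat)"
  shows "\<lfloor>x * real q\<rfloor> mod int q = \<lfloor>x * real q\<rfloor>"
proof -
  have "0 \<le> \<lfloor>x * real q\<rfloor>" using assms by simp
  moreover have "x * real q < real q" using assms by simp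
  then have "\<lfloor>x * real q\<rfloor> < int q" by linarith
  ultimately show ?thesis by simp
qed

definition large_pts :: "nat \<Rightarrow> real \<Rightarrow> nat \<Rightarrow> real set" where
  "large_pts d V N = {x. 0 \<le> x \<and> x < 1 \<and> (\<exists>m\<le>N. norm (weyl d x m) \<ge> V)}"

text \<open>Each \<open>x\<close> is placed on the axis of the coordinate \<open>r\<close>, whose
  exponent is \<open>d\<close>; the cell of that point remembers the cell of \<open>x\<close>.
  Dividing N^(2 T + d - r) by the 2T-th power of N^(1-u), where 2 T = r (r + 1), gives the
  exponent.\<close>

lemma count_fewer_equations:
  assumes r: "1 \<le> r" "r \<le> d" and \<epsilon>: "\<epsilon> > 0"
  shows "\<exists>C>0. \<forall>K u. finite ((\<lambda>x. \<lfloor>x * real (modl r d (2 ^ K) r)\<rfloor>) ` large_pts d ((2 ^ K) powr (1 - u) / 2) (2 ^ K)) \<and>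
     real (card ((\<lambda>x. \<lfloor>x * real (modl r d (2 ^ K) r)\<rfloor>) ` large_pts d ((2 ^ K) powr (1 - u) / 2) (2 ^ K)))
       \<le> C * (2 ^ K) powr (\<epsilon> + (real d - real r) + real r * (real r + 1) * u)"
proof -
  obtain C0 where C0: "C0 > 0" and lv: "\<forall>K \<Theta> V. 0 < V \<longrightarrow>
     (\<forall>g\<in>\<Theta>. \<exists>\<theta> a b. g = cell r d (2 ^ K) \<theta> \<and> a \<le> b \<and> b \<le> 2 ^ K \<and> norm (psum r d \<theta> b - psum r d \<theta> a) \<ge> V) \<longrightarrow>
     finite \<Theta> \<and> real (card \<Theta>) * V ^ (2 * tri r) \<le> C0 * (2 ^ K) powr (\<epsilon> + 2 * real (tri r) + real d - real r)"
    using large_values[OF r \<epsilon>] by (elim exE conjE) (rule that)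
  define C where "C = C0 * 2 ^ (2 * tri r)"
  have C: "C > 0" using C0 by (simp add: C_def)
  have "finite ((\<lambda>x. \<lfloor>x * real (modl r d (2 ^ K) r)\<rfloor>) ` large_pts d ((2 ^ K) powr (1 - u) / 2) (2 ^ K)) \<and>
     real (card ((\<lambda>x. \<lfloor>x * real (modl r d (2 ^ K) r)\<rfloor>) ` large_pts d ((2 ^ K) powr (1 - u) / 2) (2 ^ K)))
       \<le> C * (2 ^ K) powr (\<epsilon> + (real d - real r) + real r * (real r + 1) * u)" for K u
  proof -
    define V :: real where "V = (2 ^ K) powr (1 - u) / 2"
    have V: "V > 0" by (simp add: V_def)
    define Y where "Y = large_pts d V (2 ^ K)"
    define \<Theta> where "\<Theta> = (\<lambda>x. cell r d (2 ^ K) (\<lambda>j. if j = r then x else 0)) ` Y"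
    have l: "\<forall>g\<in>\<Theta>. \<exists>\<theta> a b. g = cell r d (2 ^ K) \<theta> \<and> a \<le> b \<and> b \<le> 2 ^ K \<and> norm (psum r d \<theta> b - psum r d \<theta> a) \<ge> V"
    proof
      fix g assume "g \<in> \<Theta>"
      then obtain x where x: "x \<in> Y" "g = cell r d (2 ^ K) (\<lambda>j. if j = r then x else 0)" by (auto simp: \<Theta>_def)
      then obtain m where m: "m \<le> 2 ^ K" "norm (weyl d x m) \<ge> V" by (auto simp: Y_def large_pts_def)
      have "norm (psum r d (\<lambda>j. if j = r then x else 0) m - psum r d (\<lambda>j. if j = r then x else 0) 0) \<ge> V"
        using m unfolding weyl_psum[OF r(1)] by (simp add: weyl_alt)
      then show "\<exists>\<theta> a b. g = cell r d (2 ^ K) \<theta> \<and> a \<le> b \<and> b \<le> 2 ^ K \<and> norm (psum r d \<theta> b - psum r d \<theta> a) \<ge> V"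
        using x m by (intro exI[of _ "\<lambda>j. if j = r then x else 0"] exI[of _ 0] exI[of _ m]) simp
    qed
    have \<Theta>: "finite \<Theta>" "real (card \<Theta>) * V ^ (2 * tri r) \<le> C0 * (2 ^ K) powr (\<epsilon> + 2 * real (tri r) + real d - real r)"
      using lv[rule_format, OF V l[rule_format]] by blast+
    have img: "(\<lambda>x. \<lfloor>x * real (modl r d (2 ^ K) r)\<rfloor>) ` Y = (\<lambda>g. g r) ` \<Theta>"
    proof -
      have "cell r d (2 ^ K) (\<lambda>j. if j = r then x else 0) r = \<lfloor>x * real (modl r d (2 ^ K) r)\<rfloor>" if "x \<in> Y" for x
        using that r floor_index_bounds[of x "modl r d (2 ^ K) r"] modl_pos
        by (subst cell_nth) (auto simp: Y_def large_pts_def)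
      then show ?thesis unfolding \<Theta>_def image_image by (intro image_cong) auto
    qed
    have "real (card ((\<lambda>x. \<lfloor>x * real (modl r d (2 ^ K) r)\<rfloor>) ` Y)) \<le> real (card \<Theta>)"
      unfolding img using \<Theta>(1) by (simp add: card_image_le)
    also have "\<dots> \<le> C0 * (2 ^ K) powr (\<epsilon> + 2 * real (tri r) + real d - real r) / V ^ (2 * tri r)"
      using \<Theta>(2) V by (simp add: pos_le_divide_eq)
    also have "V ^ (2 * tri r) = (2 ^ K) powr ((1 - u) * (2 * real (tri r))) / 2 ^ (2 * tri r)"
      unfolding V_def by (simp add: power_divide powr_powr mult.assoc flip: powr_realpow)
    also have "C0 * (2 ^ K) powr (\<epsilon> + 2 * real (tri r) + real d - real r) / \<dots> = C * (2 ^ K) powr ((\<epsilon> + 2 * real (tri r) + real d - real r) - (1 - u) * (2 * real (tri r)))"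
      by (simp add: C_def powr_diff)
    also have "(\<epsilon> + 2 * real (tri r) + real d - real r) - (1 - u) * (2 * real (tri r)) = \<epsilon> + (real d - real r) + real r * (real r + 1) * u"
      by (simp add: real_tri field_simps)
    finally show ?thesis using \<Theta>(1) unfolding img Y_def[symmetric] V_def[symmetric] by simp
  qed
  then show ?thesis using C by blast
qed

text \<open>If \<open>h\<close> is the smallest positive integer with \<open>h y\<close> close to an integer \<open>A\<close>, then \<open>A / h\<close> is in lowest
  terms, and all other such integers are multiples of \<open>h\<close>.\<close>

lemma many_near_integers:
  fixes y \<delta> :: real and N :: nat
  defines "H \<equiv> {h\<in>{1..N}. \<exists>a::int. \<bar>real h * y - of_int a\<bar> < \<delta>}"
  assumes H: "H \<noteq> {}" and \<delta>: "\<delta> > 0" "2 * real N * \<delta> < 1"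
  shows "\<exists>h A. 1 \<le> h \<and> h * card H \<le> N \<and> \<bar>real h * y - of_int A\<bar> * real (card H) < \<delta>"
proof -
  have fH: "finite H" by (simp add: H_def)
  define h where "h = Min H"
  have hH: "h \<in> H" unfolding h_def using fH H by (rule Min_in)
  have hmin: "h \<le> h'" if "h' \<in> H" for h' unfolding h_def using fH that by simp
  have h1: "1 \<le> h" "h \<le> N" using hH by (auto simp: H_def)
  obtain A :: int where A: "\<bar>real h * y - of_int A\<bar> < \<delta>" using hH by (auto simp: H_def)
  have cop: "coprime (int h) A"
  proof (rule coprimeI)
    fix c assume c: "c dvd int h" "c dvd A"
    \<comment> \<open>A common divisor \<open>g\<close> of \<open>h\<close> and \<open>A\<close>
      would make \<open>h / g\<close> an admissible index as well, with an even smaller error;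
      minimality of \<open>h\<close> forces \<open>g = 1\<close>.\<close>
    define g where "g = nat \<bar>c\<bar>"
    have c0: "c \<noteq> 0" using c h1 by auto
    have g: "int g dvd int h" "int g dvd A" "g \<ge> 1" using c c0 by (auto simp: g_def)
    have "g dvd h" using g(1) by (simp only: int_dvd_int_iff)
    then obtain h' where h': "h = g * h'" by blast
    obtain A' where A': "A = int g * A'" using g by blast
    have h'1: "h' \<ge> 1" using h1 h' by (cases h') auto
    have "real g * \<bar>real h' * y - of_int A'\<bar> = \<bar>real g * (real h' * y - of_int A')\<bar>" by (simp add: abs_mult)
    also have "\<dots> = \<bar>real h * y - of_int A\<bar>" by (simp add: h' A' algebra_simps)
    finally have "real g * \<bar>real h' * y - of_int A'\<bar> < \<delta>" using A by simp
    moreover have "1 * \<bar>real h' * y - of_int A'\<bar> \<le> real g * \<bar>real h' * y - of_int A'\<bar>"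
      using g by (intro mult_right_mono) auto
    ultimately have "\<bar>real h' * y - of_int A'\<bar> < \<delta>" by simp
    moreover have "h' \<le> N" using h' h1 g by (metis le_trans mult_le_mono1 nat_mult_1)
    ultimately have "h' \<in> H" using h'1 by (auto simp: H_def)
    then have "h \<le> h'" by (rule hmin)
    then have "g * h' \<le> 1 * h'" using h' by simp
    then have "g \<le> 1" using h'1 by (simp only: mult_le_cancel2)
    then have "g = 1" using g by simp
    then show "is_unit c" by (simp add: g_def)
  qed
  have mult: "\<exists>j\<ge>1. h' = j * h \<and> j * h \<le> N \<and> real j * \<bar>real h * y - of_int A\<bar> < \<delta>" if h': "h' \<in> H" for h'
  proof -
    obtain a :: int where a: "\<bar>real h' * y - of_int a\<bar> < \<delta>" using h' by (auto simp: H_def)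
    have hN: "1 \<le> h'" "h' \<le> N" using h' by (auto simp: H_def)
    \<comment> \<open>An integer of absolute value less than 1, because
      \<open>2 * real N * \<delta> < 1\<close>: the fractions a / h' and A / h coincide.\<close>
    have "real_of_int (int h' * A - a * int h) = real h * (real h' * y - of_int a) - real h' * (real h * y - of_int A)"
      by (simp add: algebra_simps)
    also have "\<bar>\<dots>\<bar> \<le> real h * \<bar>real h' * y - of_int a\<bar> + real h' * \<bar>real h * y - of_int A\<bar>"
      using abs_triangle_ineq4[of "real h * (real h' * y - of_int a)" "real h' * (real h * y - of_int A)"] by (simp add: abs_mult)
    also have "\<dots> \<le> real N * \<delta> + real N * \<delta>"
      using a A h1 hN \<delta> by (intro add_mono mult_mono) auto
    also have "\<dots> < 1" using \<delta>(2) by linarith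
    finally have "int h' * A - a * int h = 0" by linarith
    then have eq: "int h' * A = a * int h" by simp
    then have "int h dvd int h' * A" by simp
    then have "int h dvd int h'" using cop by (simp add: coprime_dvd_mult_left_iff)
    then obtain j where j: "h' = j * h" by (metis dvd_def int_dvd_int_iff mult.commute)
    have j1: "j \<ge> 1" using j hN by (cases j) auto
    have "a = int j * A" using eq j h1 by simp
    then have "real h' * y - of_int a = real j * (real h * y - of_int A)" by (simp add: j algebra_simps)
    then have "real j * \<bar>real h * y - of_int A\<bar> < \<delta>" using a by (simp add: abs_mult)
    then show ?thesis using j1 j hN by auto
  qed
  then obtain f where f: "\<And>h'. h' \<in> H \<Longrightarrow> f h' \<ge> 1 \<and> h' = f h' * h \<and> f h' * h \<le> N \<and> real (f h') * \<bar>real h * y - of_int A\<bar> < \<delta>"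
    by metis
  define J where "J = Max (f ` H)"
  have "J \<in> f ` H" unfolding J_def using fH H by (intro Max_in) auto
  then obtain h' where h': "h' \<in> H" "J = f h'" by auto
  have inj: "inj_on f H" by (rule inj_onI) (metis f)
  have "f ` H \<subseteq> {1..J}" using f fH by (auto simp: J_def)
  then have "card (f ` H) \<le> card {1..J}" by (intro card_mono) auto
  then have cJ: "card H \<le> J" by (simp add: card_image[OF inj])
  have "h * card H \<le> h * J" using cJ by simp
  also have "\<dots> \<le> N" using f[OF h'(1)] h'(2) by (simp add: mult.commute)
  finally have 1: "h * card H \<le> N" .
  have "\<bar>real h * y - of_int A\<bar> * real (card H) \<le> real J * \<bar>real h * y - of_int A\<bar>"
    using cJ by (simp add: mult.commute mult_right_mono)
  also have "\<dots> < \<delta>" using f[OF h'(1)] h'(2) by simp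
  finally show ?thesis using 1 h1 by blast
qed

lemma card_floor_image_le:
  assumes "\<And>x. x \<in> X \<Longrightarrow> \<bar>x - c\<bar> \<le> w" and w: "w \<ge> 0" and q: "q > 0"
  shows "finite ((\<lambda>x. \<lfloor>x * q\<rfloor>) ` X) \<and> real (card ((\<lambda>x. \<lfloor>x * q\<rfloor>) ` X)) \<le> 2 * w * q + 2"
proof -
  define lo where "lo = (c - w) * q"
  define hi where "hi = (c + w) * q"
  have sub: "(\<lambda>x. \<lfloor>x * q\<rfloor>) ` X \<subseteq> {\<lfloor>lo\<rfloor>..\<lfloor>hi\<rfloor>}"
  proof safe
    fix x assume "x \<in> X"
    then have "c - w \<le> x" "x \<le> c + w" using assms(1)[of x] by auto
    then have "lo \<le> x * q" "x * q \<le> hi" using q by (auto simp: lo_def hi_def)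
    then show "\<lfloor>x * q\<rfloor> \<in> {\<lfloor>lo\<rfloor>..\<lfloor>hi\<rfloor>}" by (auto intro: floor_mono)
  qed
  have "card ((\<lambda>x. \<lfloor>x * q\<rfloor>) ` X) \<le> card {\<lfloor>lo\<rfloor>..\<lfloor>hi\<rfloor>}" by (intro card_mono sub) auto
  also have "\<dots> = nat (\<lfloor>hi\<rfloor> - \<lfloor>lo\<rfloor> + 1)" by simp
  finally have "real (card ((\<lambda>x. \<lfloor>x * q\<rfloor>) ` X)) \<le> real (nat (\<lfloor>hi\<rfloor> - \<lfloor>lo\<rfloor> + 1))" by (simp only: of_nat_le_iff)
  also have "\<dots> = real_of_int (\<lfloor>hi\<rfloor> - \<lfloor>lo\<rfloor> + 1)"
  proof -
    have "lo \<le> hi" using w q by (simp add: lo_def hi_def)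
    then have "\<lfloor>lo\<rfloor> \<le> \<lfloor>hi\<rfloor>" by (rule floor_mono)
    then show ?thesis by simp
  qed
  also have "\<dots> \<le> hi - lo + 2" by linarith
  also have "hi - lo = 2 * w * q" by (simp add: hi_def lo_def algebra_simps)
  finally show ?thesis using finite_subset[OF sub] by auto
qed

section \<open>Counting cells through translations\<close>

text \<open>The coefficients of the polynomial x (n - c)^d in \<open>n\<close>; the constant term
  only rotates the sum.\<close>

definition shift_pt :: "nat \<Rightarrow> real \<Rightarrow> nat \<Rightarrow> nat \<Rightarrow> real" where
  "shift_pt d x c j = x * real (d choose j) * (- real c) ^ (d - j)"

text \<open>On the window from \<open>c + 1\<close> to \<open>c + m\<close> the translated
  polynomial takes the values x n^d for n from 1 to \<open>m\<close>, up to a common phase.\<close>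

lemma psum_shift:
  assumes d: "1 \<le> d"
  shows "norm (psum d d (shift_pt d x c) (c + m) - psum d d (shift_pt d x c) c) = norm (weyl d x m)"
proof -
  define F where "F n = e (\<Sum>j=1..d. shift_pt d x c j * real (n + 1) ^ expo d d j)" for n
  have F: "F (c + n) = e (- (x * (- real c) ^ d)) * e (x * real (n + 1) ^ d)" for n
  proof -
    define y where "y = real (c + n + 1)"
    have "(y + (- real c)) ^ d = (\<Sum>j\<le>d. real (d choose j) * y ^ j * (- real c) ^ (d - j))"
      by (rule binomial_ring)
    also have "{..d} = insert 0 {1..d}" by auto
    also have "(\<Sum>j\<in>insert 0 {1..d}. real (d choose j) * y ^ j * (- real c) ^ (d - j)) =
       (- real c) ^ d + (\<Sum>j=1..d. real (d choose j) * y ^ j * (- real c) ^ (d - j))"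
      by (subst sum.insert) auto
    finally have "x * (y + (- real c)) ^ d = x * (- real c) ^ d + (\<Sum>j=1..d. shift_pt d x c j * y ^ j)"
      by (simp add: distrib_left sum_distrib_left shift_pt_def mult_ac)
    moreover have "y + (- real c) = real (n + 1)" by (simp add: y_def)
    ultimately have "(\<Sum>j=1..d. shift_pt d x c j * y ^ j) = - (x * (- real c) ^ d) + x * real (n + 1) ^ d"
      by simp
    moreover have "(\<Sum>j=1..d. shift_pt d x c j * real (c + n + 1) ^ expo d d j) = (\<Sum>j=1..d. shift_pt d x c j * y ^ j)"
      by (intro sum.cong) (auto simp: expo_def y_def)
    ultimately show ?thesis unfolding F_def e_add[symmetric] by (simp only:)
  qed
  have "psum d d (shift_pt d x c) (c + m) = psum d d (shift_pt d x c) c + (\<Sum>n<m. F (c + n))"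
    unfolding psum_def F_def[symmetric] by (induction m) (auto simp: add.assoc)
  then have "psum d d (shift_pt d x c) (c + m) - psum d d (shift_pt d x c) c = e (- (x * (- real c) ^ d)) * weyl d x m"
    unfolding F weyl_alt sum_distrib_left[symmetric] by simp
  then show ?thesis by (simp add: norm_mult)
qed

definition near_set :: "nat \<Rightarrow> real \<Rightarrow> nat \<Rightarrow> real \<Rightarrow> nat set" where
  "near_set d \<delta> N x = {h\<in>{1..N}. \<exists>a::int. \<bar>real h * (real d * x) - of_int a\<bar> < \<delta>}"

text \<open>The coordinate of index \<open>d - 1\<close> equals - d x c, linear in \<open>c\<close>.
  If the translations by \<open>c\<close> and \<open>c + h\<close> fall into the same cell, then h d
  x is within \<open>1 / q'\<close> of an integer. So each cell is hit by at most one plus the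
  number of such \<open>h\<close> translations.\<close>

lemma card_shift_cells:
  fixes d M N :: nat and x :: real
  assumes d: "2 \<le> d"
  defines "q' \<equiv> modl d d M (d - 1)"
  shows "real (N + 1) \<le> real (card ((\<lambda>c. cell d d M (shift_pt d x c)) ` {0..N})) * (1 + real (card (near_set d (1 / real q') N x)))"
proof -
  define f where "f c = cell d d M (shift_pt d x c)" for c
  define Z where "Z = near_set d (1 / real q') N x"
  have fZ: "finite Z" by (simp add: Z_def near_set_def)
  have q'0: "real q' > 0" using modl_pos by (simp add: q'_def)
  have fib: "card {c\<in>{0..N}. f c = g} \<le> 1 + card Z" for g
  proof (cases "{c\<in>{0..N}. f c = g} = {}")
    case False
    define c0 where "c0 = Min {c\<in>{0..N}. f c = g}"
    have c0: "c0 \<in> {c\<in>{0..N}. f c = g}" unfolding c0_def by (rule Min_in[OF _ False]) auto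
    have "{c\<in>{0..N}. f c = g} \<subseteq> insert c0 ((\<lambda>h. c0 + h) ` Z)"
    proof
      fix c assume c: "c \<in> {c\<in>{0..N}. f c = g}"
      have c0c: "c0 \<le> c" unfolding c0_def using c by (intro Min_le) auto
      show "c \<in> insert c0 ((\<lambda>h. c0 + h) ` Z)"
      proof (cases "c = c0")
        case False
        define h where "h = c - c0"
        have h: "c = c0 + h" "1 \<le> h" "h \<le> N" using c0c False c by (auto simp: h_def)
        have j: "d - 1 \<in> {1..d}" using d by auto
        have sp: "shift_pt d x k (d - 1) = - (real d * x) * real k" for k
        proof -
          have "d choose (d - 1) = d" using d binomial_symmetric[of 1 d] by simp
          then show ?thesis using d by (simp add: shift_pt_def)
        qed
        have "f c (d - 1) = f c0 (d - 1)" using c c0 by simp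
        then have "\<lfloor>- (real d * x) * real c * real q'\<rfloor> mod int q' = \<lfloor>- (real d * x) * real c0 * real q'\<rfloor> mod int q'"
          unfolding f_def cell_nth[OF j] sp q'_def .
        then obtain k where "\<lfloor>- (real d * x) * real c * real q'\<rfloor> - \<lfloor>- (real d * x) * real c0 * real q'\<rfloor> = int q' * k"
          by (auto simp: mod_eq_dvd_iff)
        then have fl: "real_of_int \<lfloor>- (real d * x) * real c * real q'\<rfloor> - real_of_int \<lfloor>- (real d * x) * real c0 * real q'\<rfloor> = real q' * of_int k"
          by (metis of_int_diff of_int_mult of_int_of_nat_eq)
        have "\<bar>(- (real d * x) * real c * real q') - (- (real d * x) * real c0 * real q') - real q' * of_int k\<bar> < 1"
          unfolding fl[symmetric] by linarith
        also have "(- (real d * x) * real c * real q') - (- (real d * x) * real c0 * real q') - real q' * of_int k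
           = - (real q' * (real h * (real d * x) - of_int (- k)))"
          by (simp add: h(1) algebra_simps)
        finally have "real q' * \<bar>real h * (real d * x) - of_int (- k)\<bar> < 1"
          using q'0 by (simp only: abs_minus_cancel abs_mult abs_of_pos)
        then have "\<bar>real h * (real d * x) - of_int (- k)\<bar> < 1 / real q'" using q'0 by (simp add: field_simps)
        then have "h \<in> Z" using h unfolding Z_def near_set_def by (intro CollectI conjI exI[of _ "- k"]) auto
        then show ?thesis using h by auto
      qed simp
    qed
    then have "card {c\<in>{0..N}. f c = g} \<le> card (insert c0 ((\<lambda>h. c0 + h) ` Z))"
      using fZ by (intro card_mono) auto
    also have "\<dots> \<le> 1 + card ((\<lambda>h. c0 + h) ` Z)" using fZ by (simp add: card_insert_if)
    also have "\<dots> \<le> 1 + card Z" using fZ by (simp add: card_image_le)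
    finally show ?thesis .
  qed (simp only: card.empty)
  have "real (N + 1) = (\<Sum>c\<in>{0..N}. 1)" by simp
  also have "\<dots> = (\<Sum>g\<in>f ` {0..N}. \<Sum>c\<in>{c\<in>{0..N}. f c = g}. 1)" by (rule sum.image_gen) simp
  also have "\<dots> \<le> (\<Sum>g\<in>f ` {0..N}. 1 + real (card Z))"
  proof (intro sum_mono)
    fix g
    have "(\<Sum>c\<in>{c\<in>{0..N}. f c = g}. 1) = real (card {c\<in>{0..N}. f c = g})" by simp
    also have "\<dots> \<le> real (1 + card Z)" using fib[of g] by (simp only: of_nat_le_iff)
    finally show "(\<Sum>c\<in>{c\<in>{0..N}. f c = g}. 1) \<le> 1 + real (card Z)" by simp
  qed
  finally show ?thesis unfolding f_def Z_def by (simp add: distrib_left)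
qed

text \<open>If at least N / T multiples of d x are close to integers, then x is close to some A / (d
  h) with \<open>h \<le> T\<close>. Such a neighbourhood meets at most 6 T / h cells, and there are
  about d h choices of \<open>A\<close>, so each \<open>h\<close> contributes O(T).\<close>

lemma count_near_rational:
  fixes d N :: nat and T :: real and X :: "real set"
  assumes d: "2 \<le> d" and N: "1 \<le> N" and T: "1 \<le> T" "T \<le> real N"
  defines "q \<equiv> modl d d (2 * N) d" and "q' \<equiv> modl d d (2 * N) (d - 1)"
  assumes X: "\<And>x. x \<in> X \<Longrightarrow> 0 \<le> x \<and> x < 1 \<and> real N / T \<le> real (card (near_set d (1 / real q') N x))"
  shows "finite ((\<lambda>x. \<lfloor>x * real q\<rfloor>) ` X) \<and> real (card ((\<lambda>x. \<lfloor>x * real q\<rfloor>) ` X)) \<le> 12 * real d * T\<^sup>2"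
proof -
  have q0: "real q > 0" "real q' > 0" using modl_pos by (simp_all add: q_def q'_def)
  define \<delta> where "\<delta> = 1 / real q'"
  have \<delta>: "\<delta> > 0" using q0 by (simp add: \<delta>_def)
  have tri3: "tri d \<ge> 3" by (rule tri_ge_3[OF d])
  have q'N: "2 * N < q'"
  proof -
    have "(2 * N) ^ 1 \<le> (2 * N) ^ (d - 1)" using d N by (intro power_increasing) auto
    then have "1 * (2 * N) \<le> tri d * (2 * N) ^ (d - 1)" using tri3 by (intro mult_mono) auto
    then show ?thesis using d by (simp add: q'_def modl_def expo_def)
  qed
  \<comment> \<open>The two grids differ by a factor of at most 2 N, so a width of order T / (N h
    q') covers O(T / h) cells of length 1 / q.\<close>
  have qq': "real q \<le> 2 * real N * real q'"
  proof -
    have "(2 * N) ^ d = 2 * N * (2 * N) ^ (d - 1)" using d by (cases d) auto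
    then have "q \<le> 2 * N * q'" using d N by (simp add: q_def q'_def modl_def expo_def algebra_simps)
    then have "real q \<le> real (2 * N * q')" by (simp only: of_nat_le_iff)
    then show ?thesis by simp
  qed
  have N\<delta>: "2 * real N * \<delta> < 1"
  proof -
    have "real (2 * N) < real q'" using q'N by (simp only: of_nat_less_iff)
    then show ?thesis using q0 by (simp add: \<delta>_def field_simps)
  qed
  \<comment> \<open>The multiples of the least index \<open>h\<close> share its error, so |h d x -
    A| is less than \<open>\<delta>\<close> divided by the number of near integers, hence less than
    \<open>\<delta> * T / N\<close>; division by d h gives at most this width.\<close>
  define w where "w h = \<delta> * T / (real N * real h)" for h :: nat
  define ctr where "ctr h A = of_int A / (real d * real h)" for h :: nat and A :: int
  define Y where "Y h A = {x\<in>X. \<bar>x - ctr h A\<bar> \<le> w h}" for h A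
  define P where "P = (SIGMA h:{h\<in>{1..N}. real h \<le> T}. {0..int (d * h)})"
  have cov: "X \<subseteq> (\<Union>(h, A)\<in>P. Y h A)"
  proof
    fix x assume x: "x \<in> X"
    define H where "H = near_set d \<delta> N x"
    have cH: "real N / T \<le> real (card H)" "0 \<le> x" "x < 1" using X[OF x] by (auto simp: H_def \<delta>_def)
    have NT: "real N / T > 0" using N T by simp
    then have cH0: "real (card H) > 0" using cH(1) by linarith
    then have Hne: "H \<noteq> {}" by auto
    obtain h A where hA: "1 \<le> h" "h * card H \<le> N" "\<bar>real h * (real d * x) - of_int A\<bar> * real (card H) < \<delta>"
      using many_near_integers[of N "real d * x" \<delta>] Hne \<delta> N\<delta> unfolding H_def near_set_def by blast
    have hT: "real h \<le> T"
    proof -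
      have "real h * (real N / T) \<le> real h * real (card H)" using cH by (intro mult_left_mono) auto
      also have "\<dots> \<le> real N" using hA(2) by (metis of_nat_le_iff of_nat_mult)
      finally show ?thesis using N T by (simp add: field_simps)
    qed
    have "\<bar>real h * (real d * x) - of_int A\<bar> * (real N / T) \<le> \<bar>real h * (real d * x) - of_int A\<bar> * real (card H)"
      using cH by (intro mult_left_mono) auto
    then have "\<bar>real h * (real d * x) - of_int A\<bar> * (real N / T) < \<delta>" using hA(3) by linarith
    then have near: "\<bar>real h * (real d * x) - of_int A\<bar> < \<delta> * T / real N" using N T by (simp add: field_simps)
    have "\<delta> * T / real N \<le> \<delta> * real N / real N" using T \<delta> by (intro divide_right_mono mult_left_mono) auto
    also have "\<dots> = 1 * \<delta>" using N by simp
    also have "\<dots> \<le> 2 * real N * \<delta>" using N \<delta> by (intro mult_right_mono) auto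
    also have "\<dots> < 1" by (rule N\<delta>)
    finally have lt1: "\<bar>real h * (real d * x) - of_int A\<bar> < 1" using near by linarith
    have "0 \<le> real h * (real d * x)" using cH by simp
    moreover have "real h * (real d * x) \<le> real h * (real d * 1)"
      using cH by (intro mult_left_mono) auto
    moreover have "real h * (real d * 1) = real_of_int (int (d * h))" by (simp add: mult.commute)
    ultimately have "-1 < real_of_int A" "real_of_int A < real_of_int (int (d * h)) + 1" using lt1 by linarith+
    then have A: "A \<in> {0..int (d * h)}" unfolding atLeastAtMost_iff by linarith
    have dh: "real d * real h > 0" using d hA by simp
    have "\<bar>x - ctr h A\<bar> = \<bar>real h * (real d * x) - of_int A\<bar> / (real d * real h)"
    proof -
      have "x - ctr h A = (real h * (real d * x) - of_int A) / (real d * real h)"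
        using d hA by (simp add: ctr_def diff_divide_distrib)
      then show ?thesis using dh by (simp add: abs_divide abs_mult)
    qed
    also have "\<dots> \<le> (\<delta> * T / real N) / (1 * real h)"
      using near d hA \<delta> T by (intro frac_le mult_right_mono) auto
    also have "\<dots> = w h" by (simp add: w_def)
    finally have "x \<in> Y h A" using x by (simp add: Y_def)
    have "h \<le> N" using hT T by linarith
    then have "(h, A) \<in> P" using A hA(1) hT by (simp add: P_def)
    then show "x \<in> (\<Union>(h, A)\<in>P. Y h A)" using \<open>x \<in> Y h A\<close> by (intro UN_I[of "(h, A)"]) simp_all
  qed
  have finP: "finite P" unfolding P_def by (intro finite_SigmaI) auto
  have Yb: "finite ((\<lambda>x. \<lfloor>x * real q\<rfloor>) ` Y h A) \<and> real (card ((\<lambda>x. \<lfloor>x * real q\<rfloor>) ` Y h A)) \<le> 6 * T / real h"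
    if h: "1 \<le> h" "real h \<le> T" for h A
  proof -
    have w0: "w h \<ge> 0" using \<delta> T by (simp add: w_def)
    have 1: "finite ((\<lambda>x. \<lfloor>x * real q\<rfloor>) ` Y h A) \<and> real (card ((\<lambda>x. \<lfloor>x * real q\<rfloor>) ` Y h A)) \<le> 2 * w h * real q + 2"
      by (rule card_floor_image_le[OF _ w0 q0(1)]) (auto simp: Y_def)
    have "w h * real q \<le> w h * (2 * real N * real q')" using w0 qq' by (intro mult_left_mono) auto
    also have "\<dots> = 2 * T / real h" using q0 N h by (simp add: w_def \<delta>_def field_simps)
    finally have "2 * w h * real q + 2 \<le> 4 * T / real h + 2 * (T / real h)"
      using h by (simp add: field_simps)
    then show ?thesis using 1 by (simp add: add_divide_distrib[symmetric])
  qed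
  have img: "(\<lambda>x. \<lfloor>x * real q\<rfloor>) ` X \<subseteq> (\<Union>(h, A)\<in>P. (\<lambda>x. \<lfloor>x * real q\<rfloor>) ` Y h A)"
    using cov by blast
  have fin: "finite (\<Union>(h, A)\<in>P. (\<lambda>x. \<lfloor>x * real q\<rfloor>) ` Y h A)"
    using finP Yb by (intro finite_UN_I) (auto simp: P_def)
  have "real (card ((\<lambda>x. \<lfloor>x * real q\<rfloor>) ` X)) \<le> real (card (\<Union>z\<in>P. (\<lambda>x. \<lfloor>x * real q\<rfloor>) ` Y (fst z) (snd z)))"
    using img fin by (intro of_nat_mono card_mono) (auto simp: case_prod_unfold)
  also have "\<dots> \<le> real (\<Sum>z\<in>P. card ((\<lambda>x. \<lfloor>x * real q\<rfloor>) ` Y (fst z) (snd z)))"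
    by (intro of_nat_mono card_UN_le finP)
  also have "\<dots> = (\<Sum>z\<in>P. real (card ((\<lambda>x. \<lfloor>x * real q\<rfloor>) ` Y (fst z) (snd z))))" by simp
  also have "\<dots> \<le> (\<Sum>z\<in>P. 6 * T / real (fst z))"
    using Yb by (intro sum_mono) (auto simp: P_def)
  also have "\<dots> = (\<Sum>h\<in>{h\<in>{1..N}. real h \<le> T}. \<Sum>A\<in>{0..int (d * h)}. 6 * T / real h)"
    unfolding P_def by (subst sum.Sigma) (simp_all add: case_prod_unfold)
  also have "\<dots> \<le> (\<Sum>h\<in>{h\<in>{1..N}. real h \<le> T}. 12 * real d * T)"
  proof (intro sum_mono)
    fix h assume "h \<in> {h\<in>{1..N}. real h \<le> T}"
    then have h: "1 \<le> h" by simp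
    have "(\<Sum>A\<in>{0..int (d * h)}. 6 * T / real h) = (real d * real h + 1) * (6 * T / real h)"
      by (simp add: nat_add_distrib nat_mult_distrib)
    also have "\<dots> \<le> (2 * (real d * real h)) * (6 * T / real h)"
    proof (intro mult_right_mono)
      have "1 * 1 \<le> real d * real h" using d h by (intro mult_mono) auto
      then show "real d * real h + 1 \<le> 2 * (real d * real h)" by simp
    qed (use T in auto)
    also have "\<dots> = 12 * real d * T" using h by simp
    finally show "(\<Sum>A\<in>{0..int (d * h)}. 6 * T / real h) \<le> 12 * real d * T" .
  qed
  also have "\<dots> = real (card {h\<in>{1..N}. real h \<le> T}) * (12 * real d * T)" by simp
  also have "\<dots> \<le> T * (12 * real d * T)"
  proof (intro mult_right_mono)
    have "{h\<in>{1..N}. real h \<le> T} \<subseteq> {1..nat \<lfloor>T\<rfloor>}" by (auto simp: le_nat_floor)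
    then have "card {h\<in>{1..N}. real h \<le> T} \<le> card {1..nat \<lfloor>T\<rfloor>}" by (intro card_mono) auto
    then have "real (card {h\<in>{1..N}. real h \<le> T}) \<le> real (nat \<lfloor>T\<rfloor>)" by simp
    also have "\<dots> \<le> T" using T by simp
    finally show "real (card {h\<in>{1..N}. real h \<le> T}) \<le> T" .
  qed (use T in auto)
  finally have "real (card ((\<lambda>x. \<lfloor>x * real q\<rfloor>) ` X)) \<le> 12 * real d * T\<^sup>2" by (simp only: power2_eq_square mult_ac)
  then show ?thesis using finite_subset[OF img fin] by blast
qed

text \<open>Points with at least N / T near integers are counted by the rational approximation. Each
  cell of the others produces at least T / 2 cells in dimension \<open>d\<close>, disjoint for
  different cells of \<open>x\<close>, and all of them large values; so their number is at most 2 /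
  T times the total number of large cells.\<close>

lemma count_shifts:
  assumes d: "2 \<le> d" and \<epsilon>: "\<epsilon> > 0"
  defines "E \<equiv> real d * (real d + 1)"
  shows "\<exists>C>0. \<forall>K u. u > 0 \<longrightarrow> finite ((\<lambda>x. \<lfloor>x * real (modl d d (2 * 2 ^ K) d)\<rfloor>) ` large_pts d ((2 ^ K) powr (1 - u) / 2) (2 ^ K)) \<and>
     real (card ((\<lambda>x. \<lfloor>x * real (modl d d (2 * 2 ^ K) d)\<rfloor>) ` large_pts d ((2 ^ K) powr (1 - u) / 2) (2 ^ K)))
       \<le> C * (2 ^ K) powr (\<epsilon> + max (E * u - 1) (2 * E * u / 3))"
proof -
  have d1: "1 \<le> d" using d by simp
  obtain C0 where C0: "C0 > 0" and lv: "\<forall>K \<Theta> V. 0 < V \<longrightarrow>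
     (\<forall>g\<in>\<Theta>. \<exists>\<theta> a b. g = cell d d (2 ^ K) \<theta> \<and> a \<le> b \<and> b \<le> 2 ^ K \<and> norm (psum d d \<theta> b - psum d d \<theta> a) \<ge> V) \<longrightarrow>
     finite \<Theta> \<and> real (card \<Theta>) * V ^ (2 * tri d) \<le> C0 * (2 ^ K) powr (\<epsilon> + 2 * real (tri d) + real d - real d)"
    using large_values[OF d1 order_refl \<epsilon>] by (elim exE conjE) (rule that)
  define C1 where "C1 = C0 * 2 powr (\<epsilon> + 2 * real (tri d)) * 2 ^ (2 * tri d)"
  have C1: "C1 > 0" using C0 by (simp add: C1_def)
  define C where "C = 12 * real d + 2 * C1"
  have C: "C > 0" using C1 by (simp add: C_def)
  have main: "finite ((\<lambda>x. \<lfloor>x * real (modl d d (2 * 2 ^ K) d)\<rfloor>) ` large_pts d ((2 ^ K) powr (1 - u) / 2) (2 ^ K)) \<and>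
     real (card ((\<lambda>x. \<lfloor>x * real (modl d d (2 * 2 ^ K) d)\<rfloor>) ` large_pts d ((2 ^ K) powr (1 - u) / 2) (2 ^ K)))
       \<le> C * (2 ^ K) powr (\<epsilon> + max (E * u - 1) (2 * E * u / 3))" if u: "u > 0" for K u
  proof -
    define N where "N = (2::nat) ^ K"
    have N1: "1 \<le> N" by (simp add: N_def)
    define V where "V = real N powr (1 - u) / 2"
    have V: "V > 0" using N1 by (simp add: V_def)
    define Y where "Y = large_pts d V N"
    define q where "q = modl d d (2 * N) d"
    define q' where "q' = modl d d (2 * N) (d - 1)"
    define idx where "idx = (\<lambda>x. \<lfloor>x * real q\<rfloor>)"
    have E0: "E > 0" using d by (simp add: E_def)
    \<comment> \<open>E u / 3 balances T^2 against N^(E u) / T; the cap 1 expresses that at most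
      about N translations are available.\<close>
    define t where "t = min 1 (E * u / 3)"
    have t: "0 < t" "t \<le> 1" "t \<le> E * u / 3" using E0 u by (auto simp: t_def)
    define T where "T = real N powr t"
    have T: "1 \<le> T" "T \<le> real N"
      using t N1 powr_mono[of t 1 "real N"] by (auto simp: T_def intro: ge_one_powr_ge_zero)
    define Z where "Z x = real (card (near_set d (1 / real q') N x))" for x
    define X1 where "X1 = {x\<in>Y. real N / T \<le> Z x}"
    define X2 where "X2 = {x\<in>Y. Z x < real N / T}"
    have Yb: "0 \<le> x \<and> x < 1" if "x \<in> Y" for x using that by (auto simp: Y_def large_pts_def)
    have X1: "finite (idx ` X1) \<and> real (card (idx ` X1)) \<le> 12 * real d * T\<^sup>2"
      unfolding idx_def q_def using Yb
      by (intro count_near_rational[OF d N1 T]) (auto simp: X1_def Z_def q'_def)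
    \<comment> \<open>The grid is the one for 2 N because a translated window ends at
      \<open>c + m\<close>, which can reach 2 N.\<close>
    define \<Theta> where "\<Theta> = (\<Union>x\<in>X2. (\<lambda>c. cell d d (2 * N) (shift_pt d x c)) ` {0..N})"
    have l: "\<forall>g\<in>\<Theta>. \<exists>\<theta> a b. g = cell d d (2 ^ Suc K) \<theta> \<and> a \<le> b \<and> b \<le> 2 ^ Suc K \<and> norm (psum d d \<theta> b - psum d d \<theta> a) \<ge> V"
    proof
      fix g assume "g \<in> \<Theta>"
      then obtain x c where xc: "x \<in> X2" "c \<le> N" "g = cell d d (2 * N) (shift_pt d x c)" by (auto simp: \<Theta>_def)
      then obtain m where m: "m \<le> N" "norm (weyl d x m) \<ge> V" by (auto simp: X2_def Y_def large_pts_def)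
      have "norm (psum d d (shift_pt d x c) (c + m) - psum d d (shift_pt d x c) c) \<ge> V"
        using m d by (subst psum_shift) auto
      then show "\<exists>\<theta> a b. g = cell d d (2 ^ Suc K) \<theta> \<and> a \<le> b \<and> b \<le> 2 ^ Suc K \<and> norm (psum d d \<theta> b - psum d d \<theta> a) \<ge> V"
        using xc m by (intro exI[of _ "shift_pt d x c"] exI[of _ c] exI[of _ "c + m"]) (simp add: N_def)
    qed
    have \<Theta>: "finite \<Theta>" "real (card \<Theta>) * V ^ (2 * tri d) \<le> C0 * (2 ^ Suc K) powr (\<epsilon> + 2 * real (tri d) + real d - real d)"
      using lv[rule_format, OF V l[rule_format]] by blast+
    have \<Theta>c: "real (card \<Theta>) \<le> C1 * real N powr (\<epsilon> + E * u)"
    proof -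
      have "real (card \<Theta>) \<le> C0 * (2 ^ Suc K) powr (\<epsilon> + 2 * real (tri d)) / V ^ (2 * tri d)"
        using \<Theta>(2) V by (simp add: pos_le_divide_eq)
      also have "V ^ (2 * tri d) = real N powr ((1 - u) * (2 * real (tri d))) / 2 ^ (2 * tri d)"
        unfolding V_def using N1 by (simp add: power_divide powr_powr mult.assoc flip: powr_realpow)
      also have "(2 ^ Suc K :: real) powr (\<epsilon> + 2 * real (tri d)) = 2 powr (\<epsilon> + 2 * real (tri d)) * real N powr (\<epsilon> + 2 * real (tri d))"
        by (simp add: N_def powr_mult)
      also have "C0 * (2 powr (\<epsilon> + 2 * real (tri d)) * real N powr (\<epsilon> + 2 * real (tri d))) / (real N powr ((1 - u) * (2 * real (tri d))) / 2 ^ (2 * tri d))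
         = C1 * real N powr ((\<epsilon> + 2 * real (tri d)) - (1 - u) * (2 * real (tri d)))"
        by (simp add: C1_def powr_diff)
      also have "(\<epsilon> + 2 * real (tri d)) - (1 - u) * (2 * real (tri d)) = \<epsilon> + E * u"
        by (simp add: E_def real_tri field_simps)
      finally show ?thesis .
    qed
    \<comment> \<open>The leading coefficient is unaffected by translation, so the last coordinate
      of every translated cell still identifies the cell of \<open>x\<close>.\<close>
    have cellq: "cell d d (2 * N) (shift_pt d x c) d = idx x" if "x \<in> Y" for x c
      using Yb[OF that] d floor_index_bounds[of x q] modl_pos
      by (subst cell_nth) (auto simp: shift_pt_def idx_def q_def)
    have fi: "finite (idx ` X2)" 
    proof -
      have "idx ` X2 \<subseteq> (\<lambda>g. g d) ` \<Theta>"
      proof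
        fix i assume "i \<in> idx ` X2"
        then obtain x where x: "x \<in> X2" "i = idx x" by auto
        then have "i = cell d d (2 * N) (shift_pt d x 0) d" using cellq[of x 0] by (simp add: X2_def)
        moreover have "cell d d (2 * N) (shift_pt d x 0) \<in> \<Theta>" using x unfolding \<Theta>_def by (intro UN_I[OF x(1)]) auto
        ultimately show "i \<in> (\<lambda>g. g d) ` \<Theta>" by blast
      qed
      then show ?thesis using \<Theta>(1) finite_subset by blast
    qed
    have X2c: "real (card (idx ` X2)) * (T / 2) \<le> real (card \<Theta>)"
    proof -
      define rep where "rep i = (SOME x. x \<in> X2 \<and> idx x = i)" for i
      have rep: "rep i \<in> X2" "idx (rep i) = i" if "i \<in> idx ` X2" for i
        using someI_ex[of "\<lambda>x. x \<in> X2 \<and> idx x = i"] that by (auto simp: rep_def)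
      define G where "G i = (\<lambda>c. cell d d (2 * N) (shift_pt d (rep i) c)) ` {0..N}" for i
      have Gsub: "G i \<subseteq> \<Theta>" if "i \<in> idx ` X2" for i
        unfolding G_def \<Theta>_def using rep(1)[OF that] by blast
      have Gd: "g d = i" if "i \<in> idx ` X2" "g \<in> G i" for g i
        using that cellq[of "rep i"] rep[OF that(1)] by (auto simp: G_def X2_def)
      have disj: "\<forall>i\<in>idx ` X2. \<forall>j\<in>idx ` X2. i \<noteq> j \<longrightarrow> G i \<inter> G j = {}"
      proof (intro ballI impI equals0I)
        fix i j g assume ij: "i \<in> idx ` X2" "j \<in> idx ` X2" "i \<noteq> j" and g: "g \<in> G i \<inter> G j"
        show False using Gd[OF ij(1) IntD1[OF g]] Gd[OF ij(2) IntD2[OF g]] ij(3) by simp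
      qed
      have "T / 2 \<le> real (card (G i))" if i: "i \<in> idx ` X2" for i
      proof -
        have "real (N + 1) \<le> real (card (G i)) * (1 + Z (rep i))"
          unfolding G_def Z_def q'_def by (rule card_shift_cells[OF d])
        also have "\<dots> \<le> real (card (G i)) * (real N / T + real N / T)"
          using rep(1)[OF i] T by (intro mult_left_mono add_mono) (auto simp: X2_def)
        finally have "real N \<le> real (card (G i)) * (2 * real N / T)" by simp
        then show ?thesis using N1 T by (simp add: field_simps)
      qed
      then have "(\<Sum>i\<in>idx ` X2. T / 2) \<le> (\<Sum>i\<in>idx ` X2. real (card (G i)))" by (intro sum_mono)
      also have "\<dots> = real (card (\<Union>i\<in>idx ` X2. G i))"
        using card_UN_disjoint[OF fi _ disj] by (simp add: G_def)
      also have "\<dots> \<le> real (card \<Theta>)" using \<Theta>(1) Gsub by (intro of_nat_mono card_mono) auto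
      finally show ?thesis by simp
    qed
    have "Y = X1 \<union> X2" by (auto simp: X1_def X2_def)
    then have Yun: "idx ` Y = idx ` X1 \<union> idx ` X2" by (simp only: image_Un)
    have "real (card (idx ` Y)) \<le> real (card (idx ` X1)) + real (card (idx ` X2))"
      unfolding Yun by (metis card_Un_le of_nat_add of_nat_le_iff)
    also have "\<dots> \<le> 12 * real d * T\<^sup>2 + 2 * (C1 * real N powr (\<epsilon> + E * u)) / T"
      using X1 X2c \<Theta>c T by (intro add_mono) (auto simp: field_simps)
    also have "T\<^sup>2 = real N powr (2 * t)" by (simp add: T_def power2_eq_square flip: powr_add)
    also have "2 * (C1 * real N powr (\<epsilon> + E * u)) / T = 2 * C1 * real N powr (\<epsilon> + E * u - t)"
      by (simp add: T_def powr_diff)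
    also have "12 * real d * real N powr (2 * t) + 2 * C1 * real N powr (\<epsilon> + E * u - t)
      \<le> 12 * real d * real N powr (\<epsilon> + max (E * u - 1) (2 * E * u / 3)) + 2 * C1 * real N powr (\<epsilon> + max (E * u - 1) (2 * E * u / 3))"
      using N1 C1 t \<epsilon> by (intro add_mono mult_left_mono powr_mono) (auto simp: t_def)
    also have "\<dots> = C * real N powr (\<epsilon> + max (E * u - 1) (2 * E * u / 3))" by (simp add: C_def distrib_right)
    finally have "finite (idx ` Y) \<and> real (card (idx ` Y)) \<le> C * real N powr (\<epsilon> + max (E * u - 1) (2 * E * u / 3))"
      using X1 fi by (simp add: Yun)
    then show ?thesis by (simp add: idx_def Y_def V_def N_def q_def)
  qed
  then show ?thesis using C by blast
qed

section \<open>Hausdorff dimension\<close>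

text \<open>A covering argument of Borel-Cantelli type: each point of \<open>A\<close> lies in cells
  of arbitrarily high generation, so the generations from \<open>K0\<close> on cover
  \<open>A\<close>, and their total cost is the tail of a geometric series.\<close>

lemma hausdorff_measure_limsup_zero:
  fixes A :: "real set" and J :: "nat \<Rightarrow> int set" and q :: "nat \<Rightarrow> real"
  assumes t: "t > 0" and \<rho>: "0 \<le> \<rho>" "\<rho> < 1" and C: "C \<ge> 0"
    and fin: "\<And>K. finite (J K)" and q: "\<And>K. q K \<ge> 2 ^ K"
    and cov: "\<And>x K0. x \<in> A \<Longrightarrow> \<exists>K\<ge>K0. \<lfloor>x * q K\<rfloor> \<in> J K"
    and small: "\<And>K. real (card (J K)) * (1 / q K) powr t \<le> C * \<rho> ^ K"
  shows "hausdorff_measure t A = 0"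
proof -
  have q0: "q K > 0" for K using q[of K] zero_less_power[of "2::real" K] by linarith
  have "hausdorff_premeasure t \<delta> A \<le> 0" if \<delta>: "\<delta> > 0" for \<delta>
  proof (rule ennreal_le_epsilon)
    fix \<eta> :: real assume \<eta>: "\<eta> > 0"
    have "(\<lambda>K. C * \<rho> ^ K / (1 - \<rho>)) \<longlonglongrightarrow> C * 0 / (1 - \<rho>)"
      using \<rho> by (intro tendsto_intros LIMSEQ_realpow_zero) auto
    then have "eventually (\<lambda>K. C * \<rho> ^ K / (1 - \<rho>) < \<eta>) sequentially"
      using \<eta> by (intro order_tendstoD(2)) auto
    moreover have "(\<lambda>K. (1 / 2 :: real) ^ K) \<longlonglongrightarrow> 0" by (intro LIMSEQ_realpow_zero) auto
    then have "eventually (\<lambda>K. (1 / 2 :: real) ^ K < \<delta>) sequentially"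
      using \<delta> by (intro order_tendstoD(2)) auto
    ultimately have "eventually (\<lambda>K. C * \<rho> ^ K / (1 - \<rho>) < \<eta> \<and> (1 / 2 :: real) ^ K < \<delta>) sequentially"
      by (rule eventually_conj)
    then obtain K0 where K0: "C * \<rho> ^ K0 / (1 - \<rho>) < \<eta>" "(1 / 2 :: real) ^ K0 < \<delta>"
      by (auto simp: eventually_sequentially)
    have "\<forall>K. \<exists>f. bij_betw f {0..<card (J K)} (J K)" using ex_bij_betw_nat_finite[OF fin] by blast
    then obtain f where f: "\<And>K. bij_betw (f K) {0..<card (J K)} (J K)" by metis
    define I where "I K j = (if j < card (J K) then {real_of_int (f K j) / q K..(real_of_int (f K j) + 1) / q K} else {})" for K j
    \<comment> \<open>All cells of all generations from \<open>K0\<close> on in one sequence, by the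
      pairing function; surplus indices carry the empty set, whose \<open>diam_pow\<close> is
      0.\<close>
    define U where "U n = (case prod_decode n of (m, j) \<Rightarrow> I (K0 + m) j)" for n
    have dI: "diameter (I K j) \<le> 1 / q K" for K j
      using q0[of K] by (auto simp: I_def diff_divide_distrib[symmetric] divide_right_mono)
    have "U \<in> delta_covers \<delta> A"
      unfolding delta_covers_def
    proof (intro CollectI conjI allI subsetI)
      fix x assume "x \<in> A"
      then obtain K where K: "K \<ge> K0" "\<lfloor>x * q K\<rfloor> \<in> J K" using cov by blast
      then obtain j where j: "j < card (J K)" "f K j = \<lfloor>x * q K\<rfloor>"
        using f[of K] by (auto simp: bij_betw_def image_iff) (metis atLeastLessThan_iff imageE)
      have "real_of_int \<lfloor>x * q K\<rfloor> \<le> x * q K" "x * q K \<le> real_of_int \<lfloor>x * q K\<rfloor> + 1" by linarith+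
      then have "x \<in> I K j" using j q0[of K] by (simp add: I_def field_simps)
      then have "x \<in> U (prod_encode (K - K0, j))" using K by (simp add: U_def)
      then show "x \<in> (\<Union>n. U n)" by blast
    next
      fix n
      show "bounded (U n)" by (auto simp: U_def I_def split: prod.splits)
    next
      fix n
      obtain m j where mj: "prod_decode n = (m, j)" by fastforce
      have "diameter (U n) \<le> 1 / q (K0 + m)" using dI by (simp add: U_def mj)
      also have "\<dots> \<le> 1 / 2 ^ K0"
      proof (intro divide_left_mono)
        have "(2::real) ^ K0 \<le> 2 ^ (K0 + m)" by (intro power_increasing) auto
        then show "2 ^ K0 \<le> q (K0 + m)" using q[of "K0 + m"] by linarith
      qed (use q0 in auto)
      also have "\<dots> \<le> \<delta>" using K0(2) by (simp add: power_one_over)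
      finally show "diameter (U n) \<le> \<delta>" .
    qed
    then have "hausdorff_premeasure t \<delta> A \<le> (\<Sum>n. diam_pow t (U n))"
      unfolding hausdorff_premeasure_def by (rule INF_lower)
    also have "\<dots> = (\<Sum>n. (\<lambda>(m, j). diam_pow t (I (K0 + m) j)) (prod_decode n))"
      by (simp add: U_def case_prod_unfold)
    also have "\<dots> = (\<Sum>m. \<Sum>j. diam_pow t (I (K0 + m) j))"
      unfolding suminf_ennreal_2dimen[of "\<lambda>m. \<Sum>j. diam_pow t (I (K0 + m) j)" "\<lambda>(m, j). diam_pow t (I (K0 + m) j)", symmetric]
      by (subst suminf_ennreal_2dimen[of "\<lambda>m. \<Sum>j. diam_pow t (I (K0 + m) j)" "\<lambda>(m, j). diam_pow t (I (K0 + m) j)"]) auto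
    also have "\<dots> \<le> (\<Sum>m. ennreal (C * \<rho> ^ (K0 + m)))"
    proof (intro suminf_le summableI)
      fix m
      let ?K = "K0 + m"
      have "(\<Sum>j. diam_pow t (I ?K j)) = (\<Sum>j<card (J ?K). diam_pow t (I ?K j))"
        by (intro suminf_finite) (auto simp: I_def diam_pow_def)
      also have "\<dots> \<le> (\<Sum>j<card (J ?K). ennreal ((1 / q ?K) powr t))"
      proof (intro sum_mono)
        fix j
        show "diam_pow t (I ?K j) \<le> ennreal ((1 / q ?K) powr t)"
          unfolding diam_pow_def using t dI[of ?K j] diameter_ge_0[of "I ?K j"]
          by (auto intro!: ennreal_leI powr_mono2 simp: I_def)
      qed
      also have "\<dots> = ennreal (real (card (J ?K)) * (1 / q ?K) powr t)"
        by (simp add: ennreal_mult' ennreal_of_nat_eq_real_of_nat)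
      also have "\<dots> \<le> ennreal (C * \<rho> ^ ?K)" by (intro ennreal_leI small)
      finally show "(\<Sum>j. diam_pow t (I ?K j)) \<le> ennreal (C * \<rho> ^ ?K)" .
    qed
    also have "\<dots> = ennreal (C * \<rho> ^ K0 / (1 - \<rho>))"
    proof (rule suminf_ennreal_eq)
      show "0 \<le> C * \<rho> ^ (K0 + m)" for m using C \<rho> by simp
      have "(\<lambda>m. C * \<rho> ^ K0 * \<rho> ^ m) sums (C * \<rho> ^ K0 * (1 / (1 - \<rho>)))"
        using \<rho> by (intro sums_mult geometric_sums) auto
      then show "(\<lambda>m. C * \<rho> ^ (K0 + m)) sums (C * \<rho> ^ K0 / (1 - \<rho>))"
        by (simp add: power_add mult.assoc)
    qed
    also have "\<dots> \<le> ennreal \<eta>" using K0(1) by (intro ennreal_leI) simp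
    finally show "hausdorff_premeasure t \<delta> A \<le> 0 + ennreal \<eta>" by simp
  qed
  then have "hausdorff_measure t A \<le> 0"
    unfolding hausdorff_measure_def by (intro SUP_least) auto
  then show ?thesis by simp
qed

lemma hausdorff_dim_le:
  assumes "t \<ge> 0" "hausdorff_measure t A = 0"
  shows "hausdorff_dim A \<le> ereal t"
  unfolding hausdorff_dim_def using assms by (intro Inf_lower) auto

text \<open>\<open>k\<close> is a minimiser in the definition of \<open>s0\<close>. The second bound
  holds because every term of that minimum is at least 2, and then it reduces to (d - 2) (d - 3)
  \<ge> 0 for integers d \<ge> 2.\<close>

lemma s0_props:
  assumes d: "2 \<le> d"
  obtains k where "1 \<le> k" "k \<le> d" "real d * (real d + 1) - s0 d = (real k - 1) * (2 * real d + 2 - real k) / real k"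
    "2 * (real d * (real d + 1)) / 3 \<le> s0 d"
proof -
  define f where "f r = (2 * real d + (real r - 1) * (real r - 2)) / real r" for r :: nat
  have "Min (f ` {1..d}) \<in> f ` {1..d}" using d by (intro Min_in) auto
  then obtain k where k: "1 \<le> k" "k \<le> d" "Min (f ` {1..d}) = f k" by auto
  have s0: "s0 d = real d * (real d - 1) + f k" using k(3) by (simp add: s0_def f_def)
  have eq: "real d * (real d + 1) - s0 d = (real k - 1) * (2 * real d + 2 - real k) / real k"
    using k(1) by (simp add: s0 f_def field_simps)
  have "2 * real k \<le> 2 * real d + (real k - 1) * (real k - 2)"
  proof -
    have "0 \<le> (real k - 1) * (real k - 2)"
    proof (cases "k = 1")
      case False
      then show ?thesis using k by (intro mult_nonneg_nonneg) auto
    qed simp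
    then show ?thesis using k by simp
  qed
  then have f2: "f k \<ge> 2" using k(1) by (simp add: f_def field_simps)
  have "0 \<le> (real d - 2) * (real d - 3)"
  proof (cases "d = 2")
    case False
    then show ?thesis using d by (intro mult_nonneg_nonneg) auto
  qed simp
  then have "2 * (real d * (real d + 1)) / 3 \<le> s0 d" using f2 by (simp add: s0 field_simps)
  then show ?thesis using that k eq by blast
qed

text \<open>The two counts are exchanged at the value of \<open>u\<close> where \<open>u\<close>
  times the gap d (d + 1) - s0 equals 1. Below it the bound E u - 1 by translations is at most s0 u.
  Above it the count with fewer equations is at most N^(s0 u), up to N^\<epsilon>.\<close>

lemma cover_bound:
  assumes d: "2 \<le> d" and u: "u > 0" and \<epsilon>: "\<epsilon> > 0"
  shows "\<exists>C>0. \<exists>q :: nat \<Rightarrow> nat. \<forall>K. real (q K) \<ge> (2 ^ K) ^ d \<and>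
     finite ((\<lambda>x. \<lfloor>x * real (q K)\<rfloor>) ` large_pts d ((2 ^ K) powr (1 - u) / 2) (2 ^ K)) \<and>
     real (card ((\<lambda>x. \<lfloor>x * real (q K)\<rfloor>) ` large_pts d ((2 ^ K) powr (1 - u) / 2) (2 ^ K)))
       \<le> C * (2 ^ K) powr (\<epsilon> + s0 d * u)"
proof -
  obtain k where k: "1 \<le> k" "k \<le> d" and s: "real d * (real d + 1) - s0 d = (real k - 1) * (2 * real d + 2 - real k) / real k"
    and s23: "2 * (real d * (real d + 1)) / 3 \<le> s0 d" using s0_props[OF d] by blast
  have weaken: "\<exists>C>0. \<exists>q :: nat \<Rightarrow> nat. \<forall>K. real (q K) \<ge> (2 ^ K) ^ d \<and>
     finite ((\<lambda>x. \<lfloor>x * real (q K)\<rfloor>) ` large_pts d ((2 ^ K) powr (1 - u) / 2) (2 ^ K)) \<and>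
     real (card ((\<lambda>x. \<lfloor>x * real (q K)\<rfloor>) ` large_pts d ((2 ^ K) powr (1 - u) / 2) (2 ^ K)))
       \<le> C * (2 ^ K) powr (\<epsilon> + s0 d * u)"
    if C: "C > 0" and b: "b \<le> \<epsilon> + s0 d * u" and q: "\<And>K. real (q K) \<ge> (2 ^ K) ^ d"
      and le: "\<And>K. finite ((\<lambda>x. \<lfloor>x * real (q K)\<rfloor>) ` large_pts d ((2 ^ K) powr (1 - u) / 2) (2 ^ K)) \<and>
     real (card ((\<lambda>x. \<lfloor>x * real (q K)\<rfloor>) ` large_pts d ((2 ^ K) powr (1 - u) / 2) (2 ^ K))) \<le> C * (2 ^ K) powr b"
     for C b and q :: "nat \<Rightarrow> nat"
  proof (intro exI[of _ C] conjI C exI[of _ q] allI)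
    fix K
    have "C * (2 ^ K) powr b \<le> C * (2 ^ K) powr (\<epsilon> + s0 d * u)"
      using C b by (intro mult_left_mono powr_mono) auto
    then show "real (card ((\<lambda>x. \<lfloor>x * real (q K)\<rfloor>) ` large_pts d ((2 ^ K) powr (1 - u) / 2) (2 ^ K)))
       \<le> C * (2 ^ K) powr (\<epsilon> + s0 d * u)" using le[of K] by linarith
    show "finite ((\<lambda>x. \<lfloor>x * real (q K)\<rfloor>) ` large_pts d ((2 ^ K) powr (1 - u) / 2) (2 ^ K))" using le by blast
  qed (rule q)
  show ?thesis
  proof (cases "u * (real d * (real d + 1) - s0 d) \<le> 1")
    case True
    obtain C where C: "C > 0" "\<forall>K u. u > 0 \<longrightarrow> finite ((\<lambda>x. \<lfloor>x * real (modl d d (2 * 2 ^ K) d)\<rfloor>) ` large_pts d ((2 ^ K) powr (1 - u) / 2) (2 ^ K)) \<and>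
     real (card ((\<lambda>x. \<lfloor>x * real (modl d d (2 * 2 ^ K) d)\<rfloor>) ` large_pts d ((2 ^ K) powr (1 - u) / 2) (2 ^ K)))
       \<le> C * (2 ^ K) powr (\<epsilon> + max (real d * (real d + 1) * u - 1) (2 * (real d * (real d + 1)) * u / 3))"
      using count_shifts[OF d \<epsilon>] by (elim exE conjE) (rule that)
    show ?thesis
    proof (rule weaken[OF C(1), where q = "\<lambda>K. modl d d (2 * 2 ^ K) d"])
      have "real d * (real d + 1) * u - 1 \<le> s0 d * u" using True by (simp add: algebra_simps)
      moreover have "2 * (real d * (real d + 1)) * u / 3 \<le> s0 d * u"
        using mult_right_mono[OF s23, of u] u by simp
      ultimately show "\<epsilon> + max (real d * (real d + 1) * u - 1) (2 * (real d * (real d + 1)) * u / 3) \<le> \<epsilon> + s0 d * u" by simp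
      fix K
      have "(2 ^ K) ^ d \<le> (2 * 2 ^ K :: real) ^ d" by (intro power_mono) auto
      also have "\<dots> \<le> real (tri d) * (2 * 2 ^ K) ^ d" using tri_pos[of d] d by simp
      also have "\<dots> \<le> real (modl d d (2 * 2 ^ K) d)" by (simp add: modl_def expo_def)
      finally show "(2 ^ K) ^ d \<le> real (modl d d (2 * 2 ^ K) d)" .
    qed (use C(2) u in blast)
  next
    case False
    define r where "r = d + 1 - k"
    have r: "1 \<le> r" "r \<le> d" "real r = real d + 1 - real k" using k by (auto simp: r_def of_nat_diff)
    obtain C where C: "C > 0" "\<forall>K u. finite ((\<lambda>x. \<lfloor>x * real (modl r d (2 ^ K) r)\<rfloor>) ` large_pts d ((2 ^ K) powr (1 - u) / 2) (2 ^ K)) \<and>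
     real (card ((\<lambda>x. \<lfloor>x * real (modl r d (2 ^ K) r)\<rfloor>) ` large_pts d ((2 ^ K) powr (1 - u) / 2) (2 ^ K)))
       \<le> C * (2 ^ K) powr (\<epsilon> + (real d - real r) + real r * (real r + 1) * u)"
      using count_fewer_equations[OF r(1,2) \<epsilon>] by (elim exE conjE) (rule that)
    show ?thesis
    proof (rule weaken[OF C(1), where q = "\<lambda>K. modl r d (2 ^ K) r"])
      \<comment> \<open>With \<open>g\<close> the gap, r (r + 1) = d (d + 1) - k g, hence s0 = r (r
        + 1) + (k - 1) g. Since u g > 1 here, s0 u exceeds r (r + 1) u by at least k - 1 = d -
        r.\<close>
      define g where "g = (real k - 1) * (2 * real d + 2 - real k) / real k"
      have kg: "real k * g = (real k - 1) * (2 * real d + 2 - real k)" using k by (simp add: g_def)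
      have s0g: "s0 d = real d * (real d + 1) - g" using s by (simp add: g_def)
      have "real r * (real r + 1) = real d * (real d + 1) - real k * g"
        unfolding r(3) kg by (simp add: algebra_simps)
      then have s0e: "s0 d = real r * (real r + 1) + (real k - 1) * g" using s0g by (simp add: algebra_simps)
      have "s0 d * u = real r * (real r + 1) * u + (real k - 1) * (u * g)"
        unfolding s0e by (simp add: algebra_simps)
      moreover have "u * g > 1" using False s by (simp add: g_def)
      then have "(real k - 1) * 1 \<le> (real k - 1) * (u * g)" using k by (intro mult_left_mono) auto
      ultimately show "\<epsilon> + (real d - real r) + real r * (real r + 1) * u \<le> \<epsilon> + s0 d * u" using r(3) by simp
      fix K
      have "(2 ^ K) ^ d \<le> real (tri r) * (2 ^ K) ^ d" using tri_pos[OF r(1)] by simp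
      also have "\<dots> \<le> real (modl r d (2 ^ K) r)" by (simp add: modl_def expo_def)
      finally show "(2 ^ K) ^ d \<le> real (modl r d (2 ^ K) r)" .
    qed (use C(2) in blast)
  qed
qed

text \<open>A sum of length N is a partial sum at the next power of two above N, which exceeds N by
  a factor of at most 2; this accounts for the halved threshold.\<close>

lemma large_weyl_set_dyadic:
  assumes x: "x \<in> large_weyl_set d \<alpha>" "x < 1" and \<alpha>: "0 < \<alpha>" "\<alpha> < 1"
  shows "\<exists>K\<ge>K0. x \<in> large_pts d ((2 ^ K) powr \<alpha> / 2) (2 ^ K)"
proof -
  have "\<exists>\<^sub>\<infinity>N::nat. norm (weyl d x N) \<ge> real N powr \<alpha>" "0 \<le> x"
    using x by (auto simp: large_weyl_set_def weyl_def)
  then obtain N where N: "N \<ge> 2 ^ K0" "norm (weyl d x N) \<ge> real N powr \<alpha>"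
    unfolding INFM_nat_le by blast
  have "N \<ge> 1" using N(1) one_le_power[of "2::nat" K0] by linarith
  then obtain k where k: "2 ^ k \<le> N" "N < 2 ^ (k + 1)" using ex_power_ivl1[of 2 N] by auto
  have "(2::nat) ^ K0 < 2 ^ (k + 1)" using N(1) k(2) by linarith
  then have K: "K0 \<le> k + 1" using power_less_imp_less_exp[of "2::nat" K0 "k + 1"] by simp
  have "(2 ^ (k + 1)) powr \<alpha> / 2 \<le> (2 ^ (k + 1) :: real) powr \<alpha> / 2 powr \<alpha>"
  proof (intro divide_left_mono)
    show "2 powr \<alpha> \<le> (2::real)" using \<alpha> powr_mono[of \<alpha> 1 "2::real"] by simp
  qed auto
  also have "\<dots> = (2 ^ k) powr \<alpha>" by (simp add: powr_mult)
  also have "\<dots> \<le> real N powr \<alpha>"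
  proof (intro powr_mono2)
    have "real (2 ^ k) \<le> real N" using k(1) by (simp only: of_nat_le_iff)
    then show "2 ^ k \<le> real N" by simp
  qed (use \<alpha> in auto)
  finally have "(2 ^ (k + 1)) powr \<alpha> / 2 \<le> norm (weyl d x N)" using N(2) by linarith
  then have "x \<in> large_pts d ((2 ^ (k + 1)) powr \<alpha> / 2) (2 ^ (k + 1))"
    using x(2) \<open>0 \<le> x\<close> k(2) by (auto simp: large_pts_def intro!: exI[of _ N])
  then show ?thesis using K by blast
qed

text \<open>At scale 2^K there are about 2^(K s0 u) cells of length at most 2^(-K d), so their t-th
  powers are summable over K once d t > s0 u.\<close>

lemma hausdorff_measure_large_weyl_set:
  assumes d: "2 \<le> d" and \<alpha>: "0 < \<alpha>" "\<alpha> < 1" and t: "t > s0 d * (1 - \<alpha>) / real d"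
  shows "hausdorff_measure t (large_weyl_set d \<alpha>) = 0"
proof -
  define u where "u = 1 - \<alpha>"
  have u: "u > 0" using \<alpha> by (simp add: u_def)
  have s0: "s0 d \<ge> 0"
  proof -
    obtain k where "2 * (real d * (real d + 1)) / 3 \<le> s0 d" using s0_props[OF d] by blast
    moreover have "0 \<le> 2 * (real d * (real d + 1)) / 3" by simp
    ultimately show ?thesis by linarith
  qed
  have su: "0 \<le> s0 d * u" using s0 u by simp
  have d0: "real d > 0" using d by simp
  have dt: "s0 d * u < real d * t" using t d0 by (simp add: u_def field_simps)
  have t0: "t > 0" using dt su d0 by (metis le_less_trans zero_less_mult_pos)
  \<comment> \<open>Half of the available room: one half is lost in the count of cells, the other
    makes the series geometric.\<close>
  define \<epsilon> where "\<epsilon> = (real d * t - s0 d * u) / 2"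
  have \<epsilon>: "\<epsilon> > 0" using dt by (simp add: \<epsilon>_def)
  obtain C q where C: "C > 0" and q: "\<And>K. real (q K) \<ge> (2 ^ K) ^ d"
    and fin: "\<And>K. finite ((\<lambda>x. \<lfloor>x * real (q K)\<rfloor>) ` large_pts d ((2 ^ K) powr (1 - u) / 2) (2 ^ K))"
    and card: "\<And>K. real (card ((\<lambda>x. \<lfloor>x * real (q K)\<rfloor>) ` large_pts d ((2 ^ K) powr (1 - u) / 2) (2 ^ K)))
       \<le> C * (2 ^ K) powr (\<epsilon> + s0 d * u)"
    using cover_bound[OF d u \<epsilon>] by blast
  \<comment> \<open>The extra label is the cell of \<open>x = 1\<close>, which the half-open range
    in \<open>large_pts\<close> leaves out.\<close>
  define J where "J K = insert (int (q K)) ((\<lambda>x. \<lfloor>x * real (q K)\<rfloor>) ` large_pts d ((2 ^ K) powr (1 - u) / 2) (2 ^ K))" for K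
  define \<rho> where "\<rho> = 2 powr (- \<epsilon>)"
  have \<rho>: "0 \<le> \<rho>" "\<rho> < 1" using \<epsilon> powr_less_mono[of "- \<epsilon>" 0 "2::real"] by (auto simp: \<rho>_def)
  show ?thesis
  proof (rule hausdorff_measure_limsup_zero[OF t0 \<rho>, of "C + 1" J "\<lambda>K. real (q K)"])
    show "0 \<le> C + 1" using C by simp
    show "finite (J K)" for K using fin by (simp add: J_def)
    show "2 ^ K \<le> real (q K)" for K
    proof -
      have "(2 ^ K) ^ 1 \<le> (2 ^ K :: real) ^ d" using d by (intro power_increasing) auto
      also have "\<dots> \<le> real (q K)" by (rule q)
      finally show ?thesis by (simp only: power_one_right)
    qed
    show "\<exists>K\<ge>K0. \<lfloor>x * real (q K)\<rfloor> \<in> J K" if x: "x \<in> large_weyl_set d \<alpha>" for x K0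
    proof (cases "x < 1")
      case True
      then show ?thesis using large_weyl_set_dyadic[OF x True \<alpha>, of K0] by (auto simp: J_def u_def)
    next
      case False
      then have "x = 1" using x by (auto simp: large_weyl_set_def)
      then show ?thesis by (intro exI[of _ K0]) (simp add: J_def)
    qed
    fix K
    have "real (card (J K)) \<le> real (card ((\<lambda>x. \<lfloor>x * real (q K)\<rfloor>) ` large_pts d ((2 ^ K) powr (1 - u) / 2) (2 ^ K))) + 1"
      unfolding J_def using fin[of K] by (simp add: card_insert_if)
    also have "\<dots> \<le> C * (2 ^ K) powr (\<epsilon> + s0 d * u) + (2 ^ K) powr (\<epsilon> + s0 d * u)"
      using card[of K] \<epsilon> su by (intro add_mono) (auto intro!: ge_one_powr_ge_zero)
    finally have c: "real (card (J K)) \<le> (C + 1) * (2 ^ K) powr (\<epsilon> + s0 d * u)" by (simp add: distrib_right)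
    have "(1 / real (q K)) powr t \<le> (1 / (2 ^ K) ^ d) powr t"
    proof (intro powr_mono2 divide_left_mono)
      have "0 < real (q K)" by (rule less_le_trans[OF _ q]) simp
      then show "0 < real (q K) * (2 ^ K) ^ d" by simp
    qed (use t0 q[of K] in auto)
    also have "\<dots> = (2 ^ K) powr (- (real d * t))"
      by (simp add: powr_divide powr_minus_divide powr_powr mult.assoc flip: powr_realpow)
    finally have p: "(1 / real (q K)) powr t \<le> (2 ^ K) powr (- (real d * t))" .
    have "real (card (J K)) * (1 / real (q K)) powr t \<le> ((C + 1) * (2 ^ K) powr (\<epsilon> + s0 d * u)) * (2 ^ K) powr (- (real d * t))"
      using C by (intro mult_mono c p) auto
    also have "\<dots> = (C + 1) * (2 ^ K) powr (\<epsilon> + s0 d * u - real d * t)"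
      by (simp add: powr_add[symmetric])
    also have "\<epsilon> + s0 d * u - real d * t = - \<epsilon>" by (simp add: \<epsilon>_def field_simps)
    also have "(2 ^ K :: real) powr (- \<epsilon>) = \<rho> ^ K"
      by (simp add: \<rho>_def powr_powr mult.commute flip: powr_realpow)
    finally show "real (card (J K)) * (1 / real (q K)) powr t \<le> (C + 1) * \<rho> ^ K" .
  qed
qed

lemma hausdorff_measure_unit_interval:
  fixes A :: "real set"
  assumes A: "A \<subseteq> {0..1}" and t: "t > 1"
  shows "hausdorff_measure t A = 0"
proof (rule hausdorff_measure_limsup_zero[of t "2 powr (1 - t)" 2 "\<lambda>K. {0..2 ^ K}" "\<lambda>K. 2 ^ K"])
  show "2 powr (1 - t) < 1" using t powr_less_mono[of "1 - t" 0 "2::real"] by simp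
  show "\<exists>K\<ge>K0. \<lfloor>x * 2 ^ K\<rfloor> \<in> {0..2 ^ K}" if "x \<in> A" for x K0
  proof (intro exI[of _ K0] conjI)
    have x: "0 \<le> x" "x \<le> 1" using A that by auto
    then have "x * 2 ^ K0 \<le> 1 * 2 ^ K0" by (intro mult_right_mono) auto
    then have "\<lfloor>x * 2 ^ K0\<rfloor> \<le> \<lfloor>real_of_int (2 ^ K0)\<rfloor>" by (intro floor_mono) simp
    then have "\<lfloor>x * 2 ^ K0\<rfloor> \<le> 2 ^ K0" by (simp only: floor_of_int)
    then show "\<lfloor>x * 2 ^ K0\<rfloor> \<in> {0..2 ^ K0}" using x by simp
  qed simp
  fix K
  have "real (card {0..(2::int) ^ K}) = 2 ^ K + 1" by (simp add: nat_add_distrib nat_power_eq)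
  also have "\<dots> \<le> 2 * 2 ^ K" by simp
  finally have "real (card {0..(2::int) ^ K}) * (1 / 2 ^ K) powr t \<le> 2 * 2 ^ K * (1 / 2 ^ K) powr t"
    by (intro mult_right_mono) auto
  also have "\<dots> = 2 * (2 powr real K * (1 / 2 powr real K) powr t)" by (simp add: powr_realpow)
  also have "2 powr real K * (1 / 2 powr real K) powr t = 2 powr (real K * (1 - t))"
    by (simp add: powr_divide powr_powr powr_diff right_diff_distrib)
  also have "\<dots> = (2 powr (1 - t)) ^ K" by (simp add: powr_powr mult.commute flip: powr_realpow)
  finally show "real (card {0..(2::int) ^ K}) * (1 / 2 ^ K) powr t \<le> 2 * (2 powr (1 - t)) ^ K" .
qed (use t in auto)

theorem theorem3p3:
  fixes d :: nat and \<alpha> :: real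
  assumes "d \<ge> 2" and "1/2 < \<alpha>" and "\<alpha> < 1"
  shows "hausdorff_dim (large_weyl_set d \<alpha>)
           \<le> ereal ((1 + s0 d) * (1 - \<alpha>) / (real d + 1 - \<alpha>))"
proof (rule ccontr)
  define B where "B = (1 + s0 d) * (1 - \<alpha>) / (real d + 1 - \<alpha>)"
  assume "\<not> hausdorff_dim (large_weyl_set d \<alpha>) \<le> ereal ((1 + s0 d) * (1 - \<alpha>) / (real d + 1 - \<alpha>))"
  then have "ereal B < hausdorff_dim (large_weyl_set d \<alpha>)" by (simp add: B_def not_le)
  then obtain t where t: "B < t" "ereal t < hausdorff_dim (large_weyl_set d \<alpha>)"
    using ereal_dense2 by fastforce
  define u where "u = 1 - \<alpha>"
  have u: "u > 0" using assms by (simp add: u_def)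
  have B: "B = (1 + s0 d) * u / (real d + u)" by (simp add: B_def u_def)
  have du: "real d + u > 0" "real d > 0" using assms u by auto
  have "t \<ge> 0 \<and> hausdorff_measure t (large_weyl_set d \<alpha>) = 0"
  \<comment> \<open>\<open>B\<close> is the mediant of s0 u / d and u / u = 1. If the first quotient
    is below 1, it is at most \<open>B\<close> and the count of cells suffices; otherwise
    \<open>B \<ge> 1\<close>, and the dimension of the unit interval does.\<close>
  proof (cases "s0 d * u < real d")
    case True
    obtain k where "2 * (real d * (real d + 1)) / 3 \<le> s0 d" using s0_props[OF assms(1)] by blast
    moreover have "0 \<le> 2 * (real d * (real d + 1)) / 3" by simp
    ultimately have s0: "0 \<le> s0 d" by linarith
    have "s0 d * u * (real d + u) \<le> (1 + s0 d) * u * real d"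
      using mult_right_mono[of "s0 d * u" "real d" u] True u by (simp add: algebra_simps)
    then have "s0 d * u / real d \<le> B" unfolding B using du by (simp add: divide_simps)
    then have t': "t > s0 d * (1 - \<alpha>) / real d" using t(1) by (simp add: u_def)
    moreover have "0 \<le> s0 d * (1 - \<alpha>) / real d" using s0 u by (simp add: u_def)
    ultimately show ?thesis using hausdorff_measure_large_weyl_set[OF assms(1) _ assms(3) t'] assms(2) by simp
  next
    case False
    then have "1 * (real d + u) \<le> (1 + s0 d) * u" by (simp add: algebra_simps)
    then have "1 \<le> B" unfolding B using du by (simp add: pos_le_divide_eq)
    then have "t > 1" using t(1) by linarith
    moreover have "large_weyl_set d \<alpha> \<subseteq> {0..1}" by (auto simp: large_weyl_set_def)
    ultimately show ?thesis using hausdorff_measure_unit_interval by auto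
  qed
  then have "hausdorff_dim (large_weyl_set d \<alpha>) \<le> ereal t" by (intro hausdorff_dim_le) auto
  then show False using t(2) by simp
qed

end
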